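(* Let $I\subset\mathbb R$ be an interval and $t_0\in I$. Let $(\gamma_h,\gamma_h^d):I\to\Delta_1$ and $(\gamma_d,\gamma_d^h):I\to\overline\Delta_1$ be spacelike Legendre curves with curvatures $(m_h,n_h)$ and $(m_d,n_d)$, and let $(\gamma_T,\gamma_T^d):I\to\Delta_5$ be a timelike Legendre curve with curvature $(m_T,n_T)$; assume that each of the sets $\{m_h\ne0\},\{n_h\neq0\},\{m_d\neq0\},\{n_d\neq0\},\{n_T\neq0\}$ is dense in $I$. Write $\gamma_h^s=\gamma_h\wedge\gamma_h^d$, $\gamma_d^s=\gamma_d\wedge\gamma_d^h$, $\gamma_T^h=\gamma_T\wedge\gamma_T^d$. With the constructions in the context applied to the indicated Legendre curves, the following hold (in each formula upper signs go together and lower signs go together). (1) Suppose that there exists a smooth $f:I\to\mathbb R$ such that $m_h(t)+f(t)n_h(t)=0$ for all $t\in I$ and that $\{t\in I: n_h(t)\pm m_h(t)\neq0\}$ is dense in $I$. Then $$(\mathcal{HE}^\pm,\mathcal{DE}^\pm,\mu_{\mathcal E}^\pm)\big(\mathcal{HI}^\pm_{s_\pm}(\gamma_h,\gamma_h^d),\nu^\pm_{\mathcal{HI}}(\gamma_h,\gamma_h^d)\big)=(\gamma_h,\gamma_h^d,\gamma_h^s),$$ $$(\mathcal{HE}^\pm,\mathcal{DE}^\pm,\mu_{\mathcal E}^\pm)\big(\mathcal{HI}^\mp_{s_\mp}(\gamma_h,\gamma_h^d),-\nu^\mp_{\mathcal{HI}}(\gamma_h,\gamma_h^d)\big)=(\gamma_h,-\gamma_h^d,-\gamma_h^s),$$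 $$(\mathcal{HI}^\pm_{S^\pm_{\mathcal{HE}}},\nu^\pm_{\mathcal{HI}},\mu^\pm_{\mathcal{HI}})\big(\mathcal{HE}^\pm(\gamma_h,\gamma_h^d),\mathcal{DE}^\pm(\gamma_h,\gamma_h^d)\big)=(\mathcal{HP}^\pm_{f-S^\pm_{\mathcal{HE}}},\nu^\pm_{\mathcal{HP}},\mu^\pm_{\mathcal{HP}})(\gamma_h,\gamma_h^d),$$ $$(\mathcal{HI}^\pm_{\overline S^\pm_{\mathcal{HE}}},\nu^\pm_{\mathcal{HI}},\mu^\pm_{\mathcal{HI}})\big(\mathcal{HE}^\mp(\gamma_h,\gamma_h^d),-\mathcal{DE}^\mp(\gamma_h,\gamma_h^d)\big)=(\mathcal{HP}^\mp_{f+\overline S^\pm_{\mathcal{HE}}},-\nu^\mp_{\mathcal{HP}},-\mu^\mp_{\mathcal{HP}})(\gamma_h,\gamma_h^d),$$ where $\overline S^\pm_{\mathcal{HE}}(t)=-S^\mp_{\mathcal{HE}}(t)$ and $S^\pm_{\mathcal{HE}}$ is a solution of the Riccati equation $$\frac{dS^\pm_{\mathcal{HE}}}{dt}(t)=\frac{m^\pm_{\mathcal{HE}}(t)\pm n^\pm_{\mathcal{HE}}(t)}{2}(S^\pm_{\mathcal{HE}})^2(t)-m^\pm_{\mathcal{HE}}(t),$$ with $(m^\pm_{\mathcal{HE}},n^\pm_{\mathcal{HE}})=\left(-\dot f\pm\frac{f^2n_h}{2},\ \pm\dot f-\frac{f^2n_h}{2}+n_h\right)$ the curvature of $(\mathcal{HE}^\pm,\mathcal{DE}^\pm)(\gamma_h,\gamma_h^d)$.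 (2) Suppose that there exists a smooth $\overline f:I\to\mathbb R$ such that $m_d(t)+\overline f(t)n_d(t)=0$ for all $t\in I$ and that $\{t\in I:n_d(t)\mp m_d(t)\neq0\}$ is dense in $I$. Then $$(\widetilde{\mathcal{DE}}^\pm,\widetilde{\mathcal{HE}}^\pm,\widetilde\mu^\pm_{\mathcal E})\big(\overline{\mathcal{DI}}^\pm_{\overline s_\pm}(\gamma_d,\gamma_d^h),\overline\nu^\pm_{\mathcal{DI}}(\gamma_d,\gamma_d^h)\big)=(\gamma_d,\gamma_d^h,\gamma_d^s),$$ $$(\widetilde{\mathcal{DE}}^\pm,\widetilde{\mathcal{HE}}^\pm,\widetilde\mu^\pm_{\mathcal E})\big(\overline{\mathcal{DI}}^\mp_{\overline s_\mp}(\gamma_d,\gamma_d^h),-\overline\nu^\mp_{\mathcal{DI}}(\gamma_d,\gamma_d^h)\big)=(\gamma_d,-\gamma_d^h,-\gamma_d^s),$$ $$(\overline{\mathcal{DI}}^\pm_{\overline S^\pm_{\mathcal{DE}}},\overline\nu^\pm_{\mathcal{DI}},\overline\mu^\pm_{\mathcal{DI}})\big(\widetilde{\mathcal{DE}}^\pm(\gamma_T,\gamma_T^d),\widetilde{\mathcal{HE}}^\pm(\gamma_T,\gamma_T^d)\big)=(\widetilde{\mathcal{DP}}^\pm_{\overline f-\overline S^\pm_{\mathcal{DE}}},\widetilde\nu^\pm_{\mathcal{DP}},\widetilde\mu^\pm_{\mathcal{DP}})(\gamma_T,\gamma_T^d),$$ $$(\overline{\mathcal{DI}}^\pm_{\overline{\overline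 S}^\pm_{\mathcal{DE}}},\overline\nu^\pm_{\mathcal{DI}},\overline\mu^\pm_{\mathcal{DI}})\big(\widetilde{\mathcal{DE}}^\mp(\gamma_T,\gamma_T^d),-\widetilde{\mathcal{HE}}^\mp(\gamma_T,\gamma_T^d)\big)=(\widetilde{\mathcal{DP}}^\mp_{\overline f+\overline{\overline S}^\pm_{\mathcal{DE}}},-\widetilde\nu^\mp_{\mathcal{DP}},-\widetilde\mu^\mp_{\mathcal{DP}})(\gamma_T,\gamma_T^d),$$ where $\overline{\overline S}^\pm_{\mathcal{DE}}(t)=-\overline S^\mp_{\mathcal{DE}}(t)$ and $\overline S^\pm_{\mathcal{DE}}$ is a solution of the Riccati equation $$\frac{d\overline S^\pm_{\mathcal{DE}}}{dt}(t)=\frac{\widetilde m^\pm_{\mathcal{DE}}(t)\pm\widetilde n^\pm_{\mathcal{DE}}(t)}{2}(\overline S^\pm_{\mathcal{DE}})^2(t)-\widetilde m^\pm_{\mathcal{DE}}(t),$$ with $(\widetilde m^\pm_{\mathcal{DE}},\widetilde n^\pm_{\mathcal{DE}})=\left(\dot{\widetilde f}\pm\frac{\widetilde f^2n_T}{2},\ \pm\dot{\widetilde f}+\frac{\widetilde f^2n_T}{2}+n_T\right)$ the curvature of $(\widetilde{\mathcal{DE}}^\pm,\widetilde{\mathcal{HE}}^\pm)(\gamma_T,\gamma_T^d)$, where $m_T+\widetilde fn_T=0$. (3) Suppose that there exists a smooth $\varphi:I\to\mathbb R$ such that $m_h\cosh\varphi+n_h\sinh\varphi=0$ on $I$. Then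 $$(HE,\nu_{HE},\mu_{HE})\big(HI_{t_0}(\gamma_h,\gamma_h^d),DI_{t_0}(\gamma_h,\gamma_h^d)\big)=(\gamma_h,\gamma_h^d,\gamma_h^s),$$ $$(HI_{t_0},DI_{t_0},\mu_I)\big(HE(\gamma_h,\gamma_h^d),\nu_{HE}(\gamma_h,\gamma_h^d)\big)=(HP_{\varphi(t_0)},DP_{\varphi(t_0)},\mu_P)(\gamma_h,\gamma_h^d).$$ (4) Suppose that there exists a smooth $\overline\varphi:I\to\mathbb R$ such that $m_d\sinh\overline\varphi+n_d\cosh\overline\varphi=0$ on $I$. Then $$(\overline{HE},\overline\nu_{HE},\overline\mu_{HE})\big(DI_{t_0}(\gamma_h,\gamma_h^d),HI_{t_0}(\gamma_h,\gamma_h^d)\big)=(\gamma_h,\gamma_h^d,\gamma_h^s),$$ $$(DI_{t_0},HI_{t_0},\mu_I)\big(\overline{HE}(\gamma_d,\gamma_d^h),\overline\nu_{HE}(\gamma_d,\gamma_d^h)\big)=(-\overline{DP}_{\overline\varphi(t_0)},\overline{HP}_{\overline\varphi(t_0)},-\overline\mu_P)(\gamma_d,\gamma_d^h).$$ (5) Suppose that there exists a smooth $\overline\psi:I\to\mathbb R$ such that $m_d\cosh\overline\psi+n_d\sinh\overline\psi=0$ on $I$. Then $$(\overline{DE},\overline\nu_{DE},\overline\mu_{DE})\big(\widetilde{DI}_{t_0}(\gamma_T,\gamma_T^d),\widetilde{HI}_{t_0}(\gamma_T,\gamma_T^d)\big)=(\gamma_T,\gamma_T^d,\gamma_T^h),$$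 $$(\widetilde{DI}_{t_0},\widetilde{HI}_{t_0},\widetilde\mu_I)\big(\overline{DE}(\gamma_d,\gamma_d^h),\overline\nu_{DE}(\gamma_d,\gamma_d^h)\big)=(\overline{DP}_{\overline\psi(t_0)},\overline{HP}_{\overline\psi(t_0)},\overline\mu_P)(\gamma_d,\gamma_d^h).$$ (6) Suppose that there exists a smooth $\psi:I\to\mathbb R$ such that $m_h\sinh\psi+n_h\cosh\psi=0$ on $I$. Then $$(DE,\nu_{DE},\mu_{DE})\big(\widetilde{HI}_{t_0}(\gamma_T,\gamma_T^d),\widetilde{DI}_{t_0}(\gamma_T,\gamma_T^d)\big)=(\gamma_T,\gamma_T^d,\gamma_T^h),$$ $$(\widetilde{HI}_{t_0},\widetilde{DI}_{t_0},\widetilde\mu_I)\big(DE(\gamma_h,\gamma_h^d),\nu_{DE}(\gamma_h,\gamma_h^d)\big)=(-HP_{\psi(t_0)},DP_{\psi(t_0)},-\mu_P)(\gamma_h,\gamma_h^d).$$ (7) Suppose that there exists a smooth $\widetilde\varphi:I\to\mathbb R$ such that $m_T\cos\widetilde\varphi+n_T\sin\widetilde\varphi=0$ on $I$. Then $$(\widetilde{DE},\widetilde\nu_{DE},\widetilde\mu_{DE})\big(\overline{DI}_{t_0}(\gamma_d,\gamma_d^h),\overline\nu_{DI}(\gamma_d,\gamma_d^h)\big)=(\pm\gamma_d,\gamma_d^h,\pm\gamma_d^s),$$ $$(\overline{DI}_{t_0},\overline\nu_{DI},\overline\mu_{DI})\big(\widetilde{DE}(\gamma_T,\gamma_T^d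),\widetilde\nu_{DE}(\gamma_T,\gamma_T^d)\big)=(\widetilde{DP}_{\widetilde\varphi(t_0)},\widetilde\nu_{DP},\widetilde\mu_{DP})(\gamma_T,\gamma_T^d).$$
   Context: All maps are $C^\infty$. $\mathbb R^3_1$ is $\mathbb R^3$ with $\langle x,y\rangle=-x_1y_1+x_2y_2+x_3y_3$ and $x\wedge y=(-(x_2y_3-x_3y_2),\,x_3y_1-x_1y_3,\,x_1y_2-x_2y_1)$. $H^2=\{\langle x,x\rangle=-1\}$, $S^2_1=\{\langle x,x\rangle=1\}$; $\Delta_1$, $\overline\Delta_1$, $\Delta_5$ are the sets of pairs $(v,w)$ with $\langle v,w\rangle=0$ in $H^2\times S^2_1$, $S_1^2\times H^2$, $S_1^2\times S_1^2$ respectively. A Legendre curve in one of these sets is a smooth map $(\gamma,\nu)$ from $I$ into it with $\langle\dot\gamma,\nu\rangle=0$ (it is called spacelike for $\Delta_1,\overline\Delta_1$ and timelike for $\Delta_5$; $\dot\gamma$ is then spacelike, resp. timelike, where nonzero). Put $\mu=\gamma\wedge\nu$. The curvature $(m,n)$ is defined by $\dot\gamma=m\mu$, $\dot\nu=n\mu$; then $\dot\mu=m\gamma-n\nu$ for $\Delta_1$, $\dot\mu=-m\gamma+n\nu$ for $\overline\Delta_1$, $\dot\mu=m\gamma+n\nu$ for $\Delta_5$. The notation $(X,Y,Z)(\gamma,\nu)$ means the triple $(X(\gamma,\nu),Y(\gamma,\nu),Z(\gamma,\nu))$. Write $a(t)=\int_{t_0}^tm(\tau)\,d\tau$. Evolutes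 are formed with smooth functions $f,\varphi,\dots$ satisfying the stated equations on $I$ for the curvature of the curve to which they are applied; the angle $\widetilde\varphi$ for $\widetilde{DE}$ is considered only modulo $\pi$. The functions $s_\pm,\overline s_\pm,\lambda_\pm,\widetilde\lambda_\pm$ are solutions of the stated differential equations; if a solution is not global, $I$ is replaced by a subinterval on which it exists. A function written as a subscript of an involute or parallel is the one substituted into the formulas below. A. Constructions for $(\gamma,\nu)$ in $\Delta_1$: - Horocyclic evolutes, with $m+fn=0$: $\mathcal{HE}^\pm=\gamma+f\nu+\frac{f^2}2(\gamma\pm\mu)$, $\mathcal{DE}^\pm=\mp\frac{f^2}2\gamma\mp f\nu+(1-\frac{f^2}2)\mu$, $\mu^\pm_{\mathcal E}=\mathcal{HE}^\pm\wedge\mathcal{DE}^\pm$. - Horocyclic involutes, with $\dot s_\pm=\frac{m\pm n}{2}s_\pm^2-m$: $\mathcal{HI}^\pm_{s_\pm}=\gamma+s_\pm\mu+\frac{s_\pm^2}{2}(\gamma\pm\nu)$, $\nu^\pm_{\mathcal{HI}}=-s_\pm\gamma-\mu\mp s_\pm\nu$, $\mu^\pm_{\mathcal{HI}}=\mathcal{HI}^\pm_{s_\pm}\wedge\nu^\pm_{\mathcal{HI}}$. - Horocyclic parallels, with $\dot\lambda_\pm=\mp(\frac{\lambda_\pm^2n}{2}+\lambda_\pm m)$: $\mathcal{HP}^\pm_{\lambda_\pm}=\gamma+\lambda_\pm\nu+\frac{\lambda_\pm^2}{2}(\gamma\pm\mu)$, $\nu^\pm_{\mathcal{HP}}=\lambda_\pm\gamma+\nu\pm\lambda_\pm\mu$,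 $\mu^\pm_{\mathcal{HP}}=\mathcal{HP}^\pm_{\lambda_\pm}\wedge\nu^\pm_{\mathcal{HP}}$. - Hyperbolic evolute, with $m\cosh\varphi+n\sinh\varphi=0$: $HE=\cosh\varphi\,\gamma+\sinh\varphi\,\nu$, $\nu_{HE}=\mu$, $\mu_{HE}=HE\wedge\nu_{HE}$. - De Sitter evolute, with $m\sinh\psi+n\cosh\psi=0$: $DE=\sinh\psi\,\gamma+\cosh\psi\,\nu$, $\nu_{DE}=\mu$, $\mu_{DE}=DE\wedge\nu_{DE}$. - Involutes: $HI_{t_0}=\cosh a\,\gamma-\sinh a\,\mu$, $DI_{t_0}=\sinh a\,\gamma-\cosh a\,\mu$, $\mu_I=HI_{t_0}\wedge DI_{t_0}$. - Parallels, $\theta\in\mathbb R$: $HP_\theta=\cosh\theta\,\gamma+\sinh\theta\,\nu$, $DP_\theta=\sinh\theta\,\gamma+\cosh\theta\,\nu$, $\mu_P=HP_\theta\wedge DP_\theta$. B. Constructions for $(\gamma,\nu)$ in $\overline\Delta_1$: - De Sitter evolute, with $m\cosh\overline\psi+n\sinh\overline\psi=0$: $\overline{DE}=\cosh\overline\psi\,\gamma+\sinh\overline\psi\,\nu$, $\overline\nu_{DE}=\mu$, $\overline\mu_{DE}=\overline{DE}\wedge\overline\nu_{DE}$. - Hyperbolic evolute, with $m\sinh\overline\varphi+n\cosh\overline\varphi=0$: $\overline{HE}=\sinh\overline\varphi\,\gamma+\cosh\overline\varphi\,\nu$, $\overline\nu_{HE}=\mu$, $\overline\mu_{HE}=\overline{HE}\wedge\overline\nu_{HE}$.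 - Horocyclic involutes, with $\dot{\overline s}_\pm=-\frac{m\mp n}2\overline s_\pm^2-m$: $\overline{\mathcal{DI}}^\pm_{\overline s_\pm}=\gamma+\overline s_\pm\mu-\frac{\overline s_\pm^2}{2}(\gamma\mp\nu)$, $\overline\nu^\pm_{\mathcal{DI}}=-\overline s_\pm\gamma\pm\overline s_\pm\nu+\mu$, $\overline\mu^\pm_{\mathcal{DI}}=\overline{\mathcal{DI}}^\pm_{\overline s_\pm}\wedge\overline\nu^\pm_{\mathcal{DI}}$. - Involute: $\overline{DI}_{t_0}=\cos a\,\gamma-\sin a\,\mu$, $\overline\nu_{DI}=\cos a\,\mu+\sin a\,\gamma$, $\overline\mu_{DI}=\overline{DI}_{t_0}\wedge\overline\nu_{DI}$. - Parallels: $\overline{DP}_\theta=\cosh\theta\,\gamma+\sinh\theta\,\nu$, $\overline{HP}_\theta=\sinh\theta\,\gamma+\cosh\theta\,\nu$, $\overline\mu_P=\overline{DP}_\theta\wedge\overline{HP}_\theta$. C. Constructions for $(\gamma,\nu)$ in $\Delta_5$: - Horocyclic evolutes, with $m+\widetilde fn=0$: $\widetilde{\mathcal{DE}}^\pm=\gamma+\widetilde f\nu-\frac{\widetilde f^2}2(\gamma\mp\mu)$, $\widetilde{\mathcal{HE}}^\pm=\mp\frac{\widetilde f^2}2\gamma\pm\widetilde f\nu+(1+\frac{\widetilde f^2}2)\mu$, $\widetilde\mu^\pm_{\mathcal E}=\widetilde{\mathcal{DE}}^\pm\wedge\widetilde{\mathcal{HE}}^\pm$. - De Sitter evolute, with $m\cos\widetilde\varphi+n\sin\widetilde\varphi=0$: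 $\widetilde{DE}=\cos\widetilde\varphi\,\gamma+\sin\widetilde\varphi\,\nu$, $\widetilde\nu_{DE}=\mu$, $\widetilde\mu_{DE}=\widetilde{DE}\wedge\widetilde\nu_{DE}$. - Involutes: $\widetilde{DI}_{t_0}=\cosh a\,\gamma-\sinh a\,\mu$, $\widetilde{HI}_{t_0}=\cosh a\,\mu-\sinh a\,\gamma$, $\widetilde\mu_I=\widetilde{DI}_{t_0}\wedge\widetilde{HI}_{t_0}$. - Horocyclic parallels, with $\dot{\widetilde\lambda}_\pm=\pm(\frac{\widetilde\lambda_\pm^2n}2+\widetilde\lambda_\pm m)$: $\widetilde{\mathcal{DP}}^\pm_{\widetilde\lambda_\pm}=(1-\frac{\widetilde\lambda_\pm^2}2)\gamma+\widetilde\lambda_\pm\nu\pm\frac{\widetilde\lambda_\pm^2}2\mu$, $\widetilde\nu^\pm_{\mathcal{DP}}=-\widetilde\lambda_\pm\gamma+\nu\pm\widetilde\lambda_\pm\mu$, $\widetilde\mu^\pm_{\mathcal{DP}}=\widetilde{\mathcal{DP}}^\pm_{\widetilde\lambda_\pm}\wedge\widetilde\nu^\pm_{\mathcal{DP}}$. - Parallel: $\widetilde{DP}_\theta=\cos\theta\,\gamma+\sin\theta\,\nu$, $\widetilde\nu_{DP}=\cos\theta\,\nu-\sin\theta\,\gamma$, $\widetilde\mu_{DP}=\widetilde{DP}_\theta\wedge\widetilde\nu_{DP}$.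
   Formalization: First formulas of (4),(6): second and third entries negated; second formulas: third entries +μ̄_P, +μ_P. In (2), formulas 3–4: subscripts f̃+S̄ and f̃−S̿ (f̃ of γ_T), Riccati S̄'=−(m̃∓ñ)S̄²/2−m̃. Density in (1),(2) is assumed for both signs. *)

theory Defs
  imports "HOL-Analysis.Analysis"
begin

section \<open>Intervals, smoothness, differential equations\<close>

definition nondeg_interval :: "real set \<Rightarrow> bool" where
  "nondeg_interval I \<longleftrightarrow> is_interval I \<and> (\<exists>a\<in>I. \<exists>b\<in>I. a < b)"

text \<open>The interval may contain its endpoints; derivatives there are one-sided, which is
  why all derivatives are taken within the interval.\<close>

primrec Ck_on :: "nat \<Rightarrow> real set \<Rightarrow> (real \<Rightarrow> 'a::real_normed_vector) \<Rightarrow> bool" where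
  "Ck_on 0 I f \<longleftrightarrow> continuous_on I f"
| "Ck_on (Suc k) I f \<longleftrightarrow>
     (\<exists>f'. (\<forall>t\<in>I. (f has_vector_derivative f' t) (at t within I)) \<and> Ck_on k I f')"

definition smooth_on :: "real set \<Rightarrow> (real \<Rightarrow> 'a::real_normed_vector) \<Rightarrow> bool" where
  "smooth_on I f \<longleftrightarrow> (\<forall>k. Ck_on k I f)"

definition dense_in :: "real set \<Rightarrow> (real \<Rightarrow> bool) \<Rightarrow> bool" where
  "dense_in I P \<longleftrightarrow> I \<subseteq> closure {t\<in>I. P t}"

definition solves :: "real set \<Rightarrow> (real \<Rightarrow> real \<Rightarrow> real) \<Rightarrow> (real \<Rightarrow> real) \<Rightarrow> bool" where
  "solves J F s \<longleftrightarrow>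
     smooth_on J s \<and> (\<forall>t\<in>J. (s has_real_derivative F t (s t)) (at t within J))"


section \<open>Lorentz--Minkowski 3-space\<close>

definition lprod :: "real^3 \<Rightarrow> real^3 \<Rightarrow> real" where
  "lprod x y = - x$1 * y$1 + x$2 * y$2 + x$3 * y$3"

definition lwedge :: "real^3 \<Rightarrow> real^3 \<Rightarrow> real^3" where
  "lwedge x y = vector [- (x$2 * y$3 - x$3 * y$2), x$3 * y$1 - x$1 * y$3, x$1 * y$2 - x$2 * y$1]"

definition H2 :: "(real^3) set" where "H2 = {x. lprod x x = -1}"

definition S21 :: "(real^3) set" where "S21 = {x. lprod x x = 1}"

definition Delta1 :: "((real^3) \<times> (real^3)) set" where
  "Delta1 = {(v, w). v \<in> H2 \<and> w \<in> S21 \<and> lprod v w = 0}"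

definition Delta1bar :: "((real^3) \<times> (real^3)) set" where
  "Delta1bar = {(v, w). v \<in> S21 \<and> w \<in> H2 \<and> lprod v w = 0}"

definition Delta5 :: "((real^3) \<times> (real^3)) set" where
  "Delta5 = {(v, w). v \<in> S21 \<and> w \<in> S21 \<and> lprod v w = 0}"


section \<open>Legendre curves and their curvature\<close>

type_synonym curve = "real \<Rightarrow> real^3"

definition mu :: "curve \<Rightarrow> curve \<Rightarrow> curve" where
  "mu \<gamma> \<nu> t = lwedge (\<gamma> t) (\<nu> t)"

definition legendre :: "((real^3) \<times> (real^3)) set \<Rightarrow> real set \<Rightarrow> curve \<Rightarrow> curve \<Rightarrow> bool" where
  "legendre D I \<gamma> \<nu> \<longleftrightarrow> smooth_on I \<gamma> \<and> smooth_on I \<nu> \<and>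
     (\<forall>t\<in>I. (\<gamma> t, \<nu> t) \<in> D \<and> lprod (vector_derivative \<gamma> (at t within I)) (\<nu> t) = 0)"

definition curvature ::
  "real set \<Rightarrow> curve \<Rightarrow> curve \<Rightarrow> (real \<Rightarrow> real) \<Rightarrow> (real \<Rightarrow> real) \<Rightarrow> bool" where
  "curvature I \<gamma> \<nu> m n \<longleftrightarrow>
     (\<forall>t\<in>I. (\<gamma> has_vector_derivative m t *\<^sub>R mu \<gamma> \<nu> t) (at t within I) \<and>
            (\<nu> has_vector_derivative n t *\<^sub>R mu \<gamma> \<nu> t) (at t within I))"

definition legendre_curv :: "((real^3) \<times> (real^3)) set \<Rightarrow> real set \<Rightarrow> curve \<Rightarrow> curve \<Rightarrow>
    (real \<Rightarrow> real) \<Rightarrow> (real \<Rightarrow> real) \<Rightarrow> bool" where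
  "legendre_curv D I \<gamma> \<nu> m n \<longleftrightarrow> legendre D I \<gamma> \<nu> \<and> curvature I \<gamma> \<nu> m n"


section \<open>Auxiliary functions from which the associated curves are formed\<close>

text \<open>In the following, \<open>P_fun I \<gamma> \<nu> f\<close> says that \<open>(\<gamma>, \<nu>)\<close> is a Legendre curve on \<open>I\<close> in the
  set required by the construction \<open>P\<close>, and that \<open>f\<close> is a function with which that construction
  may be formed. A double sign is encoded by a real \<open>\<epsilon> \<in> {1, -1}\<close>, the upper sign being
  \<open>\<epsilon> = 1\<close>; thus \<open>\<mp>\<close> becomes \<open>- \<epsilon>\<close>. The names ending in \<open>h\<close> denote horocyclic objects, the
  prefix \<open>b\<close> (bar) marks constructions on \<open>Delta1bar\<close> and the prefix \<open>t\<close> (tilde) those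
  on \<open>Delta5\<close>.\<close>

text \<open>The integral of the first curvature from \<open>t0\<close>; the interval integral changes sign
  for \<open>t < t0\<close>.\<close>

definition int_fun :: "((real^3) \<times> (real^3)) set \<Rightarrow> real set \<Rightarrow> real \<Rightarrow> curve \<Rightarrow> curve \<Rightarrow>
    (real \<Rightarrow> real) \<Rightarrow> bool" where
  "int_fun D I t0 \<gamma> \<nu> a \<longleftrightarrow>
     (\<exists>m n. legendre_curv D I \<gamma> \<nu> m n \<and> (\<forall>t\<in>I. a t = (LBINT \<tau>=t0..t. m \<tau>)))"

definition HEh_fun :: "real set \<Rightarrow> curve \<Rightarrow> curve \<Rightarrow> (real \<Rightarrow> real) \<Rightarrow> bool" where
  "HEh_fun I \<gamma> \<nu> f \<longleftrightarrow> smooth_on I f \<and>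
     (\<exists>m n. legendre_curv Delta1 I \<gamma> \<nu> m n \<and> (\<forall>t\<in>I. m t + f t * n t = 0))"

definition HIh_fun :: "real \<Rightarrow> real set \<Rightarrow> curve \<Rightarrow> curve \<Rightarrow> (real \<Rightarrow> real) \<Rightarrow> bool" where
  "HIh_fun \<epsilon> I \<gamma> \<nu> s \<longleftrightarrow>
     (\<exists>m n. legendre_curv Delta1 I \<gamma> \<nu> m n \<and>
            solves I (\<lambda>t x. (m t + \<epsilon> * n t) / 2 * x^2 - m t) s)"

definition HPh_fun :: "real \<Rightarrow> real set \<Rightarrow> curve \<Rightarrow> curve \<Rightarrow> (real \<Rightarrow> real) \<Rightarrow> bool" where
  "HPh_fun \<epsilon> I \<gamma> \<nu> l \<longleftrightarrow>
     (\<exists>m n. legendre_curv Delta1 I \<gamma> \<nu> m n \<and>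
            solves I (\<lambda>t x. - \<epsilon> * (x^2 * n t / 2 + x * m t)) l)"

definition HE_fun :: "real set \<Rightarrow> curve \<Rightarrow> curve \<Rightarrow> (real \<Rightarrow> real) \<Rightarrow> bool" where
  "HE_fun I \<gamma> \<nu> \<phi> \<longleftrightarrow> smooth_on I \<phi> \<and>
     (\<exists>m n. legendre_curv Delta1 I \<gamma> \<nu> m n \<and> (\<forall>t\<in>I. m t * cosh (\<phi> t) + n t * sinh (\<phi> t) = 0))"

definition DE_fun :: "real set \<Rightarrow> curve \<Rightarrow> curve \<Rightarrow> (real \<Rightarrow> real) \<Rightarrow> bool" where
  "DE_fun I \<gamma> \<nu> \<psi> \<longleftrightarrow> smooth_on I \<psi> \<and>
     (\<exists>m n. legendre_curv Delta1 I \<gamma> \<nu> m n \<and> (\<forall>t\<in>I. m t * sinh (\<psi> t) + n t * cosh (\<psi> t) = 0))"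

definition bDE_fun :: "real set \<Rightarrow> curve \<Rightarrow> curve \<Rightarrow> (real \<Rightarrow> real) \<Rightarrow> bool" where
  "bDE_fun I \<gamma> \<nu> \<psi> \<longleftrightarrow> smooth_on I \<psi> \<and>
     (\<exists>m n. legendre_curv Delta1bar I \<gamma> \<nu> m n \<and> (\<forall>t\<in>I. m t * cosh (\<psi> t) + n t * sinh (\<psi> t) = 0))"

definition bHE_fun :: "real set \<Rightarrow> curve \<Rightarrow> curve \<Rightarrow> (real \<Rightarrow> real) \<Rightarrow> bool" where
  "bHE_fun I \<gamma> \<nu> \<phi> \<longleftrightarrow> smooth_on I \<phi> \<and>
     (\<exists>m n. legendre_curv Delta1bar I \<gamma> \<nu> m n \<and> (\<forall>t\<in>I. m t * sinh (\<phi> t) + n t * cosh (\<phi> t) = 0))"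

definition bDIh_fun :: "real \<Rightarrow> real set \<Rightarrow> curve \<Rightarrow> curve \<Rightarrow> (real \<Rightarrow> real) \<Rightarrow> bool" where
  "bDIh_fun \<epsilon> I \<gamma> \<nu> s \<longleftrightarrow>
     (\<exists>m n. legendre_curv Delta1bar I \<gamma> \<nu> m n \<and>
            solves I (\<lambda>t x. - ((m t - \<epsilon> * n t) / 2) * x^2 - m t) s)"

definition tDEh_fun :: "real set \<Rightarrow> curve \<Rightarrow> curve \<Rightarrow> (real \<Rightarrow> real) \<Rightarrow> bool" where
  "tDEh_fun I \<gamma> \<nu> f \<longleftrightarrow> smooth_on I f \<and>
     (\<exists>m n. legendre_curv Delta5 I \<gamma> \<nu> m n \<and> (\<forall>t\<in>I. m t + f t * n t = 0))"

definition tDE_fun :: "real set \<Rightarrow> curve \<Rightarrow> curve \<Rightarrow> (real \<Rightarrow> real) \<Rightarrow> bool" where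
  "tDE_fun I \<gamma> \<nu> \<phi> \<longleftrightarrow> smooth_on I \<phi> \<and>
     (\<exists>m n. legendre_curv Delta5 I \<gamma> \<nu> m n \<and> (\<forall>t\<in>I. m t * cos (\<phi> t) + n t * sin (\<phi> t) = 0))"

definition tDPh_fun :: "real \<Rightarrow> real set \<Rightarrow> curve \<Rightarrow> curve \<Rightarrow> (real \<Rightarrow> real) \<Rightarrow> bool" where
  "tDPh_fun \<epsilon> I \<gamma> \<nu> l \<longleftrightarrow>
     (\<exists>m n. legendre_curv Delta5 I \<gamma> \<nu> m n \<and>
            solves I (\<lambda>t x. \<epsilon> * (x^2 * n t / 2 + x * m t)) l)"


section \<open>Constructions for curves in \<open>Delta1\<close>\<close>

definition HEh :: "real \<Rightarrow> (real \<Rightarrow> real) \<Rightarrow> curve \<Rightarrow> curve \<Rightarrow> curve" where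
  "HEh \<epsilon> f \<gamma> \<nu> t = \<gamma> t + f t *\<^sub>R \<nu> t + ((f t)^2 / 2) *\<^sub>R (\<gamma> t + \<epsilon> *\<^sub>R mu \<gamma> \<nu> t)"

definition DEh :: "real \<Rightarrow> (real \<Rightarrow> real) \<Rightarrow> curve \<Rightarrow> curve \<Rightarrow> curve" where
  "DEh \<epsilon> f \<gamma> \<nu> t = (- \<epsilon> * (f t)^2 / 2) *\<^sub>R \<gamma> t + (- \<epsilon> * f t) *\<^sub>R \<nu> t
                     + (1 - (f t)^2 / 2) *\<^sub>R mu \<gamma> \<nu> t"

definition muEh :: "real \<Rightarrow> (real \<Rightarrow> real) \<Rightarrow> curve \<Rightarrow> curve \<Rightarrow> curve" where
  "muEh \<epsilon> f \<gamma> \<nu> = mu (HEh \<epsilon> f \<gamma> \<nu>) (DEh \<epsilon> f \<gamma> \<nu>)"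

definition HIh :: "real \<Rightarrow> (real \<Rightarrow> real) \<Rightarrow> curve \<Rightarrow> curve \<Rightarrow> curve" where
  "HIh \<epsilon> s \<gamma> \<nu> t = \<gamma> t + s t *\<^sub>R mu \<gamma> \<nu> t + ((s t)^2 / 2) *\<^sub>R (\<gamma> t + \<epsilon> *\<^sub>R \<nu> t)"

definition nuHIh :: "real \<Rightarrow> (real \<Rightarrow> real) \<Rightarrow> curve \<Rightarrow> curve \<Rightarrow> curve" where
  "nuHIh \<epsilon> s \<gamma> \<nu> t = (- s t) *\<^sub>R \<gamma> t - mu \<gamma> \<nu> t - (\<epsilon> * s t) *\<^sub>R \<nu> t"

definition muHIh :: "real \<Rightarrow> (real \<Rightarrow> real) \<Rightarrow> curve \<Rightarrow> curve \<Rightarrow> curve" where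
  "muHIh \<epsilon> s \<gamma> \<nu> = mu (HIh \<epsilon> s \<gamma> \<nu>) (nuHIh \<epsilon> s \<gamma> \<nu>)"

definition HPh :: "real \<Rightarrow> (real \<Rightarrow> real) \<Rightarrow> curve \<Rightarrow> curve \<Rightarrow> curve" where
  "HPh \<epsilon> l \<gamma> \<nu> t = \<gamma> t + l t *\<^sub>R \<nu> t + ((l t)^2 / 2) *\<^sub>R (\<gamma> t + \<epsilon> *\<^sub>R mu \<gamma> \<nu> t)"

definition nuHPh :: "real \<Rightarrow> (real \<Rightarrow> real) \<Rightarrow> curve \<Rightarrow> curve \<Rightarrow> curve" where
  "nuHPh \<epsilon> l \<gamma> \<nu> t = l t *\<^sub>R \<gamma> t + \<nu> t + (\<epsilon> * l t) *\<^sub>R mu \<gamma> \<nu> t"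

definition muHPh :: "real \<Rightarrow> (real \<Rightarrow> real) \<Rightarrow> curve \<Rightarrow> curve \<Rightarrow> curve" where
  "muHPh \<epsilon> l \<gamma> \<nu> = mu (HPh \<epsilon> l \<gamma> \<nu>) (nuHPh \<epsilon> l \<gamma> \<nu>)"

definition HE :: "(real \<Rightarrow> real) \<Rightarrow> curve \<Rightarrow> curve \<Rightarrow> curve" where
  "HE \<phi> \<gamma> \<nu> t = cosh (\<phi> t) *\<^sub>R \<gamma> t + sinh (\<phi> t) *\<^sub>R \<nu> t"

definition nuHE :: "curve \<Rightarrow> curve \<Rightarrow> curve" where
  "nuHE \<gamma> \<nu> = mu \<gamma> \<nu>"

definition muHE :: "(real \<Rightarrow> real) \<Rightarrow> curve \<Rightarrow> curve \<Rightarrow> curve" where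
  "muHE \<phi> \<gamma> \<nu> = mu (HE \<phi> \<gamma> \<nu>) (nuHE \<gamma> \<nu>)"

definition DE :: "(real \<Rightarrow> real) \<Rightarrow> curve \<Rightarrow> curve \<Rightarrow> curve" where
  "DE \<psi> \<gamma> \<nu> t = sinh (\<psi> t) *\<^sub>R \<gamma> t + cosh (\<psi> t) *\<^sub>R \<nu> t"

definition nuDE :: "curve \<Rightarrow> curve \<Rightarrow> curve" where
  "nuDE \<gamma> \<nu> = mu \<gamma> \<nu>"

definition muDE :: "(real \<Rightarrow> real) \<Rightarrow> curve \<Rightarrow> curve \<Rightarrow> curve" where
  "muDE \<psi> \<gamma> \<nu> = mu (DE \<psi> \<gamma> \<nu>) (nuDE \<gamma> \<nu>)"

text \<open>In \<open>HI\<close>, \<open>DI\<close> and their analogues below, the first argument is the integral of the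
  first curvature from \<open>t0\<close>, see \<open>int_fun\<close>.\<close>

definition HI :: "(real \<Rightarrow> real) \<Rightarrow> curve \<Rightarrow> curve \<Rightarrow> curve" where
  "HI a \<gamma> \<nu> t = cosh (a t) *\<^sub>R \<gamma> t - sinh (a t) *\<^sub>R mu \<gamma> \<nu> t"

definition DI :: "(real \<Rightarrow> real) \<Rightarrow> curve \<Rightarrow> curve \<Rightarrow> curve" where
  "DI a \<gamma> \<nu> t = sinh (a t) *\<^sub>R \<gamma> t - cosh (a t) *\<^sub>R mu \<gamma> \<nu> t"

text \<open>Both \<open>(HI, DI)\<close> (in \<open>Delta1\<close>) and \<open>(DI, HI)\<close> (in \<open>Delta1bar\<close>) are Legendre curves, but
  \<open>muI\<close> is the wedge product in the order \<open>(HI, DI)\<close>; for the curve \<open>(DI, HI)\<close>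
  the vector \<open>mu\<close> is \<open>- muI\<close>. The same remark applies to \<open>muP\<close>, \<open>tmuI\<close> and \<open>bmuP\<close>.
  Consequently the evolutes \<open>bHE\<close> of \<open>(DI, HI)\<close> and \<open>DE\<close> of \<open>(tHI, tDI)\<close> return the
  original curve with its second vector negated, and \<open>muI\<close>, \<open>tmuI\<close> in the converse formulas
  give \<open>bmuP\<close>, \<open>muP\<close> without a sign. The theorem has these signs, which the
  source misprints.\<close>

definition muI :: "(real \<Rightarrow> real) \<Rightarrow> curve \<Rightarrow> curve \<Rightarrow> curve" where
  "muI a \<gamma> \<nu> = mu (HI a \<gamma> \<nu>) (DI a \<gamma> \<nu>)"

definition HP :: "real \<Rightarrow> curve \<Rightarrow> curve \<Rightarrow> curve" where
  "HP \<theta> \<gamma> \<nu> t = cosh \<theta> *\<^sub>R \<gamma> t + sinh \<theta> *\<^sub>R \<nu> t"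

definition DP :: "real \<Rightarrow> curve \<Rightarrow> curve \<Rightarrow> curve" where
  "DP \<theta> \<gamma> \<nu> t = sinh \<theta> *\<^sub>R \<gamma> t + cosh \<theta> *\<^sub>R \<nu> t"

definition muP :: "real \<Rightarrow> curve \<Rightarrow> curve \<Rightarrow> curve" where
  "muP \<theta> \<gamma> \<nu> = mu (HP \<theta> \<gamma> \<nu>) (DP \<theta> \<gamma> \<nu>)"


section \<open>Constructions for curves in \<open>Delta1bar\<close>\<close>

definition bDE :: "(real \<Rightarrow> real) \<Rightarrow> curve \<Rightarrow> curve \<Rightarrow> curve" where
  "bDE \<psi> \<gamma> \<nu> t = cosh (\<psi> t) *\<^sub>R \<gamma> t + sinh (\<psi> t) *\<^sub>R \<nu> t"

definition bnuDE :: "curve \<Rightarrow> curve \<Rightarrow> curve" where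
  "bnuDE \<gamma> \<nu> = mu \<gamma> \<nu>"

definition bmuDE :: "(real \<Rightarrow> real) \<Rightarrow> curve \<Rightarrow> curve \<Rightarrow> curve" where
  "bmuDE \<psi> \<gamma> \<nu> = mu (bDE \<psi> \<gamma> \<nu>) (bnuDE \<gamma> \<nu>)"

definition bHE :: "(real \<Rightarrow> real) \<Rightarrow> curve \<Rightarrow> curve \<Rightarrow> curve" where
  "bHE \<phi> \<gamma> \<nu> t = sinh (\<phi> t) *\<^sub>R \<gamma> t + cosh (\<phi> t) *\<^sub>R \<nu> t"

definition bnuHE :: "curve \<Rightarrow> curve \<Rightarrow> curve" where
  "bnuHE \<gamma> \<nu> = mu \<gamma> \<nu>"

definition bmuHE :: "(real \<Rightarrow> real) \<Rightarrow> curve \<Rightarrow> curve \<Rightarrow> curve" where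
  "bmuHE \<phi> \<gamma> \<nu> = mu (bHE \<phi> \<gamma> \<nu>) (bnuHE \<gamma> \<nu>)"

definition bDIh :: "real \<Rightarrow> (real \<Rightarrow> real) \<Rightarrow> curve \<Rightarrow> curve \<Rightarrow> curve" where
  "bDIh \<epsilon> s \<gamma> \<nu> t = \<gamma> t + s t *\<^sub>R mu \<gamma> \<nu> t - ((s t)^2 / 2) *\<^sub>R (\<gamma> t - \<epsilon> *\<^sub>R \<nu> t)"

definition bnuDIh :: "real \<Rightarrow> (real \<Rightarrow> real) \<Rightarrow> curve \<Rightarrow> curve \<Rightarrow> curve" where
  "bnuDIh \<epsilon> s \<gamma> \<nu> t = (- s t) *\<^sub>R \<gamma> t + (\<epsilon> * s t) *\<^sub>R \<nu> t + mu \<gamma> \<nu> t"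

definition bmuDIh :: "real \<Rightarrow> (real \<Rightarrow> real) \<Rightarrow> curve \<Rightarrow> curve \<Rightarrow> curve" where
  "bmuDIh \<epsilon> s \<gamma> \<nu> = mu (bDIh \<epsilon> s \<gamma> \<nu>) (bnuDIh \<epsilon> s \<gamma> \<nu>)"

definition bDI :: "(real \<Rightarrow> real) \<Rightarrow> curve \<Rightarrow> curve \<Rightarrow> curve" where
  "bDI a \<gamma> \<nu> t = cos (a t) *\<^sub>R \<gamma> t - sin (a t) *\<^sub>R mu \<gamma> \<nu> t"

definition bnuDI :: "(real \<Rightarrow> real) \<Rightarrow> curve \<Rightarrow> curve \<Rightarrow> curve" where
  "bnuDI a \<gamma> \<nu> t = cos (a t) *\<^sub>R mu \<gamma> \<nu> t + sin (a t) *\<^sub>R \<gamma> t"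

definition bmuDI :: "(real \<Rightarrow> real) \<Rightarrow> curve \<Rightarrow> curve \<Rightarrow> curve" where
  "bmuDI a \<gamma> \<nu> = mu (bDI a \<gamma> \<nu>) (bnuDI a \<gamma> \<nu>)"

definition bDP :: "real \<Rightarrow> curve \<Rightarrow> curve \<Rightarrow> curve" where
  "bDP \<theta> \<gamma> \<nu> t = cosh \<theta> *\<^sub>R \<gamma> t + sinh \<theta> *\<^sub>R \<nu> t"

definition bHP :: "real \<Rightarrow> curve \<Rightarrow> curve \<Rightarrow> curve" where
  "bHP \<theta> \<gamma> \<nu> t = sinh \<theta> *\<^sub>R \<gamma> t + cosh \<theta> *\<^sub>R \<nu> t"

definition bmuP :: "real \<Rightarrow> curve \<Rightarrow> curve \<Rightarrow> curve" where
  "bmuP \<theta> \<gamma> \<nu> = mu (bDP \<theta> \<gamma> \<nu>) (bHP \<theta> \<gamma> \<nu>)"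


section \<open>Constructions for curves in \<open>Delta5\<close>\<close>

definition tDEh :: "real \<Rightarrow> (real \<Rightarrow> real) \<Rightarrow> curve \<Rightarrow> curve \<Rightarrow> curve" where
  "tDEh \<epsilon> f \<gamma> \<nu> t = \<gamma> t + f t *\<^sub>R \<nu> t - ((f t)^2 / 2) *\<^sub>R (\<gamma> t - \<epsilon> *\<^sub>R mu \<gamma> \<nu> t)"

definition tHEh :: "real \<Rightarrow> (real \<Rightarrow> real) \<Rightarrow> curve \<Rightarrow> curve \<Rightarrow> curve" where
  "tHEh \<epsilon> f \<gamma> \<nu> t = (- \<epsilon> * (f t)^2 / 2) *\<^sub>R \<gamma> t + (\<epsilon> * f t) *\<^sub>R \<nu> t
                      + (1 + (f t)^2 / 2) *\<^sub>R mu \<gamma> \<nu> t"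

definition tmuEh :: "real \<Rightarrow> (real \<Rightarrow> real) \<Rightarrow> curve \<Rightarrow> curve \<Rightarrow> curve" where
  "tmuEh \<epsilon> f \<gamma> \<nu> = mu (tDEh \<epsilon> f \<gamma> \<nu>) (tHEh \<epsilon> f \<gamma> \<nu>)"

definition tDE :: "(real \<Rightarrow> real) \<Rightarrow> curve \<Rightarrow> curve \<Rightarrow> curve" where
  "tDE \<phi> \<gamma> \<nu> t = cos (\<phi> t) *\<^sub>R \<gamma> t + sin (\<phi> t) *\<^sub>R \<nu> t"

definition tnuDE :: "curve \<Rightarrow> curve \<Rightarrow> curve" where
  "tnuDE \<gamma> \<nu> = mu \<gamma> \<nu>"

definition tmuDE :: "(real \<Rightarrow> real) \<Rightarrow> curve \<Rightarrow> curve \<Rightarrow> curve" where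
  "tmuDE \<phi> \<gamma> \<nu> = mu (tDE \<phi> \<gamma> \<nu>) (tnuDE \<gamma> \<nu>)"

definition tDI :: "(real \<Rightarrow> real) \<Rightarrow> curve \<Rightarrow> curve \<Rightarrow> curve" where
  "tDI a \<gamma> \<nu> t = cosh (a t) *\<^sub>R \<gamma> t - sinh (a t) *\<^sub>R mu \<gamma> \<nu> t"

definition tHI :: "(real \<Rightarrow> real) \<Rightarrow> curve \<Rightarrow> curve \<Rightarrow> curve" where
  "tHI a \<gamma> \<nu> t = cosh (a t) *\<^sub>R mu \<gamma> \<nu> t - sinh (a t) *\<^sub>R \<gamma> t"

definition tmuI :: "(real \<Rightarrow> real) \<Rightarrow> curve \<Rightarrow> curve \<Rightarrow> curve" where
  "tmuI a \<gamma> \<nu> = mu (tDI a \<gamma> \<nu>) (tHI a \<gamma> \<nu>)"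

definition tDPh :: "real \<Rightarrow> (real \<Rightarrow> real) \<Rightarrow> curve \<Rightarrow> curve \<Rightarrow> curve" where
  "tDPh \<epsilon> l \<gamma> \<nu> t = (1 - (l t)^2 / 2) *\<^sub>R \<gamma> t + l t *\<^sub>R \<nu> t + (\<epsilon> * (l t)^2 / 2) *\<^sub>R mu \<gamma> \<nu> t"

definition tnuDPh :: "real \<Rightarrow> (real \<Rightarrow> real) \<Rightarrow> curve \<Rightarrow> curve \<Rightarrow> curve" where
  "tnuDPh \<epsilon> l \<gamma> \<nu> t = (- l t) *\<^sub>R \<gamma> t + \<nu> t + (\<epsilon> * l t) *\<^sub>R mu \<gamma> \<nu> t"

definition tmuDPh :: "real \<Rightarrow> (real \<Rightarrow> real) \<Rightarrow> curve \<Rightarrow> curve \<Rightarrow> curve" where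
  "tmuDPh \<epsilon> l \<gamma> \<nu> = mu (tDPh \<epsilon> l \<gamma> \<nu>) (tnuDPh \<epsilon> l \<gamma> \<nu>)"

definition tDP :: "real \<Rightarrow> curve \<Rightarrow> curve \<Rightarrow> curve" where
  "tDP \<theta> \<gamma> \<nu> t = cos \<theta> *\<^sub>R \<gamma> t + sin \<theta> *\<^sub>R \<nu> t"

definition tnuDP :: "real \<Rightarrow> curve \<Rightarrow> curve \<Rightarrow> curve" where
  "tnuDP \<theta> \<gamma> \<nu> t = cos \<theta> *\<^sub>R \<nu> t - sin \<theta> *\<^sub>R \<gamma> t"

definition tmuDP :: "real \<Rightarrow> curve \<Rightarrow> curve \<Rightarrow> curve" where
  "tmuDP \<theta> \<gamma> \<nu> = mu (tDP \<theta> \<gamma> \<nu>) (tnuDP \<theta> \<gamma> \<nu>)"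


section \<open>Curvatures of the horocyclic evolutes\<close>

text \<open>Claimed closed forms (for \<open>m + f n = 0\<close>) of the curvatures of \<open>(HEh, DEh)\<close> and
  \<open>(tDEh, tHEh)\<close>, in terms of \<open>f\<close> and the second curvature \<open>n\<close> of the original curve.

  Involutes of these evolutes are parallels of the original curve, but with parameter \<open>f - S\<close> for
  \<open>Delta1\<close> (where \<open>muEh = - \<nu> - f (\<gamma> + \<epsilon> \<mu>)\<close>) and \<open>f + S\<close> for \<open>Delta5\<close>
  (where \<open>tmuEh = \<nu> - f (\<gamma> - \<epsilon> \<mu>)\<close>). In the second case the source prints \<open>f - S\<close>, with
  the auxiliary function \<open>f\<close> of another curve, and a Riccati equation that is not the one
  required by \<open>bDIh_fun\<close>; the theorem has \<open>f + S\<close>, the \<open>f\<close> of the curve itself, and the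
  equation of \<open>bDIh_fun\<close>.\<close>

definition m_HEh :: "real \<Rightarrow> real set \<Rightarrow> (real \<Rightarrow> real) \<Rightarrow> (real \<Rightarrow> real) \<Rightarrow> real \<Rightarrow> real" where
  "m_HEh \<epsilon> I f n t = - vector_derivative f (at t within I) + \<epsilon> * ((f t)^2 * n t / 2)"

definition n_HEh :: "real \<Rightarrow> real set \<Rightarrow> (real \<Rightarrow> real) \<Rightarrow> (real \<Rightarrow> real) \<Rightarrow> real \<Rightarrow> real" where
  "n_HEh \<epsilon> I f n t = \<epsilon> * vector_derivative f (at t within I) - (f t)^2 * n t / 2 + n t"

definition m_tDEh :: "real \<Rightarrow> real set \<Rightarrow> (real \<Rightarrow> real) \<Rightarrow> (real \<Rightarrow> real) \<Rightarrow> real \<Rightarrow> real" where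
  "m_tDEh \<epsilon> I f n t = vector_derivative f (at t within I) + \<epsilon> * ((f t)^2 * n t / 2)"

definition n_tDEh :: "real \<Rightarrow> real set \<Rightarrow> (real \<Rightarrow> real) \<Rightarrow> (real \<Rightarrow> real) \<Rightarrow> real \<Rightarrow> real" where
  "n_tDEh \<epsilon> I f n t = \<epsilon> * vector_derivative f (at t within I) + (f t)^2 * n t / 2 + n t"

end

theory Submission
  imports Defs
begin

text \<open>
  All constructions express new vectors in the frame \<open>(\<gamma>, \<nu>, \<mu>)\<close> of a given Legendre curve,
  and a composition of two of them is a composition of coordinate changes (\<open>frame_frame\<close>).
  With \<open>\<sigma> = \<langle>\<gamma>, \<gamma>\<rangle>\<close> and \<open>\<tau> = \<langle>\<nu>, \<nu>\<rangle>\<close> the structure equations are \<open>\<gamma>' = m \<mu>\<close>, \<open>\<nu>' = n \<mu>\<close>, \<open>\<mu>' =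
  \<tau> m \<gamma> + \<sigma> n \<nu>\<close> for all three kinds of curves. Hence the curvature of an associated curve can
  be computed from its coordinates (\<open>legendre_curv_frame\<close>), and the theorem rests on what
  these curvatures turn out to be.

  Evolutes of involutes. Both components of the curvature of an involute contain a common
  factor: \<open>n \<plusminus> m\<close> for horocyclic involutes, which satisfy a Riccati equation, and \<open>n\<close> for the
  others. Apart from this factor the curvature depends only on the auxiliary function of the
  involute. The equation for the auxiliary function of the evolute is therefore the common
  factor times an equation between the two auxiliary functions. The factor is nonzero on a
  dense set and everything is continuous, so the evolute has to be formed with the function of
  the involute up to sign, or up to a multiple of \<open>\<pi>\<close> in the circular case. With this function
  the second coordinate change undoes the first (\<open>evolute_of_HIh\<close>, \<open>evolute_of_bDIh\<close>,
  \<open>evolute_of_HI\<close>, \<open>evolute_of_tDI\<close>, \<open>evolute_of_bDI\<close>).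

  Involutes of evolutes. The first curvature of a hyperbolic or de Sitter evolute is, up to
  sign, the derivative of its angle \<open>\<phi>\<close>. Its integral from \<open>t0\<close> is \<open>\<plusminus>(\<phi> - \<phi> t0)\<close>, and the
  addition theorems reduce the involute to a parallel with the constant angle \<open>\<phi> t0\<close>
  (\<open>involute_of_HE\<close> and its analogues). In the horocyclic case a composition of an evolute
  with function \<open>f\<close> and an involute with function \<open>S\<close> is a parallel with function \<open>f - S\<close> or
  \<open>f + S\<close>, and the Riccati equation for \<open>S\<close> is exactly what makes this function satisfy the
  equation of horocyclic parallels (\<open>involute_of_HEh\<close>, \<open>involute_of_tDEh\<close>).

  The remaining formulas follow by symmetry. Replacing \<open>\<nu>\<close> by \<open>-\<nu>\<close> interchanges the upper and
  lower signs (\<open>legendre_curv_uminus\<close>), and exchanging \<open>\<gamma>\<close> and \<open>\<nu>\<close> interchanges \<open>Delta1\<close> with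
  \<open>Delta1bar\<close> (\<open>legendre_curv_swap\<close>).
\<close>


section \<open>Smooth functions on an interval\<close>

lemma nondeg_interval_at_within_neq_bot:
  assumes "nondeg_interval J" "t \<in> J"
  shows "at t within J \<noteq> bot"
proof -
  obtain a b where ab: "a \<in> J" "b \<in> J" "a < b" and J: "is_interval J"
    using assms unfolding nondeg_interval_def by blast
  have "connected J" using J by (simp add: is_interval_connected_1)
  moreover have "\<not> J \<subseteq> {t}" using ab by auto
  ultimately have "t islimpt J" using assms(2) connected_imp_perfect by blast
  then show ?thesis by (simp add: trivial_limit_within)
qed

lemma has_vector_derivative_unique_on:
  assumes "nondeg_interval J" "t \<in> J"
    and "(f has_vector_derivative x) (at t within J)" "(f has_vector_derivative y) (at t within J)"
  shows "x = y"
  using assms nondeg_interval_at_within_neq_bot vector_derivative_unique_within by blast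

lemma Ck_on_cong:
  assumes "Ck_on k J f" and eq: "\<And>t. t \<in> J \<Longrightarrow> f t = g t"
  shows "Ck_on k J g"
proof (cases k)
  case 0
  then show ?thesis using assms continuous_on_cong[of J J f g] by simp
next
  case (Suc l)
  then obtain f' where "\<forall>t\<in>J. (f has_vector_derivative f' t) (at t within J)" "Ck_on l J f'"
    using assms by auto
  then show ?thesis
    using Suc eq by (auto intro!: exI[of _ f'] intro: has_vector_derivative_transform[of _ _ g f])
qed

lemma Ck_on_subset: "Ck_on k I f \<Longrightarrow> J \<subseteq> I \<Longrightarrow> Ck_on k J f"
proof (induction k arbitrary: f)
  case 0
  then show ?case by (auto intro: continuous_on_subset)
next
  case (Suc k)
  then obtain f' where "\<forall>t\<in>I. (f has_vector_derivative f' t) (at t within I)" "Ck_on k I f'"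
    by auto
  then show ?case
    using Suc by (auto intro!: exI[of _ f'] intro: has_vector_derivative_within_subset)
qed

lemma Ck_on_Suc_imp: "Ck_on (Suc k) J f \<Longrightarrow> Ck_on k J f"
proof (induction k arbitrary: f)
  case 0
  then show ?case
    by (auto simp: continuous_on_eq_continuous_within dest!: bspec has_vector_derivative_continuous)
next
  case (Suc k)
  then show ?case by (metis Ck_on.simps(2))
qed

lemma Ck_on_const: "Ck_on k J (\<lambda>_. c)"
  by (induction k arbitrary: c) (auto intro!: exI[of _ "\<lambda>_. 0"])

lemma Ck_on_add: "Ck_on k J f \<Longrightarrow> Ck_on k J g \<Longrightarrow> Ck_on k J (\<lambda>t. f t + g t)"
proof (induction k arbitrary: f g)
  case 0
  then show ?case by (auto intro: continuous_on_add)
next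
  case (Suc k)
  obtain f' g' where "\<forall>t\<in>J. (f has_vector_derivative f' t) (at t within J)" "Ck_on k J f'"
    and "\<forall>t\<in>J. (g has_vector_derivative g' t) (at t within J)" "Ck_on k J g'"
    using Suc.prems by auto
  then show ?case
    using Suc.IH by (auto intro!: exI[of _ "\<lambda>t. f' t + g' t"] has_vector_derivative_add)
qed

lemma (in bounded_bilinear) Ck_on:
  "Ck_on k J f \<Longrightarrow> Ck_on k J g \<Longrightarrow> Ck_on k J (\<lambda>t. prod (f t) (g t))"
proof (induction k arbitrary: f g)
  case 0
  then show ?case by (auto intro: continuous_on)
next
  case (Suc k)
  obtain f' g' where f': "\<forall>t\<in>J. (f has_vector_derivative f' t) (at t within J)" "Ck_on k J f'"
    and g': "\<forall>t\<in>J. (g has_vector_derivative g' t) (at t within J)" "Ck_on k J g'"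
    using Suc.prems by auto
  have "Ck_on k J f" "Ck_on k J g" using Suc.prems Ck_on_Suc_imp by blast+
  then have "Ck_on k J (\<lambda>t. prod (f t) (g' t) + prod (f' t) (g t))"
    by (intro Ck_on_add Suc.IH f'(2) g'(2))
  then show ?case using f' g'
    by (auto intro!: exI[of _ "\<lambda>t. prod (f t) (g' t) + prod (f' t) (g t)"] has_vector_derivative)
qed

text \<open>Covers the pairs \<open>(cosh, sinh)\<close> and \<open>(sin, cos)\<close>. Neither function can be treated alone,
  because the chain rule for one brings in the other.\<close>

lemma Ck_on_compose_pair:
  fixes u v :: "real \<Rightarrow> real"
  assumes u: "\<And>x. (u has_real_derivative v x) (at x)"
    and v: "\<And>x. (v has_real_derivative c * u x) (at x)"
  shows "Ck_on k J f \<Longrightarrow> Ck_on k J (\<lambda>t. u (f t)) \<and> Ck_on k J (\<lambda>t. v (f t))"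
proof (induction k)
  case 0
  have "continuous_on UNIV u" "continuous_on UNIV v"
    using u v by (auto simp: continuous_on_eq_continuous_at intro: DERIV_isCont)
  then show ?case using 0 by (auto intro: continuous_on_compose2)
next
  case (Suc k)
  obtain f' where f': "\<forall>t\<in>J. (f has_vector_derivative f' t) (at t within J)" "Ck_on k J f'"
    using Suc.prems by auto
  have IH: "Ck_on k J (\<lambda>t. u (f t))" "Ck_on k J (\<lambda>t. v (f t))"
    using Suc Ck_on_Suc_imp by blast+
  have "Ck_on k J (\<lambda>t. v (f t) * f' t)" "Ck_on k J (\<lambda>t. c * u (f t) * f' t)"
    by (intro bounded_bilinear.Ck_on[OF bounded_bilinear_mult] IH f' Ck_on_const)+
  moreover have "\<forall>t\<in>J. ((\<lambda>t. u (f t)) has_vector_derivative v (f t) * f' t) (at t within J)"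
    "\<forall>t\<in>J. ((\<lambda>t. v (f t)) has_vector_derivative c * u (f t) * f' t) (at t within J)"
    using f' DERIV_chain2[OF u] DERIV_chain2[OF v]
    by (auto simp: has_real_derivative_iff_has_vector_derivative[symmetric])
  ultimately show ?case by auto
qed

lemma smooth_on_cong: "smooth_on J f \<Longrightarrow> (\<And>t. t \<in> J \<Longrightarrow> f t = g t) \<Longrightarrow> smooth_on J g"
  unfolding smooth_on_def using Ck_on_cong by blast

lemma smooth_on_subset: "smooth_on I f \<Longrightarrow> J \<subseteq> I \<Longrightarrow> smooth_on J f"
  unfolding smooth_on_def using Ck_on_subset by blast

lemma smooth_on_continuous: "smooth_on J f \<Longrightarrow> continuous_on J f"
  unfolding smooth_on_def by (metis Ck_on.simps(1))

text \<open>On a nondegenerate interval derivatives are unique, so that the derivatives of all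
  orders that are chosen separately for each \<open>k\<close> in \<open>Ck_on\<close> agree with any given one.\<close>

lemma smooth_on_derivative:
  assumes "nondeg_interval J" "smooth_on J f"
    and f': "\<And>t. t \<in> J \<Longrightarrow> (f has_vector_derivative f' t) (at t within J)"
  shows "smooth_on J f'"
  unfolding smooth_on_def
proof
  fix k
  obtain g where "\<forall>t\<in>J. (f has_vector_derivative g t) (at t within J)" "Ck_on k J g"
    using assms(2) unfolding smooth_on_def by (metis Ck_on.simps(2))
  moreover from this have "g t = f' t" if "t \<in> J" for t
    using has_vector_derivative_unique_on[OF assms(1) that] f'[OF that] that by blast
  ultimately show "Ck_on k J f'" using Ck_on_cong by blast
qed

lemma smooth_on_antiderivative:
  assumes "smooth_on J f'" and "\<And>t. t \<in> J \<Longrightarrow> (f has_vector_derivative f' t) (at t within J)"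
  shows "smooth_on J f"
  using assms Ck_on_Suc_imp unfolding smooth_on_def by (metis Ck_on.simps(2))

lemma smooth_on_vector_derivative:
  assumes "nondeg_interval J" "smooth_on J f" "t \<in> J"
  shows "(f has_vector_derivative vector_derivative f (at t within J)) (at t within J)"
proof -
  have "f differentiable (at t within J)"
    using assms unfolding smooth_on_def
    by (metis Ck_on.simps(2) differentiableI_vector)
  then show ?thesis
    using vector_derivative_works nondeg_interval_at_within_neq_bot assms by blast
qed

named_theorems smooth_intros

lemma smooth_on_const [smooth_intros]: "smooth_on J (\<lambda>_. c)"
  unfolding smooth_on_def by (simp add: Ck_on_const)

lemma smooth_on_add [smooth_intros]:
  "smooth_on J f \<Longrightarrow> smooth_on J g \<Longrightarrow> smooth_on J (\<lambda>t. f t + g t)"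
  unfolding smooth_on_def by (simp add: Ck_on_add)

lemma (in bounded_bilinear) smooth_on:
  "smooth_on J f \<Longrightarrow> smooth_on J g \<Longrightarrow> smooth_on J (\<lambda>t. prod (f t) (g t))"
  unfolding smooth_on_def by (simp add: Ck_on)

lemmas smooth_on_scaleR [smooth_intros] = bounded_bilinear.smooth_on[OF bounded_bilinear_scaleR]

lemmas smooth_on_mult [smooth_intros] =
  bounded_bilinear.smooth_on[OF bounded_bilinear_mult[where 'a = real]]

lemma smooth_on_minus [smooth_intros]: "smooth_on J f \<Longrightarrow> smooth_on J (\<lambda>t. - f t)"
  using smooth_on_scaleR[OF smooth_on_const[of J "-1"]] by fastforce

lemma smooth_on_diff [smooth_intros]:
  "smooth_on J f \<Longrightarrow> smooth_on J g \<Longrightarrow> smooth_on J (\<lambda>t. f t - g t)"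
  using smooth_on_add[OF _ smooth_on_minus] by fastforce

lemma smooth_on_divide_const [smooth_intros]:
  fixes f :: "real \<Rightarrow> real"
  shows "smooth_on J f \<Longrightarrow> smooth_on J (\<lambda>t. f t / c)"
  using smooth_on_mult[OF _ smooth_on_const[of J "inverse c"]] by (fastforce simp: divide_inverse)

lemma smooth_on_power2 [smooth_intros]:
  fixes f :: "real \<Rightarrow> real"
  shows "smooth_on J f \<Longrightarrow> smooth_on J (\<lambda>t. (f t)^2)"
  unfolding power2_eq_square by (intro smooth_intros)

lemma smooth_on_cosh_sinh [smooth_intros]:
  fixes f :: "real \<Rightarrow> real"
  assumes "smooth_on J f"
  shows "smooth_on J (\<lambda>t. cosh (f t))" and "smooth_on J (\<lambda>t. sinh (f t))"
proof -
  have u: "(cosh has_real_derivative sinh x) (at x)" for x :: real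
    by (auto intro!: derivative_eq_intros)
  have v: "(sinh has_real_derivative 1 * cosh x) (at x)" for x :: real
    by (auto intro!: derivative_eq_intros)
  show "smooth_on J (\<lambda>t. cosh (f t))" "smooth_on J (\<lambda>t. sinh (f t))"
    using assms Ck_on_compose_pair[of cosh sinh 1, OF u v] unfolding smooth_on_def by simp_all
qed

lemma smooth_on_cos_sin [smooth_intros]:
  fixes f :: "real \<Rightarrow> real"
  assumes "smooth_on J f"
  shows "smooth_on J (\<lambda>t. cos (f t))" and "smooth_on J (\<lambda>t. sin (f t))"
proof -
  have u: "(sin has_real_derivative cos x) (at x)" for x :: real
    by (auto intro!: derivative_eq_intros)
  have v: "(cos has_real_derivative (-1) * sin x) (at x)" for x :: real
    by (auto intro!: derivative_eq_intros)
  show "smooth_on J (\<lambda>t. cos (f t))" "smooth_on J (\<lambda>t. sin (f t))"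
    using assms Ck_on_compose_pair[of sin cos "-1", OF u v] unfolding smooth_on_def by simp_all
qed

text \<open>The density hypotheses concern \<open>I\<close>, whereas solutions of the Riccati equations may live
  on a subinterval only. A nondegenerate subinterval has interior points arbitrarily close to
  each of its points, and density is a local matter there.\<close>

lemma dense_in_subinterval:
  assumes "dense_in I P" "nondeg_interval J" "J \<subseteq> I"
  shows "dense_in J P"
  unfolding dense_in_def
proof
  fix t assume t: "t \<in> J"
  obtain a b where ab: "a \<in> J" "b \<in> J" "a < b" and J: "is_interval J"
    using assms unfolding nondeg_interval_def by blast
  show "t \<in> closure {t \<in> J. P t}"
    unfolding closure_approachable
  proof (intro allI impI)
    fix e :: real assume e: "e > 0"
    \<comment> \<open>An open interval inside \<open>J\<close> and close to \<open>t\<close>, on the side on which \<open>J\<close> continues.\<close>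
    obtain c d where cd: "c < d" "{c<..<d} \<subseteq> J" "\<And>x. x \<in> {c<..<d} \<Longrightarrow> dist x t < e"
    proof (cases "t < b")
      case True
      have "{t..b} \<subseteq> J" using J t ab unfolding is_interval_1 by (meson atLeastAtMost_iff subsetI)
      then show ?thesis using e True by (intro that[of t "min b (t + e)"]) (auto simp: dist_real_def)
    next
      case False
      then have "a < t" using ab by linarith
      have "{a..t} \<subseteq> J" using J t ab unfolding is_interval_1 by (meson atLeastAtMost_iff subsetI)
      then show ?thesis using e \<open>a < t\<close>
        by (intro that[of "max a (t - e)" t]) (auto simp: dist_real_def)
    qed
    have "(c + d) / 2 \<in> closure {t \<in> I. P t}"
      using assms(1,3) cd(1,2) unfolding dense_in_def by (auto simp: field_simps subset_iff)
    moreover have "open {c<..<d}" "(c + d) / 2 \<in> {c<..<d}" using cd(1) by auto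
    ultimately obtain x where "x \<in> {c<..<d}" "P x"
      unfolding closure_iff_nhds_not_empty by (smt (verit) disjoint_iff mem_Collect_eq order_refl)
    then show "\<exists>y\<in>{t \<in> J. P t}. dist y t < e" using cd by (intro bexI[of _ x]) auto
  qed
qed

lemma continuous_eq_0_of_dense:
  fixes h :: "real \<Rightarrow> real"
  assumes "dense_in J P" "continuous_on J h" "\<And>t. t \<in> J \<Longrightarrow> P t \<Longrightarrow> h t = 0" "t \<in> J"
  shows "h t = 0"
proof -
  have "t \<in> closure {t \<in> J. P t}" using assms(1,4) unfolding dense_in_def by blast
  then obtain x where x: "\<And>k. x k \<in> {t \<in> J. P t}" "x \<longlonglongrightarrow> t"
    unfolding closure_sequential by blast
  then have "(\<lambda>k. h (x k)) \<longlonglongrightarrow> h t"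
    using assms(2,4) unfolding continuous_on_sequentially by (auto simp: o_def)
  moreover have "(\<lambda>k. h (x k)) = (\<lambda>_. 0)" using x assms(3) by auto
  ultimately show ?thesis by (simp add: LIMSEQ_const_iff)
qed

lemma interval_integral_antiderivative:
  assumes I: "is_interval I" "t0 \<in> I" "t \<in> I" and "continuous_on I m"
    and "\<And>t. t \<in> I \<Longrightarrow> (F has_vector_derivative m t) (at t within I)"
  shows "(LBINT \<tau>=t0..t. m \<tau>) = F t - (F t0 :: real)"
proof -
  have sub: "{min t0 t..max t0 t} \<subseteq> I"
  proof
    fix x assume "x \<in> {min t0 t..max t0 t}"
    then have "t0 \<le> x \<and> x \<le> t \<or> t \<le> x \<and> x \<le> t0" by auto
    then show "x \<in> I" using I unfolding is_interval_1 by blast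
  qed
  show ?thesis
  proof (rule interval_integral_FTC_finite)
    show "continuous_on {min t0 t..max t0 t} m" using assms(4) sub by (rule continuous_on_subset)
    show "(F has_vector_derivative m x) (at x within {min t0 t..max t0 t})"
      if "min t0 t \<le> x" "x \<le> max t0 t" for x
      using that sub by (intro has_vector_derivative_within_subset[OF assms(5) sub]) auto
  qed
qed

lemma interval_integral_has_derivative:
  fixes m :: "real \<Rightarrow> real"
  assumes I: "is_interval I" "t0 \<in> I" "t \<in> I" and m: "continuous_on I m"
  shows "((\<lambda>u. LBINT \<tau>=t0..u. m \<tau>) has_vector_derivative m t) (at t within I)"
proof -
  \<comment> \<open>A compact interval that contains \<open>t0\<close> and is a neighbourhood of \<open>t\<close> in \<open>I\<close>: an endpoint
    can only be \<open>t\<close> itself if \<open>I\<close> ends there.\<close>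
  obtain a where a: "a \<in> I" "a \<le> t0" "a \<le> t" "\<And>x. x \<in> I \<Longrightarrow> a < t \<or> t \<le> x"
  proof (cases "\<exists>x\<in>I. x < min t0 t")
    case True
    then show ?thesis using that by force
  next
    case False
    then show ?thesis using I by (intro that[of "min t0 t"]) (auto simp: min_def not_less)
  qed
  obtain b where b: "b \<in> I" "t0 \<le> b" "t \<le> b" "\<And>x. x \<in> I \<Longrightarrow> t < b \<or> x \<le> t"
  proof (cases "\<exists>x\<in>I. x > max t0 t")
    case True
    then show ?thesis using that by force
  next
    case False
    then show ?thesis using I by (intro that[of "max t0 t"]) (auto simp: max_def not_less)
  qed
  have sub: "{a..b} \<subseteq> I" using I a(1) b(1) unfolding is_interval_1 by (meson atLeastAtMost_iff subsetI)
  define a' where "a' = (if a < t then a else t - 1)"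
  define b' where "b' = (if t < b then b else t + 1)"
  have "at t within I = at t within {a..b}"
  proof (rule at_within_nhd)
    show "t \<in> {a'<..<b'}" by (simp add: a'_def b'_def)
    show "I \<inter> {a'<..<b'} - {t} = {a..b} \<inter> {a'<..<b'} - {t}"
    proof -
      have "x \<in> {a..b}" if x: "x \<in> I" "x \<in> {a'<..<b'}" "x \<noteq> t" for x
        using x a(3) b(3) a(4)[OF x(1)] b(4)[OF x(1)]
        by (cases "x < t") (auto simp: a'_def b'_def)
      then show ?thesis using sub by blast
    qed
  qed simp
  moreover have "((\<lambda>u. LBINT \<tau>=t0..u. m \<tau>) has_vector_derivative m t) (at t within {a..b})"
    using a(2,3) b(2,3) continuous_on_subset[OF m sub] by (intro interval_integral_FTC2) auto
  ultimately show ?thesis by simp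
qed


section \<open>The frame of an orthogonal pair\<close>

text \<open>The three targets of Legendre curves differ only in the squares of the two vectors.
  Keeping the squares as parameters makes one computation serve all of them.\<close>

definition orthopairs :: "real \<Rightarrow> real \<Rightarrow> ((real^3) \<times> (real^3)) set" where
  "orthopairs \<sigma> \<tau> = {(v, w). lprod v v = \<sigma> \<and> lprod w w = \<tau> \<and> lprod v w = 0}"

lemma Delta_eq_orthopairs:
  "Delta1 = orthopairs (-1) 1" "Delta1bar = orthopairs 1 (-1)" "Delta5 = orthopairs 1 1"
  by (auto simp: Delta1_def Delta1bar_def Delta5_def orthopairs_def H2_def S21_def)

text \<open>The vector with coordinates \<open>a\<close>, \<open>b\<close>, \<open>c\<close> in the frame that a pair and its wedge product
  form. All constructions have this shape.\<close>

definition frame :: "real \<Rightarrow> real \<Rightarrow> real \<Rightarrow> real^3 \<Rightarrow> real^3 \<Rightarrow> real^3" where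
  "frame a b c v w = a *\<^sub>R v + b *\<^sub>R w + c *\<^sub>R lwedge v w"

lemma bounded_bilinear_lwedge: "bounded_bilinear lwedge"
  unfolding bilinear_conv_bounded_bilinear[symmetric] bilinear_def linear_iff
  by (auto simp: lwedge_def vec_eq_iff forall_3 algebra_simps)

lemma bounded_bilinear_lprod: "bounded_bilinear lprod"
  unfolding bilinear_conv_bounded_bilinear[symmetric] bilinear_def linear_iff
  by (auto simp: lprod_def algebra_simps)

lemma lwedge_skew: "lwedge w v = - lwedge v w"
  by (simp add: lwedge_def vec_eq_iff forall_3)

lemma lwedge_minus_right: "lwedge v (- w) = - lwedge v w"
  by (rule bounded_bilinear.minus_right[OF bounded_bilinear_lwedge])

text \<open>The Lorentzian counterpart of the vector triple product. For a pair in \<open>orthopairs \<sigma> \<tau>\<close>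
  it gives the wedge table \<open>v \<and> \<mu> = \<sigma>w\<close>, \<open>w \<and> \<mu> = -\<tau>v\<close> of the frame, where \<open>\<mu> = v \<and> w\<close>.\<close>

lemma lwedge_triple:
  "lwedge v (lwedge v w) = lprod v v *\<^sub>R w - lprod v w *\<^sub>R v"
  "lwedge w (lwedge v w) = lprod v w *\<^sub>R w - lprod w w *\<^sub>R v"
  by (simp_all add: lwedge_def lprod_def vec_eq_iff forall_3 algebra_simps)

lemma lprod_lwedge:
  "lprod (lwedge v w) (lwedge v w) = (lprod v w)^2 - lprod v v * lprod w w"
  "lprod v (lwedge v w) = 0" "lprod w (lwedge v w) = 0"
  by (simp_all add: lwedge_def lprod_def power2_eq_square algebra_simps)

lemma lprod_commute: "lprod v w = lprod w v"
  by (simp add: lprod_def)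

lemma lprod_frame:
  assumes "(v, w) \<in> orthopairs \<sigma> \<tau>"
  shows "lprod (frame a b c v w) (frame a' b' c' v w) = \<sigma> * (a * a') + \<tau> * (b * b') - \<sigma> * \<tau> * (c * c')"
  using assms unfolding frame_def orthopairs_def
  by (simp add: bounded_bilinear.add_left[OF bounded_bilinear_lprod]
      bounded_bilinear.add_right[OF bounded_bilinear_lprod]
      bounded_bilinear.scaleR_left[OF bounded_bilinear_lprod]
      bounded_bilinear.scaleR_right[OF bounded_bilinear_lprod]
      lprod_lwedge lprod_commute[of "lwedge v w"] lprod_commute[of w v] algebra_simps)

lemma lwedge_frame:
  assumes "(v, w) \<in> orthopairs \<sigma> \<tau>"
  shows "lwedge (frame a b c v w) (frame a' b' c' v w)
    = frame (- \<tau> * (b * c' - c * b')) (\<sigma> * (a * c' - c * a')) (a * b' - b * a') v w"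
proof -
  have "lwedge v v = 0" "lwedge w w = 0" "lwedge (lwedge v w) (lwedge v w) = 0"
    by (simp_all add: lwedge_def vec_eq_iff forall_3)
  moreover have "lwedge (lwedge v w) v = - (\<sigma> *\<^sub>R w)" "lwedge (lwedge v w) w = \<tau> *\<^sub>R v"
    "lwedge v (lwedge v w) = \<sigma> *\<^sub>R w" "lwedge w (lwedge v w) = - (\<tau> *\<^sub>R v)"
    using assms unfolding orthopairs_def by (auto simp: lwedge_skew[of "lwedge v w"] lwedge_triple)
  ultimately show ?thesis
    unfolding frame_def
    by (simp add: bounded_bilinear.add_left[OF bounded_bilinear_lwedge]
        bounded_bilinear.add_right[OF bounded_bilinear_lwedge]
        bounded_bilinear.scaleR_left[OF bounded_bilinear_lwedge]
        bounded_bilinear.scaleR_right[OF bounded_bilinear_lwedge]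
        lwedge_skew[of w v] algebra_simps)
qed

text \<open>Composition of constructions. The evolute of an involute is a vector with known
  coordinates in the frame of the involute; this lemma converts them to coordinates in the
  frame of the original curve, so that an identity between curves becomes three identities
  between real numbers.\<close>

lemma frame_frame:
  assumes "(v, w) \<in> orthopairs \<sigma> \<tau>"
  shows "frame a b c (frame x1 x2 x3 v w) (frame y1 y2 y3 v w)
    = frame (a * x1 + b * y1 - c * (\<tau> * (x2 * y3 - x3 * y2)))
         (a * x2 + b * y2 + c * (\<sigma> * (x1 * y3 - x3 * y1)))
         (a * x3 + b * y3 + c * (x1 * y2 - x2 * y1)) v w"
  unfolding frame_def[of a b c] lwedge_frame[OF assms] by (simp add: frame_def algebra_simps)

lemma frame_basis [simp]: "frame 1 0 0 v w = v" "frame 0 1 0 v w = w" "frame 0 0 1 v w = lwedge v w"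
  by (simp_all add: frame_def)

lemma frame_uminus: "- frame a b c v w = frame (- a) (- b) (- c) v w"
  by (simp add: frame_def)

lemma lwedge_neq_0:
  assumes "D \<in> {Delta1, Delta1bar, Delta5}" "(v, w) \<in> D"
  shows "lwedge v w \<noteq> 0"
proof
  assume "lwedge v w = 0"
  then have "lprod (lwedge v w) (lwedge v w) = 0" by (simp add: lprod_def)
  then show False
    using assms by (auto simp: Delta_eq_orthopairs orthopairs_def lprod_lwedge)
qed


section \<open>Curvature of Legendre curves\<close>

lemma legendre_curvD:
  assumes "legendre_curv D J \<gamma> \<nu> m n"
  shows "smooth_on J \<gamma>" "smooth_on J \<nu>" "t \<in> J \<Longrightarrow> (\<gamma> t, \<nu> t) \<in> D"
    "t \<in> J \<Longrightarrow> (\<gamma> has_vector_derivative m t *\<^sub>R mu \<gamma> \<nu> t) (at t within J)"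
    "t \<in> J \<Longrightarrow> (\<nu> has_vector_derivative n t *\<^sub>R mu \<gamma> \<nu> t) (at t within J)"
  using assms unfolding legendre_curv_def legendre_def curvature_def by auto

lemma legendre_curvI:
  assumes "nondeg_interval J" "smooth_on J \<gamma>" "smooth_on J \<nu>" "\<And>t. t \<in> J \<Longrightarrow> (\<gamma> t, \<nu> t) \<in> D"
    and "\<And>t. t \<in> J \<Longrightarrow> (\<gamma> has_vector_derivative m t *\<^sub>R mu \<gamma> \<nu> t) (at t within J)"
    and "\<And>t. t \<in> J \<Longrightarrow> (\<nu> has_vector_derivative n t *\<^sub>R mu \<gamma> \<nu> t) (at t within J)"
  shows "legendre_curv D J \<gamma> \<nu> m n"
proof -
  have "lprod (vector_derivative \<gamma> (at t within J)) (\<nu> t) = 0" if "t \<in> J" for t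
  proof -
    have "vector_derivative \<gamma> (at t within J) = m t *\<^sub>R mu \<gamma> \<nu> t"
      using assms that nondeg_interval_at_within_neq_bot by (intro vector_derivative_within) auto
    then show ?thesis
      using lprod_lwedge(3)[of "\<nu> t" "\<gamma> t"]
      by (simp add: mu_def bounded_bilinear.scaleR_left[OF bounded_bilinear_lprod]
          lprod_commute[of "lwedge _ _"])
  qed
  then show ?thesis
    using assms unfolding legendre_curv_def legendre_def curvature_def by auto
qed

lemma legendre_curv_subset:
  assumes "legendre_curv D I \<gamma> \<nu> m n" "nondeg_interval J" "J \<subseteq> I"
  shows "legendre_curv D J \<gamma> \<nu> m n"
  using legendre_curvD[OF assms(1)] subsetD[OF assms(3)]
  by (intro legendre_curvI assms(2) smooth_on_subset[OF _ assms(3)]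
      has_vector_derivative_within_subset[OF _ assms(3)]) simp_all

text \<open>A derivative determines its coefficient along \<open>mu\<close>, as \<open>mu\<close> is never lightlike and so
  never zero.\<close>

lemma legendre_curv_unique:
  assumes "nondeg_interval J" "D \<in> {Delta1, Delta1bar, Delta5}" "t \<in> J"
    and L: "legendre_curv D J \<gamma> \<nu> m n" and L': "legendre_curv D J \<gamma> \<nu> m' n'"
  shows "m' t = m t" "n' t = n t"
proof -
  have "mu \<gamma> \<nu> t \<noteq> 0"
    using lwedge_neq_0[OF assms(2)] legendre_curvD(3)[OF L assms(3)] by (simp add: mu_def)
  moreover have "m' t *\<^sub>R mu \<gamma> \<nu> t = m t *\<^sub>R mu \<gamma> \<nu> t" "n' t *\<^sub>R mu \<gamma> \<nu> t = n t *\<^sub>R mu \<gamma> \<nu> t"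
    using has_vector_derivative_unique_on[OF assms(1,3)] legendre_curvD(4,5)[OF L assms(3)]
      legendre_curvD(4,5)[OF L' assms(3)] by blast+
  ultimately show "m' t = m t" "n' t = n t" by simp_all
qed

text \<open>The conditions on auxiliary functions assert the existence of some curvature with a
  given property. As the curvature is unique on \<open>J\<close>, the property may be tested on the one at
  hand.\<close>

lemma ex_legendre_curv_iff:
  assumes "nondeg_interval J" "D \<in> {Delta1, Delta1bar, Delta5}" and L: "legendre_curv D J \<gamma> \<nu> m n"
  shows "(\<exists>m n. legendre_curv D J \<gamma> \<nu> m n \<and> R \<and> (\<forall>t\<in>J. Q t (m t) (n t)))
    \<longleftrightarrow> R \<and> (\<forall>t\<in>J. Q t (m t) (n t))"
  using L legendre_curv_unique[OF assms(1,2) _ L] by (metis (full_types))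

lemma smooth_on_mu:
  assumes "legendre_curv D J \<gamma> \<nu> m n"
  shows "smooth_on J (mu \<gamma> \<nu>)"
  unfolding mu_def[abs_def]
  using legendre_curvD(1,2)[OF assms] by (rule bounded_bilinear.smooth_on[OF bounded_bilinear_lwedge])

text \<open>The curvature is recovered from the curve by the smooth expression \<open>\<langle>\<gamma>', \<mu>\<rangle> / \<langle>\<mu>, \<mu>\<rangle>\<close>,
  and likewise from \<open>\<nu>'\<close>.\<close>

lemma smooth_on_curvature:
  assumes "nondeg_interval J" "D \<in> {Delta1, Delta1bar, Delta5}" and L: "legendre_curv D J \<gamma> \<nu> m n"
  shows "smooth_on J m" "smooth_on J n"
proof -
  obtain \<sigma> \<tau> where D: "D = orthopairs \<sigma> \<tau>" "\<sigma> * \<tau> \<noteq> 0" using assms(2) Delta_eq_orthopairs by force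
  have coef: "smooth_on J k"
    if "smooth_on J \<alpha>" "\<And>t. t \<in> J \<Longrightarrow> (\<alpha> has_vector_derivative k t *\<^sub>R mu \<gamma> \<nu> t) (at t within J)"
    for \<alpha> k
  proof -
    have "smooth_on J (\<lambda>t. k t *\<^sub>R mu \<gamma> \<nu> t)" 
      using that by (rule smooth_on_derivative[OF assms(1)])
    then have "smooth_on J (\<lambda>t. lprod (k t *\<^sub>R mu \<gamma> \<nu> t) (mu \<gamma> \<nu> t) / (- \<sigma> * \<tau>))"
      by (intro smooth_on_divide_const
          bounded_bilinear.smooth_on[OF bounded_bilinear_lprod _ smooth_on_mu[OF L]])
    moreover have "lprod (k t *\<^sub>R mu \<gamma> \<nu> t) (mu \<gamma> \<nu> t) / (- \<sigma> * \<tau>) = k t" if "t \<in> J" for t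
      using legendre_curvD(3)[OF L that] D
      by (simp add: mu_def orthopairs_def bounded_bilinear.scaleR_left[OF bounded_bilinear_lprod]
          lprod_lwedge)
    ultimately show ?thesis by (rule smooth_on_cong)
  qed
  show "smooth_on J m" "smooth_on J n"
    using coef[OF legendre_curvD(1,4)[OF L]] coef[OF legendre_curvD(2,5)[OF L]]
    by simp_all
qed

text \<open>Reversing the second vector reverses \<open>mu\<close>, and with it the first component of the
  curvature only. The formulas that mix upper and lower signs arise from this symmetry.\<close>

lemma legendre_curv_uminus:
  assumes "nondeg_interval J" "legendre_curv (orthopairs \<sigma> \<tau>) J \<gamma> \<nu> m n"
  shows "legendre_curv (orthopairs \<sigma> \<tau>) J \<gamma> (\<lambda>t. - \<nu> t) (\<lambda>t. - m t) n"
proof -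
  have mu: "mu \<gamma> (\<lambda>t. - \<nu> t) t = - mu \<gamma> \<nu> t" for t by (simp add: mu_def lwedge_minus_right)
  show ?thesis
    using legendre_curvD[OF assms(2)] assms(1)
    by (intro legendre_curvI smooth_intros)
      (auto simp: mu orthopairs_def bounded_bilinear.minus_left[OF bounded_bilinear_lprod]
        bounded_bilinear.minus_right[OF bounded_bilinear_lprod] intro: has_vector_derivative_minus)
qed

text \<open>Exchanging the two vectors identifies Legendre curves in \<open>Delta1\<close> with those in
  \<open>Delta1bar\<close>, and carries the hyperbolic and de Sitter evolutes of the former to those of the
  latter.\<close>

lemma legendre_curv_swap:
  assumes "nondeg_interval J" "legendre_curv (orthopairs \<sigma> \<tau>) J \<gamma> \<nu> m n"
  shows "legendre_curv (orthopairs \<tau> \<sigma>) J \<nu> \<gamma> (\<lambda>t. - n t) (\<lambda>t. - m t)"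
proof -
  have mu: "mu \<nu> \<gamma> t = - mu \<gamma> \<nu> t" for t by (simp add: mu_def lwedge_skew[of "\<nu> t"])
  show ?thesis
    using legendre_curvD[OF assms(2)] assms(1)
    by (intro legendre_curvI) (auto simp: mu orthopairs_def lprod_commute)
qed

text \<open>The third structure equation of the frame, \<open>\<mu>' = \<tau> m \<gamma> + \<sigma> n \<nu>\<close>, for all three kinds of
  curves at once.\<close>

lemma mu_has_vector_derivative:
  assumes L: "legendre_curv (orthopairs \<sigma> \<tau>) J \<gamma> \<nu> m n" and "t \<in> J"
  shows "(mu \<gamma> \<nu> has_vector_derivative frame (\<tau> * m t) (\<sigma> * n t) 0 (\<gamma> t) (\<nu> t)) (at t within J)"
proof -
  note pt = legendre_curvD(3)[OF assms]
  have "((\<lambda>t. lwedge (\<gamma> t) (\<nu> t)) has_vector_derivative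
      lwedge (\<gamma> t) (n t *\<^sub>R mu \<gamma> \<nu> t) + lwedge (m t *\<^sub>R mu \<gamma> \<nu> t) (\<nu> t)) (at t within J)"
    by (rule bounded_bilinear.has_vector_derivative[OF bounded_bilinear_lwedge])
      (use legendre_curvD[OF L] assms(2) in auto)
  moreover have "lwedge (\<gamma> t) (mu \<gamma> \<nu> t) = \<sigma> *\<^sub>R \<nu> t" "lwedge (mu \<gamma> \<nu> t) (\<nu> t) = \<tau> *\<^sub>R \<gamma> t"
    using lwedge_frame[OF pt, of 1 0 0 0 0 1] lwedge_frame[OF pt, of 0 0 1 0 1 0]
    by (simp_all add: frame_def mu_def)
  ultimately show ?thesis
    by (simp add: bounded_bilinear.scaleR_left[OF bounded_bilinear_lwedge]
        bounded_bilinear.scaleR_right[OF bounded_bilinear_lwedge] frame_def mu_def[abs_def] algebra_simps)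
qed

lemma frame_has_vector_derivative:
  assumes L: "legendre_curv (orthopairs \<sigma> \<tau>) J \<gamma> \<nu> m n" and t: "t \<in> J"
    and a: "(a has_real_derivative a') (at t within J)"
    and b: "(b has_real_derivative b') (at t within J)"
    and c: "(c has_real_derivative c') (at t within J)"
  shows "((\<lambda>t. frame (a t) (b t) (c t) (\<gamma> t) (\<nu> t)) has_vector_derivative
      frame (a' + \<tau> * m t * c t) (b' + \<sigma> * n t * c t) (c' + m t * a t + n t * b t) (\<gamma> t) (\<nu> t))
      (at t within J)"
  unfolding frame_def mu_def[symmetric]
  by (rule has_vector_derivative_eq_rhs[OF has_vector_derivative_add[OF has_vector_derivative_add[OF
      has_vector_derivative_scaleR[OF a legendre_curvD(4)[OF L t]]
      has_vector_derivative_scaleR[OF b legendre_curvD(5)[OF L t]]]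
      has_vector_derivative_scaleR[OF c mu_has_vector_derivative[OF L t]]]])
    (simp add: frame_def mu_def algebra_simps)

lemma smooth_on_frame:
  assumes "legendre_curv D J \<gamma> \<nu> m n" "smooth_on J a" "smooth_on J b" "smooth_on J c"
  shows "smooth_on J (\<lambda>t. frame (a t) (b t) (c t) (\<gamma> t) (\<nu> t))"
  unfolding frame_def mu_def[symmetric]
  using assms(2-) legendre_curvD(1,2)[OF assms(1)] smooth_on_mu[OF assms(1)]
  by (intro smooth_intros)

text \<open>The tool by which every curvature below is computed. If two curves are given by
  coordinates in the moving frame, being a Legendre curve with curvature \<open>(p, q)\<close> is a
  condition on coordinates: \<open>ortho\<close> expresses the inner products, and the right-hand sides in
  the last two assumptions are the coordinates of \<open>p\<close> and \<open>q\<close> times the wedge product of the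
  two curves.\<close>

lemma legendre_curv_frame:
  assumes J: "nondeg_interval J" and L: "legendre_curv (orthopairs \<sigma> \<tau>) J \<gamma> \<nu> m n"
    and smooth: "smooth_on J x1" "smooth_on J x2" "smooth_on J x3"
      "smooth_on J y1" "smooth_on J y2" "smooth_on J y3"
    and deriv: "\<And>t. t \<in> J \<Longrightarrow>
      (x1 has_real_derivative x1' t) (at t within J) \<and> (x2 has_real_derivative x2' t) (at t within J) \<and>
      (x3 has_real_derivative x3' t) (at t within J) \<and> (y1 has_real_derivative y1' t) (at t within J) \<and>
      (y2 has_real_derivative y2' t) (at t within J) \<and> (y3 has_real_derivative y3' t) (at t within J)"
    and ortho: "\<And>t. t \<in> J \<Longrightarrow>
      \<sigma> * (x1 t)^2 + \<tau> * (x2 t)^2 - \<sigma> * \<tau> * (x3 t)^2 = \<sigma>' \<and>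
      \<sigma> * (y1 t)^2 + \<tau> * (y2 t)^2 - \<sigma> * \<tau> * (y3 t)^2 = \<tau>' \<and>
      \<sigma> * (x1 t * y1 t) + \<tau> * (x2 t * y2 t) - \<sigma> * \<tau> * (x3 t * y3 t) = 0"
    and p: "\<And>t. t \<in> J \<Longrightarrow>
      x1' t + \<tau> * m t * x3 t = p t * (- \<tau> * (x2 t * y3 t - x3 t * y2 t)) \<and>
      x2' t + \<sigma> * n t * x3 t = p t * (\<sigma> * (x1 t * y3 t - x3 t * y1 t)) \<and>
      x3' t + m t * x1 t + n t * x2 t = p t * (x1 t * y2 t - x2 t * y1 t)"
    and q: "\<And>t. t \<in> J \<Longrightarrow>
      y1' t + \<tau> * m t * y3 t = q t * (- \<tau> * (x2 t * y3 t - x3 t * y2 t)) \<and>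
      y2' t + \<sigma> * n t * y3 t = q t * (\<sigma> * (x1 t * y3 t - x3 t * y1 t)) \<and>
      y3' t + m t * y1 t + n t * y2 t = q t * (x1 t * y2 t - x2 t * y1 t)"
  shows "legendre_curv (orthopairs \<sigma>' \<tau>') J
    (\<lambda>t. frame (x1 t) (x2 t) (x3 t) (\<gamma> t) (\<nu> t)) (\<lambda>t. frame (y1 t) (y2 t) (y3 t) (\<gamma> t) (\<nu> t)) p q"
    (is "legendre_curv _ J ?X ?Y p q")
proof (rule legendre_curvI[OF J])
  show "smooth_on J ?X" "smooth_on J ?Y" using smooth by (intro smooth_on_frame[OF L]; simp)+
next
  fix t assume t: "t \<in> J"
  note pt = legendre_curvD(3)[OF L t]
  show "(?X t, ?Y t) \<in> orthopairs \<sigma>' \<tau>'"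
    unfolding orthopairs_def using ortho[OF t] by (simp add: lprod_frame[OF pt] power2_eq_square)
  have mu: "k *\<^sub>R mu ?X ?Y t
      = frame (k * (- \<tau> * (x2 t * y3 t - x3 t * y2 t))) (k * (\<sigma> * (x1 t * y3 t - x3 t * y1 t)))
          (k * (x1 t * y2 t - x2 t * y1 t)) (\<gamma> t) (\<nu> t)" for k
    unfolding mu_def lwedge_frame[OF pt] by (simp add: frame_def algebra_simps)
  show "(?X has_vector_derivative p t *\<^sub>R mu ?X ?Y t) (at t within J)"
    using frame_has_vector_derivative[OF L t, of x1 "x1' t" x2 "x2' t" x3 "x3' t"] deriv[OF t] p[OF t]
    unfolding mu by simp
  show "(?Y has_vector_derivative q t *\<^sub>R mu ?X ?Y t) (at t within J)"
    using frame_has_vector_derivative[OF L t, of y1 "y1' t" y2 "y2' t" y3 "y3' t"] deriv[OF t] q[OF t]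
    unfolding mu by simp
qed

lemma int_fun_has_derivative:
  assumes "nondeg_interval I" "t0 \<in> I" "D \<in> {Delta1, Delta1bar, Delta5}"
    and L: "legendre_curv D I \<gamma> \<nu> m n" and a: "int_fun D I t0 \<gamma> \<nu> a" and t: "t \<in> I"
  shows "(a has_real_derivative m t) (at t within I)"
proof -
  obtain m' n' where L': "legendre_curv D I \<gamma> \<nu> m' n'"
    and a': "\<And>t. t \<in> I \<Longrightarrow> a t = (LBINT \<tau>=t0..t. m' \<tau>)"
    using a unfolding int_fun_def by blast
  have "((\<lambda>u. LBINT \<tau>=t0..u. m' \<tau>) has_vector_derivative m' t) (at t within I)"
    using assms(1) smooth_on_curvature[OF assms(1,3) L']
    by (intro interval_integral_has_derivative[OF _ assms(2) t] smooth_on_continuous)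
      (simp_all add: nondeg_interval_def)
  then show ?thesis
    using has_vector_derivative_transform[OF t a'] legendre_curv_unique[OF assms(1,3) t L L']
    by (simp add: has_real_derivative_iff_has_vector_derivative)
qed

text \<open>Determines the angle of an involute whenever an antiderivative of the curvature is
  visible. For an evolute, the antiderivative is the angle of the evolute up to sign.\<close>

lemma int_fun_antiderivative:
  assumes "nondeg_interval I" "t0 \<in> I" "D \<in> {Delta1, Delta1bar, Delta5}"
    and L: "legendre_curv D I \<gamma> \<nu> m n" and a: "int_fun D I t0 \<gamma> \<nu> a" and t: "t \<in> I"
    and F: "\<And>t. t \<in> I \<Longrightarrow> (F has_real_derivative m t) (at t within I)"
  shows "a t = F t - F t0"
proof -
  obtain m' n' where L': "legendre_curv D I \<gamma> \<nu> m' n'"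
    and a': "\<And>t. t \<in> I \<Longrightarrow> a t = (LBINT \<tau>=t0..t. m' \<tau>)"
    using a unfolding int_fun_def by blast
  have "(LBINT \<tau>=t0..t. m' \<tau>) = F t - F t0"
    using assms(1) smooth_on_curvature[OF assms(1,3) L'] F legendre_curv_unique[OF assms(1,3) _ L L']
    by (intro interval_integral_antiderivative[OF _ assms(2) t] smooth_on_continuous)
      (simp_all add: nondeg_interval_def has_real_derivative_iff_has_vector_derivative)
  then show ?thesis using a' t by simp
qed

lemma int_fun_exists: "legendre_curv D I \<gamma> \<nu> m n \<Longrightarrow> \<exists>a. int_fun D I t0 \<gamma> \<nu> a"
  unfolding int_fun_def
  by (rule exI[of _ "\<lambda>t::real. LBINT \<tau>=t0..t. m \<tau>"], rule exI[of _ m], rule exI[of _ n]) simp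


section \<open>Horocyclic evolutes, involutes and parallels in the hyperbolic plane\<close>

lemma horocyclic_hyperbolic_frame:
  "HEh \<epsilon> f \<gamma> \<nu> t = frame (1 + (f t)^2 / 2) (f t) (\<epsilon> * (f t)^2 / 2) (\<gamma> t) (\<nu> t)"
  "DEh \<epsilon> f \<gamma> \<nu> t = frame (- \<epsilon> * (f t)^2 / 2) (- \<epsilon> * f t) (1 - (f t)^2 / 2) (\<gamma> t) (\<nu> t)"
  "HIh \<epsilon> s \<gamma> \<nu> t = frame (1 + (s t)^2 / 2) (\<epsilon> * (s t)^2 / 2) (s t) (\<gamma> t) (\<nu> t)"
  "nuHIh \<epsilon> s \<gamma> \<nu> t = frame (- s t) (- \<epsilon> * s t) (- 1) (\<gamma> t) (\<nu> t)"
  "HPh \<epsilon> l \<gamma> \<nu> t = frame (1 + (l t)^2 / 2) (l t) (\<epsilon> * (l t)^2 / 2) (\<gamma> t) (\<nu> t)"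
  "nuHPh \<epsilon> l \<gamma> \<nu> t = frame (l t) 1 (\<epsilon> * l t) (\<gamma> t) (\<nu> t)"
  by (simp_all add: HEh_def DEh_def HIh_def nuHIh_def HPh_def nuHPh_def frame_def mu_def algebra_simps)

text \<open>Reversing \<open>\<nu>\<close> and the auxiliary function together amounts to reversing \<open>\<epsilon>\<close>, up to the
  sign of the second and third vector.\<close>

lemma horocyclic_hyperbolic_uminus:
  "HEh \<epsilon> f \<gamma> (\<lambda>t. - \<nu> t) t = HEh (- \<epsilon>) (\<lambda>t. - f t) \<gamma> \<nu> t"
  "DEh \<epsilon> f \<gamma> (\<lambda>t. - \<nu> t) t = - DEh (- \<epsilon>) (\<lambda>t. - f t) \<gamma> \<nu> t"
  "muEh \<epsilon> f \<gamma> (\<lambda>t. - \<nu> t) t = - muEh (- \<epsilon>) (\<lambda>t. - f t) \<gamma> \<nu> t"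
  "HIh \<epsilon> f \<gamma> (\<lambda>t. - \<nu> t) t = HIh (- \<epsilon>) (\<lambda>t. - f t) \<gamma> \<nu> t"
  "nuHIh \<epsilon> f \<gamma> (\<lambda>t. - \<nu> t) t = - nuHIh (- \<epsilon>) (\<lambda>t. - f t) \<gamma> \<nu> t"
  "muHIh \<epsilon> f \<gamma> (\<lambda>t. - \<nu> t) t = - muHIh (- \<epsilon>) (\<lambda>t. - f t) \<gamma> \<nu> t"
proof -
  show *: "HEh \<epsilon> f \<gamma> (\<lambda>t. - \<nu> t) t = HEh (- \<epsilon>) (\<lambda>t. - f t) \<gamma> \<nu> t"
    "DEh \<epsilon> f \<gamma> (\<lambda>t. - \<nu> t) t = - DEh (- \<epsilon>) (\<lambda>t. - f t) \<gamma> \<nu> t"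
    "HIh \<epsilon> f \<gamma> (\<lambda>t. - \<nu> t) t = HIh (- \<epsilon>) (\<lambda>t. - f t) \<gamma> \<nu> t"
    "nuHIh \<epsilon> f \<gamma> (\<lambda>t. - \<nu> t) t = - nuHIh (- \<epsilon>) (\<lambda>t. - f t) \<gamma> \<nu> t"
    by (simp_all add: horocyclic_hyperbolic_frame frame_def lwedge_minus_right)
  show "muEh \<epsilon> f \<gamma> (\<lambda>t. - \<nu> t) t = - muEh (- \<epsilon>) (\<lambda>t. - f t) \<gamma> \<nu> t"
    "muHIh \<epsilon> f \<gamma> (\<lambda>t. - \<nu> t) t = - muHIh (- \<epsilon>) (\<lambda>t. - f t) \<gamma> \<nu> t"
    by (simp_all add: muEh_def muHIh_def mu_def * lwedge_minus_right)
qed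

lemma HEh_fun_iff:
  assumes "nondeg_interval J" "legendre_curv Delta1 J \<gamma> \<nu> m n"
  shows "HEh_fun J \<gamma> \<nu> f \<longleftrightarrow> smooth_on J f \<and> (\<forall>t\<in>J. m t + f t * n t = 0)"
  using ex_legendre_curv_iff[OF assms(1) _ assms(2), of "smooth_on J f" "\<lambda>t m n. m + f t * n = 0"]
  unfolding HEh_fun_def by auto

lemma HIh_fun_iff:
  assumes "nondeg_interval J" "legendre_curv Delta1 J \<gamma> \<nu> m n"
  shows "HIh_fun \<epsilon> J \<gamma> \<nu> s \<longleftrightarrow> solves J (\<lambda>t x. (m t + \<epsilon> * n t) / 2 * x^2 - m t) s"
  using ex_legendre_curv_iff[OF assms(1) _ assms(2), of "smooth_on J s"
      "\<lambda>t m n. (s has_real_derivative (m + \<epsilon> * n) / 2 * (s t)^2 - m) (at t within J)"]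
  unfolding HIh_fun_def solves_def by auto

lemma solves_uminus:
  assumes "solves J F s" "\<And>t. t \<in> J \<Longrightarrow> G t (- s t) = - F t (s t)"
  shows "solves J G (\<lambda>t. - s t)"
  using assms by (auto simp: solves_def intro!: smooth_intros derivative_eq_intros)

lemma HIh_fun_uminus:
  assumes "nondeg_interval J" "HIh_fun (- \<epsilon>) J \<gamma> \<nu> s"
  shows "HIh_fun \<epsilon> J \<gamma> (\<lambda>t. - \<nu> t) (\<lambda>t. - s t)"
  using assms legendre_curv_uminus unfolding HIh_fun_def Delta_eq_orthopairs
  by (fastforce elim: solves_uminus simp: field_simps)

lemma HEh_fun_uminus:
  assumes "nondeg_interval J" "HEh_fun J \<gamma> \<nu> f"
  shows "HEh_fun J \<gamma> (\<lambda>t. - \<nu> t) (\<lambda>t. - f t)"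
  using assms legendre_curv_uminus unfolding HEh_fun_def Delta_eq_orthopairs
  by (fastforce intro: smooth_intros)

text \<open>By the Riccati equation for \<open>s\<close> both components of the curvature are multiples of \<open>n + \<epsilon>
  m\<close>, with quotient \<open>- s\<close>.\<close>

lemma legendre_curv_HIh:
  assumes J: "nondeg_interval J" and L: "legendre_curv Delta1 J \<gamma> \<nu> m n" and \<epsilon>: "\<epsilon> \<in> {1, -1}"
    and s: "solves J (\<lambda>t x. (m t + \<epsilon> * n t) / 2 * x^2 - m t) s"
  shows "legendre_curv Delta1 J (HIh \<epsilon> s \<gamma> \<nu>) (nuHIh \<epsilon> s \<gamma> \<nu>)
    (\<lambda>t. - s t * (n t + \<epsilon> * m t)) (\<lambda>t. n t + \<epsilon> * m t)"
proof -
  define s' where "s' t = (m t + \<epsilon> * n t) / 2 * (s t)^2 - m t" for t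
  have deriv: "(s has_real_derivative d) (at t within J)" if "t \<in> J" "d = s' t" for t d
    using s that unfolding solves_def s'_def by blast
  have smooth: "smooth_on J s" using s unfolding solves_def by blast
  show ?thesis
    unfolding horocyclic_hyperbolic_frame[abs_def] Delta_eq_orthopairs
    by (rule legendre_curv_frame[OF J L[unfolded Delta_eq_orthopairs],
        where x1' = "\<lambda>t. s t * s' t" and x2' = "\<lambda>t. \<epsilon> * s t * s' t" and x3' = s'
          and y1' = "\<lambda>t. - s' t" and y2' = "\<lambda>t. - \<epsilon> * s' t" and y3' = "\<lambda>t. 0"])
      (use \<epsilon> in \<open>auto intro!: smooth smooth_intros derivative_eq_intros deriv
        simp: s'_def field_simps power2_eq_square\<close>)
qed

text \<open>The curvature of the involute is \<open>(- s q, q)\<close> with \<open>q = n + \<epsilon> m\<close>. The condition on the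
  function \<open>g\<close> of the evolute therefore reads \<open>(g - s) q = 0\<close>. Since \<open>q\<close> is nonzero on a dense
  set, \<open>g\<close> can only be \<open>s\<close>, and with this function the evolute is the original curve.\<close>

lemma evolute_of_HIh:
  assumes J: "nondeg_interval J" and L: "legendre_curv Delta1 J \<gamma> \<nu> m n" and \<epsilon>: "\<epsilon> \<in> {1, -1}"
    and dense: "dense_in J (\<lambda>t. n t + \<epsilon> * m t \<noteq> 0)" and s: "HIh_fun \<epsilon> J \<gamma> \<nu> s"
  defines "X \<equiv> HIh \<epsilon> s \<gamma> \<nu>" and "Y \<equiv> nuHIh \<epsilon> s \<gamma> \<nu>"
  shows "HEh_fun J X Y s"
    and "HEh_fun J X Y g \<Longrightarrow> t \<in> J \<Longrightarrow>
      HEh \<epsilon> g X Y t = \<gamma> t \<and> DEh \<epsilon> g X Y t = \<nu> t \<and> muEh \<epsilon> g X Y t = mu \<gamma> \<nu> t"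
proof -
  have solves: "solves J (\<lambda>t x. (m t + \<epsilon> * n t) / 2 * x^2 - m t) s"
    using s HIh_fun_iff[OF J L] by blast
  have smooth: "smooth_on J s" using solves unfolding solves_def by blast
  note iff = HEh_fun_iff[OF J legendre_curv_HIh[OF J L \<epsilon> solves], folded X_def Y_def]
  show "HEh_fun J X Y s" unfolding iff using smooth by simp
  assume g: "HEh_fun J X Y g" and t: "t \<in> J"
  have "g t - s t = 0"
  proof (rule continuous_eq_0_of_dense[OF dense _ _ t])
    show "continuous_on J (\<lambda>t. g t - s t)"
      using smooth g unfolding iff by (intro smooth_on_continuous smooth_intros) simp_all
    show "g t - s t = 0" if "t \<in> J" "n t + \<epsilon> * m t \<noteq> 0" for t
    proof -
      have "(g t - s t) * (n t + \<epsilon> * m t) = 0"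
        using g that(1) unfolding iff by (auto simp: algebra_simps)
      then show ?thesis using that(2) by simp
    qed
  qed
  then have gs: "g t = s t" by simp
  note pt = legendre_curvD(3)[OF L t, unfolded Delta_eq_orthopairs]
  have "HEh \<epsilon> g X Y t = frame 1 0 0 (\<gamma> t) (\<nu> t)" "DEh \<epsilon> g X Y t = frame 0 1 0 (\<gamma> t) (\<nu> t)"
    unfolding X_def Y_def horocyclic_hyperbolic_frame frame_frame[OF pt] gs
    by (use \<epsilon> in \<open>auto intro!: arg_cong3[where f = "\<lambda>a b c. frame a b c (\<gamma> t) (\<nu> t)"]
      simp: field_simps power2_eq_square\<close>)
  then show "HEh \<epsilon> g X Y t = \<gamma> t \<and> DEh \<epsilon> g X Y t = \<nu> t \<and> muEh \<epsilon> g X Y t = mu \<gamma> \<nu> t"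
    by (simp add: muEh_def mu_def)
qed

lemma legendre_curv_HEh:
  assumes J: "nondeg_interval J" and L: "legendre_curv Delta1 J \<gamma> \<nu> m n" and \<epsilon>: "\<epsilon> \<in> {1, -1}"
    and smooth: "smooth_on J f" and f: "\<And>t. t \<in> J \<Longrightarrow> m t + f t * n t = 0"
  shows "legendre_curv Delta1 J (HEh \<epsilon> f \<gamma> \<nu>) (DEh \<epsilon> f \<gamma> \<nu>) (m_HEh \<epsilon> J f n) (n_HEh \<epsilon> J f n)"
proof -
  define f' where "f' t = vector_derivative f (at t within J)" for t
  have deriv: "(f has_real_derivative d) (at t within J)" if "t \<in> J" "d = f' t" for t d
    using smooth_on_vector_derivative[OF J smooth] that
    by (simp add: f'_def has_real_derivative_iff_has_vector_derivative)
  have m: "m t = - f t * n t" if "t \<in> J" for t using f[OF that] by simp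
  show ?thesis
    unfolding horocyclic_hyperbolic_frame[abs_def] Delta_eq_orthopairs
    by (rule legendre_curv_frame[OF J L[unfolded Delta_eq_orthopairs],
        where x1' = "\<lambda>t. f t * f' t" and x2' = f' and x3' = "\<lambda>t. \<epsilon> * f t * f' t"
          and y1' = "\<lambda>t. - \<epsilon> * f t * f' t" and y2' = "\<lambda>t. - \<epsilon> * f' t" and y3' = "\<lambda>t. - f t * f' t"])
      (use \<epsilon> in \<open>auto intro!: smooth smooth_intros derivative_eq_intros deriv
        simp: m m_HEh_def n_HEh_def f'_def[symmetric] field_simps power2_eq_square\<close>)
qed

text \<open>If \<open>(p, q)\<close> is the curvature of the evolute, then \<open>p + \<epsilon> q = \<epsilon> n\<close>. Therefore the Riccati
  equation for \<open>S\<close> amounts to \<open>f' - S' = \<epsilon> (n/2) (f\<^sup>2 - S\<^sup>2)\<close>. As \<open>m = - f n\<close>, this is the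
  differential equation of the horocyclic parallels for \<open>f - S\<close>.\<close>

lemma involute_of_HEh:
  assumes I: "nondeg_interval I" and L: "legendre_curv Delta1 I \<gamma> \<nu> m n" and \<epsilon>: "\<epsilon> \<in> {1, -1}"
    and smooth: "smooth_on I f" and f: "\<And>t. t \<in> I \<Longrightarrow> m t + f t * n t = 0"
    and J: "nondeg_interval J" "J \<subseteq> I"
    and S: "solves J (\<lambda>t x. (m_HEh \<epsilon> I f n t + \<epsilon> * n_HEh \<epsilon> I f n t) / 2 * x^2 - m_HEh \<epsilon> I f n t) S"
  defines "X \<equiv> HEh \<epsilon> f \<gamma> \<nu>" and "Y \<equiv> DEh \<epsilon> f \<gamma> \<nu>" and "l \<equiv> \<lambda>t. f t - S t"
  shows "HIh_fun \<epsilon> J X Y S" and "HPh_fun \<epsilon> J \<gamma> \<nu> l"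
    and "t \<in> J \<Longrightarrow> HIh \<epsilon> S X Y t = HPh \<epsilon> l \<gamma> \<nu> t \<and> nuHIh \<epsilon> S X Y t = nuHPh \<epsilon> l \<gamma> \<nu> t \<and>
      muHIh \<epsilon> S X Y t = muHPh \<epsilon> l \<gamma> \<nu> t"
proof -
  note LX = legendre_curv_subset[OF legendre_curv_HEh[OF I L \<epsilon> smooth f] J]
  note LJ = legendre_curv_subset[OF L J]
  show "HIh_fun \<epsilon> J X Y S" using S LX unfolding HIh_fun_def X_def Y_def by blast
  show "HPh_fun \<epsilon> J \<gamma> \<nu> l"
    unfolding HPh_fun_def
  proof (intro exI conjI)
    show "legendre_curv Delta1 J \<gamma> \<nu> m n" by fact
    show "solves J (\<lambda>t x. - \<epsilon> * (x^2 * n t / 2 + x * m t)) l"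
      unfolding solves_def
    proof (intro conjI ballI)
      show "smooth_on J l"
        unfolding l_def using S smooth_on_subset[OF smooth J(2)]
        by (intro smooth_intros) (simp_all add: solves_def)
    next
      fix t assume t: "t \<in> J"
      then have m: "m t = - f t * n t" using f J(2) by fastforce
      have df: "(f has_real_derivative vector_derivative f (at t within I)) (at t within J)"
        using has_vector_derivative_within_subset[OF smooth_on_vector_derivative[OF I smooth] J(2)] t J(2)
        by (auto simp: has_real_derivative_iff_has_vector_derivative)
      have dS: "(S has_real_derivative (m_HEh \<epsilon> I f n t + \<epsilon> * n_HEh \<epsilon> I f n t) / 2 * (S t)^2
          - m_HEh \<epsilon> I f n t) (at t within J)"
        using S t unfolding solves_def by blast
      show "(l has_real_derivative - \<epsilon> * ((l t)^2 * n t / 2 + l t * m t)) (at t within J)"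
        unfolding l_def
        by (rule DERIV_cong[OF DERIV_diff[OF df dS]])
          (use \<epsilon> in \<open>auto simp: m m_HEh_def n_HEh_def field_simps power2_eq_square\<close>)
    qed
  qed
  assume "t \<in> J"
  note pt = legendre_curvD(3)[OF LJ this, unfolded Delta_eq_orthopairs]
  have "HIh \<epsilon> S X Y t = HPh \<epsilon> l \<gamma> \<nu> t" "nuHIh \<epsilon> S X Y t = nuHPh \<epsilon> l \<gamma> \<nu> t"
    unfolding X_def Y_def l_def horocyclic_hyperbolic_frame frame_frame[OF pt]
    by (use \<epsilon> in \<open>auto intro!: arg_cong3[where f = "\<lambda>a b c. frame a b c (\<gamma> t) (\<nu> t)"]
      simp: field_simps power2_eq_square\<close>)
  then show "HIh \<epsilon> S X Y t = HPh \<epsilon> l \<gamma> \<nu> t \<and> nuHIh \<epsilon> S X Y t = nuHPh \<epsilon> l \<gamma> \<nu> t \<and>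
      muHIh \<epsilon> S X Y t = muHPh \<epsilon> l \<gamma> \<nu> t"
    by (simp add: muHIh_def muHPh_def mu_def)
qed


section \<open>Horocyclic evolutes, involutes and parallels in the de Sitter plane\<close>

lemma horocyclic_de_Sitter_frame:
  "bDIh \<epsilon> s \<gamma> \<nu> t = frame (1 - (s t)^2 / 2) (\<epsilon> * (s t)^2 / 2) (s t) (\<gamma> t) (\<nu> t)"
  "bnuDIh \<epsilon> s \<gamma> \<nu> t = frame (- s t) (\<epsilon> * s t) 1 (\<gamma> t) (\<nu> t)"
  "tDEh \<epsilon> f \<gamma> \<nu> t = frame (1 - (f t)^2 / 2) (f t) (\<epsilon> * (f t)^2 / 2) (\<gamma> t) (\<nu> t)"
  "tHEh \<epsilon> f \<gamma> \<nu> t = frame (- \<epsilon> * (f t)^2 / 2) (\<epsilon> * f t) (1 + (f t)^2 / 2) (\<gamma> t) (\<nu> t)"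
  "tDPh \<epsilon> l \<gamma> \<nu> t = frame (1 - (l t)^2 / 2) (l t) (\<epsilon> * (l t)^2 / 2) (\<gamma> t) (\<nu> t)"
  "tnuDPh \<epsilon> l \<gamma> \<nu> t = frame (- l t) 1 (\<epsilon> * l t) (\<gamma> t) (\<nu> t)"
  by (simp_all add: bDIh_def bnuDIh_def tDEh_def tHEh_def tDPh_def tnuDPh_def frame_def mu_def
      algebra_simps)

lemma horocyclic_de_Sitter_uminus:
  "tDEh \<epsilon> f \<gamma> (\<lambda>t. - \<nu> t) t = tDEh (- \<epsilon>) (\<lambda>t. - f t) \<gamma> \<nu> t"
  "tHEh \<epsilon> f \<gamma> (\<lambda>t. - \<nu> t) t = - tHEh (- \<epsilon>) (\<lambda>t. - f t) \<gamma> \<nu> t"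
  "tmuEh \<epsilon> f \<gamma> (\<lambda>t. - \<nu> t) t = - tmuEh (- \<epsilon>) (\<lambda>t. - f t) \<gamma> \<nu> t"
  "bDIh \<epsilon> f \<gamma> (\<lambda>t. - \<nu> t) t = bDIh (- \<epsilon>) (\<lambda>t. - f t) \<gamma> \<nu> t"
  "bnuDIh \<epsilon> f \<gamma> (\<lambda>t. - \<nu> t) t = - bnuDIh (- \<epsilon>) (\<lambda>t. - f t) \<gamma> \<nu> t"
  "bmuDIh \<epsilon> f \<gamma> (\<lambda>t. - \<nu> t) t = - bmuDIh (- \<epsilon>) (\<lambda>t. - f t) \<gamma> \<nu> t"
proof -
  show *: "tDEh \<epsilon> f \<gamma> (\<lambda>t. - \<nu> t) t = tDEh (- \<epsilon>) (\<lambda>t. - f t) \<gamma> \<nu> t"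
    "tHEh \<epsilon> f \<gamma> (\<lambda>t. - \<nu> t) t = - tHEh (- \<epsilon>) (\<lambda>t. - f t) \<gamma> \<nu> t"
    "bDIh \<epsilon> f \<gamma> (\<lambda>t. - \<nu> t) t = bDIh (- \<epsilon>) (\<lambda>t. - f t) \<gamma> \<nu> t"
    "bnuDIh \<epsilon> f \<gamma> (\<lambda>t. - \<nu> t) t = - bnuDIh (- \<epsilon>) (\<lambda>t. - f t) \<gamma> \<nu> t"
    by (simp_all add: horocyclic_de_Sitter_frame frame_def lwedge_minus_right)
  show "tmuEh \<epsilon> f \<gamma> (\<lambda>t. - \<nu> t) t = - tmuEh (- \<epsilon>) (\<lambda>t. - f t) \<gamma> \<nu> t"
    "bmuDIh \<epsilon> f \<gamma> (\<lambda>t. - \<nu> t) t = - bmuDIh (- \<epsilon>) (\<lambda>t. - f t) \<gamma> \<nu> t"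
    by (simp_all add: tmuEh_def bmuDIh_def mu_def * lwedge_minus_right)
qed

lemma tDEh_fun_iff:
  assumes "nondeg_interval J" "legendre_curv Delta5 J \<gamma> \<nu> m n"
  shows "tDEh_fun J \<gamma> \<nu> f \<longleftrightarrow> smooth_on J f \<and> (\<forall>t\<in>J. m t + f t * n t = 0)"
  using ex_legendre_curv_iff[OF assms(1) _ assms(2), of "smooth_on J f" "\<lambda>t m n. m + f t * n = 0"]
  unfolding tDEh_fun_def by auto

lemma bDIh_fun_iff:
  assumes "nondeg_interval J" "legendre_curv Delta1bar J \<gamma> \<nu> m n"
  shows "bDIh_fun \<epsilon> J \<gamma> \<nu> s \<longleftrightarrow> solves J (\<lambda>t x. - ((m t - \<epsilon> * n t) / 2) * x^2 - m t) s"
  using ex_legendre_curv_iff[OF assms(1) _ assms(2), of "smooth_on J s"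
      "\<lambda>t m n. (s has_real_derivative - ((m - \<epsilon> * n) / 2) * (s t)^2 - m) (at t within J)"]
  unfolding bDIh_fun_def solves_def by auto

lemma bDIh_fun_uminus:
  assumes "nondeg_interval J" "bDIh_fun (- \<epsilon>) J \<gamma> \<nu> s"
  shows "bDIh_fun \<epsilon> J \<gamma> (\<lambda>t. - \<nu> t) (\<lambda>t. - s t)"
  using assms legendre_curv_uminus unfolding bDIh_fun_def Delta_eq_orthopairs
  by (fastforce elim: solves_uminus simp: field_simps)

lemma tDEh_fun_uminus:
  assumes "nondeg_interval J" "tDEh_fun J \<gamma> \<nu> f"
  shows "tDEh_fun J \<gamma> (\<lambda>t. - \<nu> t) (\<lambda>t. - f t)"
  using assms legendre_curv_uminus unfolding tDEh_fun_def Delta_eq_orthopairs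
  by (fastforce intro: smooth_intros)

text \<open>Again both components are multiples of one function, now \<open>n - \<epsilon> m\<close>, but with quotient
  \<open>s\<close>. This is why the evolute is formed with \<open>- s\<close>.\<close>

lemma legendre_curv_bDIh:
  assumes J: "nondeg_interval J" and L: "legendre_curv Delta1bar J \<gamma> \<nu> m n" and \<epsilon>: "\<epsilon> \<in> {1, -1}"
    and s: "solves J (\<lambda>t x. - ((m t - \<epsilon> * n t) / 2) * x^2 - m t) s"
  shows "legendre_curv Delta5 J (bDIh \<epsilon> s \<gamma> \<nu>) (bnuDIh \<epsilon> s \<gamma> \<nu>)
    (\<lambda>t. s t * (n t - \<epsilon> * m t)) (\<lambda>t. n t - \<epsilon> * m t)"
proof -
  define s' where "s' t = - ((m t - \<epsilon> * n t) / 2) * (s t)^2 - m t" for t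
  have deriv: "(s has_real_derivative d) (at t within J)" if "t \<in> J" "d = s' t" for t d
    using s that unfolding solves_def s'_def by blast
  have smooth: "smooth_on J s" using s unfolding solves_def by blast
  show ?thesis
    unfolding horocyclic_de_Sitter_frame[abs_def] Delta_eq_orthopairs
    by (rule legendre_curv_frame[OF J L[unfolded Delta_eq_orthopairs],
        where x1' = "\<lambda>t. - s t * s' t" and x2' = "\<lambda>t. \<epsilon> * s t * s' t" and x3' = s'
          and y1' = "\<lambda>t. - s' t" and y2' = "\<lambda>t. \<epsilon> * s' t" and y3' = "\<lambda>t. 0"])
      (use \<epsilon> in \<open>auto intro!: smooth smooth_intros derivative_eq_intros deriv
        simp: s'_def field_simps power2_eq_square\<close>)
qed

lemma evolute_of_bDIh:
  assumes J: "nondeg_interval J" and L: "legendre_curv Delta1bar J \<gamma> \<nu> m n" and \<epsilon>: "\<epsilon> \<in> {1, -1}"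
    and dense: "dense_in J (\<lambda>t. n t - \<epsilon> * m t \<noteq> 0)" and s: "bDIh_fun \<epsilon> J \<gamma> \<nu> s"
  defines "X \<equiv> bDIh \<epsilon> s \<gamma> \<nu>" and "Y \<equiv> bnuDIh \<epsilon> s \<gamma> \<nu>"
  shows "tDEh_fun J X Y (\<lambda>t. - s t)"
    and "tDEh_fun J X Y g \<Longrightarrow> t \<in> J \<Longrightarrow>
      tDEh \<epsilon> g X Y t = \<gamma> t \<and> tHEh \<epsilon> g X Y t = \<nu> t \<and> tmuEh \<epsilon> g X Y t = mu \<gamma> \<nu> t"
proof -
  have solves: "solves J (\<lambda>t x. - ((m t - \<epsilon> * n t) / 2) * x^2 - m t) s"
    using s bDIh_fun_iff[OF J L] by blast
  have smooth: "smooth_on J s" using solves unfolding solves_def by blast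
  note iff = tDEh_fun_iff[OF J legendre_curv_bDIh[OF J L \<epsilon> solves], folded X_def Y_def]
  show "tDEh_fun J X Y (\<lambda>t. - s t)" unfolding iff using smooth by (simp add: smooth_intros)
  assume g: "tDEh_fun J X Y g" and t: "t \<in> J"
  have "g t + s t = 0"
  proof (rule continuous_eq_0_of_dense[OF dense _ _ t])
    show "continuous_on J (\<lambda>t. g t + s t)"
      using smooth g unfolding iff by (intro smooth_on_continuous smooth_intros) simp_all
    show "g t + s t = 0" if "t \<in> J" "n t - \<epsilon> * m t \<noteq> 0" for t
    proof -
      have "(g t + s t) * (n t - \<epsilon> * m t) = 0"
        using g that(1) unfolding iff by (auto simp: algebra_simps)
      then show ?thesis using that(2) by simp
    qed
  qed
  then have gs: "g t = - s t" by simp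
  note pt = legendre_curvD(3)[OF L t, unfolded Delta_eq_orthopairs]
  have "tDEh \<epsilon> g X Y t = frame 1 0 0 (\<gamma> t) (\<nu> t)" "tHEh \<epsilon> g X Y t = frame 0 1 0 (\<gamma> t) (\<nu> t)"
    unfolding X_def Y_def horocyclic_de_Sitter_frame frame_frame[OF pt] gs
    by (use \<epsilon> in \<open>auto intro!: arg_cong3[where f = "\<lambda>a b c. frame a b c (\<gamma> t) (\<nu> t)"]
      simp: field_simps power2_eq_square\<close>)
  then show "tDEh \<epsilon> g X Y t = \<gamma> t \<and> tHEh \<epsilon> g X Y t = \<nu> t \<and> tmuEh \<epsilon> g X Y t = mu \<gamma> \<nu> t"
    by (simp add: tmuEh_def mu_def)
qed

lemma legendre_curv_tDEh:
  assumes J: "nondeg_interval J" and L: "legendre_curv Delta5 J \<gamma> \<nu> m n" and \<epsilon>: "\<epsilon> \<in> {1, -1}"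
    and smooth: "smooth_on J f" and f: "\<And>t. t \<in> J \<Longrightarrow> m t + f t * n t = 0"
  shows "legendre_curv Delta1bar J (tDEh \<epsilon> f \<gamma> \<nu>) (tHEh \<epsilon> f \<gamma> \<nu>)
    (m_tDEh \<epsilon> J f n) (n_tDEh \<epsilon> J f n)"
proof -
  define f' where "f' t = vector_derivative f (at t within J)" for t
  have deriv: "(f has_real_derivative d) (at t within J)" if "t \<in> J" "d = f' t" for t d
    using smooth_on_vector_derivative[OF J smooth] that
    by (simp add: f'_def has_real_derivative_iff_has_vector_derivative)
  have m: "m t = - f t * n t" if "t \<in> J" for t using f[OF that] by simp
  show ?thesis
    unfolding horocyclic_de_Sitter_frame[abs_def] Delta_eq_orthopairs
    by (rule legendre_curv_frame[OF J L[unfolded Delta_eq_orthopairs],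
        where x1' = "\<lambda>t. - f t * f' t" and x2' = f' and x3' = "\<lambda>t. \<epsilon> * f t * f' t"
          and y1' = "\<lambda>t. - \<epsilon> * f t * f' t" and y2' = "\<lambda>t. \<epsilon> * f' t" and y3' = "\<lambda>t. f t * f' t"])
      (use \<epsilon> in \<open>auto intro!: smooth smooth_intros derivative_eq_intros deriv
        simp: m m_tDEh_def n_tDEh_def f'_def[symmetric] field_simps power2_eq_square\<close>)
qed

text \<open>The third vector of the evolute has coordinate \<open>1\<close> along \<open>\<nu>\<close>, where it is \<open>- 1\<close> for
  curves in \<open>Delta1\<close>. This is why the functions of the evolute and of the involute are added
  here.\<close>

lemma involute_of_tDEh:
  assumes I: "nondeg_interval I" and L: "legendre_curv Delta5 I \<gamma> \<nu> m n" and \<epsilon>: "\<epsilon> \<in> {1, -1}"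
    and smooth: "smooth_on I f" and f: "\<And>t. t \<in> I \<Longrightarrow> m t + f t * n t = 0"
    and J: "nondeg_interval J" "J \<subseteq> I"
    and S: "solves J (\<lambda>t x. - ((m_tDEh \<epsilon> I f n t - \<epsilon> * n_tDEh \<epsilon> I f n t) / 2) * x^2
      - m_tDEh \<epsilon> I f n t) S"
  defines "X \<equiv> tDEh \<epsilon> f \<gamma> \<nu>" and "Y \<equiv> tHEh \<epsilon> f \<gamma> \<nu>" and "l \<equiv> \<lambda>t. f t + S t"
  shows "bDIh_fun \<epsilon> J X Y S" and "tDPh_fun \<epsilon> J \<gamma> \<nu> l"
    and "t \<in> J \<Longrightarrow> bDIh \<epsilon> S X Y t = tDPh \<epsilon> l \<gamma> \<nu> t \<and> bnuDIh \<epsilon> S X Y t = tnuDPh \<epsilon> l \<gamma> \<nu> t \<and>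
      bmuDIh \<epsilon> S X Y t = tmuDPh \<epsilon> l \<gamma> \<nu> t"
proof -
  note LX = legendre_curv_subset[OF legendre_curv_tDEh[OF I L \<epsilon> smooth f] J]
  note LJ = legendre_curv_subset[OF L J]
  show "bDIh_fun \<epsilon> J X Y S" using S LX unfolding bDIh_fun_def X_def Y_def by blast
  show "tDPh_fun \<epsilon> J \<gamma> \<nu> l"
    unfolding tDPh_fun_def
  proof (intro exI conjI)
    show "legendre_curv Delta5 J \<gamma> \<nu> m n" by fact
    show "solves J (\<lambda>t x. \<epsilon> * (x^2 * n t / 2 + x * m t)) l"
      unfolding solves_def
    proof (intro conjI ballI)
      show "smooth_on J l"
        unfolding l_def using S smooth_on_subset[OF smooth J(2)]
        by (intro smooth_intros) (simp_all add: solves_def)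
    next
      fix t assume t: "t \<in> J"
      then have m: "m t = - f t * n t" using f J(2) by fastforce
      have df: "(f has_real_derivative vector_derivative f (at t within I)) (at t within J)"
        using has_vector_derivative_within_subset[OF smooth_on_vector_derivative[OF I smooth] J(2)] t J(2)
        by (auto simp: has_real_derivative_iff_has_vector_derivative)
      have dS: "(S has_real_derivative - ((m_tDEh \<epsilon> I f n t - \<epsilon> * n_tDEh \<epsilon> I f n t) / 2) * (S t)^2
          - m_tDEh \<epsilon> I f n t) (at t within J)"
        using S t unfolding solves_def by blast
      show "(l has_real_derivative \<epsilon> * ((l t)^2 * n t / 2 + l t * m t)) (at t within J)"
        unfolding l_def
        by (rule DERIV_cong[OF DERIV_add[OF df dS]])
          (use \<epsilon> in \<open>auto simp: m m_tDEh_def n_tDEh_def field_simps power2_eq_square\<close>)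
    qed
  qed
  assume "t \<in> J"
  note pt = legendre_curvD(3)[OF LJ this, unfolded Delta_eq_orthopairs]
  have "bDIh \<epsilon> S X Y t = tDPh \<epsilon> l \<gamma> \<nu> t" "bnuDIh \<epsilon> S X Y t = tnuDPh \<epsilon> l \<gamma> \<nu> t"
    unfolding X_def Y_def l_def horocyclic_de_Sitter_frame frame_frame[OF pt]
    by (use \<epsilon> in \<open>auto intro!: arg_cong3[where f = "\<lambda>a b c. frame a b c (\<gamma> t) (\<nu> t)"]
      simp: field_simps power2_eq_square\<close>)
  then show "bDIh \<epsilon> S X Y t = tDPh \<epsilon> l \<gamma> \<nu> t \<and> bnuDIh \<epsilon> S X Y t = tnuDPh \<epsilon> l \<gamma> \<nu> t \<and>
      bmuDIh \<epsilon> S X Y t = tmuDPh \<epsilon> l \<gamma> \<nu> t"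
    by (simp add: bmuDIh_def tmuDPh_def mu_def)
qed


section \<open>Hyperbolic and de Sitter evolutes and involutes\<close>

lemma hyperbolic_de_Sitter_frame:
  "HE \<phi> \<gamma> \<nu> t = frame (cosh (\<phi> t)) (sinh (\<phi> t)) 0 (\<gamma> t) (\<nu> t)"
  "DE \<phi> \<gamma> \<nu> t = frame (sinh (\<phi> t)) (cosh (\<phi> t)) 0 (\<gamma> t) (\<nu> t)"
  "HI a \<gamma> \<nu> t = frame (cosh (a t)) 0 (- sinh (a t)) (\<gamma> t) (\<nu> t)"
  "DI a \<gamma> \<nu> t = frame (sinh (a t)) 0 (- cosh (a t)) (\<gamma> t) (\<nu> t)"
  "HP \<theta> \<gamma> \<nu> t = frame (cosh \<theta>) (sinh \<theta>) 0 (\<gamma> t) (\<nu> t)"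
  "DP \<theta> \<gamma> \<nu> t = frame (sinh \<theta>) (cosh \<theta>) 0 (\<gamma> t) (\<nu> t)"
  "bDE \<phi> \<gamma> \<nu> t = frame (cosh (\<phi> t)) (sinh (\<phi> t)) 0 (\<gamma> t) (\<nu> t)"
  "bHE \<phi> \<gamma> \<nu> t = frame (sinh (\<phi> t)) (cosh (\<phi> t)) 0 (\<gamma> t) (\<nu> t)"
  "bDI a \<gamma> \<nu> t = frame (cos (a t)) 0 (- sin (a t)) (\<gamma> t) (\<nu> t)"
  "bnuDI a \<gamma> \<nu> t = frame (sin (a t)) 0 (cos (a t)) (\<gamma> t) (\<nu> t)"
  "bDP \<theta> \<gamma> \<nu> t = frame (cosh \<theta>) (sinh \<theta>) 0 (\<gamma> t) (\<nu> t)"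
  "bHP \<theta> \<gamma> \<nu> t = frame (sinh \<theta>) (cosh \<theta>) 0 (\<gamma> t) (\<nu> t)"
  "tDE \<phi> \<gamma> \<nu> t = frame (cos (\<phi> t)) (sin (\<phi> t)) 0 (\<gamma> t) (\<nu> t)"
  "tDI a \<gamma> \<nu> t = frame (cosh (a t)) 0 (- sinh (a t)) (\<gamma> t) (\<nu> t)"
  "tHI a \<gamma> \<nu> t = frame (- sinh (a t)) 0 (cosh (a t)) (\<gamma> t) (\<nu> t)"
  "tDP \<theta> \<gamma> \<nu> t = frame (cos \<theta>) (sin \<theta>) 0 (\<gamma> t) (\<nu> t)"
  "tnuDP \<theta> \<gamma> \<nu> t = frame (- sin \<theta>) (cos \<theta>) 0 (\<gamma> t) (\<nu> t)"
  "mu \<gamma> \<nu> t = frame 0 0 1 (\<gamma> t) (\<nu> t)"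
  by (simp_all add: HE_def DE_def HI_def DI_def HP_def DP_def bDE_def bHE_def bDI_def bnuDI_def
      bDP_def bHP_def tDE_def tDI_def tHI_def tDP_def tnuDP_def frame_def mu_def)

text \<open>The involutes of the three kinds of curves are one construction. The functions \<open>c\<close>, \<open>s\<close>
  stand for the hyperbolic or circular cosine and sine of the angle \<open>a\<close> with \<open>a' = m\<close>,
  according to \<open>\<kappa> = 1\<close> or \<open>\<kappa> = -1\<close>; the sign \<open>\<kappa>\<close> has to be the square of the second vector for
  the terms with \<open>m\<close> to cancel.\<close>

lemma legendre_curv_involute:
  assumes J: "nondeg_interval J" and L: "legendre_curv (orthopairs \<sigma> \<kappa>) J \<gamma> \<nu> m n"
    and signs: "\<sigma> \<in> {1, -1}" "\<kappa> \<in> {1, -1}" and smooth: "smooth_on J c" "smooth_on J s"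
    and c: "\<And>t. t \<in> J \<Longrightarrow> (c has_real_derivative \<kappa> * m t * s t) (at t within J)"
    and s: "\<And>t. t \<in> J \<Longrightarrow> (s has_real_derivative m t * c t) (at t within J)"
    and cs: "\<And>t. t \<in> J \<Longrightarrow> (c t)^2 = 1 + \<kappa> * (s t)^2"
  shows "legendre_curv (orthopairs \<sigma> (- \<sigma> * \<kappa>)) J
    (\<lambda>t. frame (c t) 0 (- s t) (\<gamma> t) (\<nu> t)) (\<lambda>t. frame (- \<kappa> * s t) 0 (c t) (\<gamma> t) (\<nu> t))
    (\<lambda>t. - n t * s t) (\<lambda>t. n t * c t)"
proof (rule legendre_curv_frame[OF J L, where x1' = "\<lambda>t. \<kappa> * m t * s t" and x2' = "\<lambda>_. 0"
        and x3' = "\<lambda>t. - m t * c t" and y1' = "\<lambda>t. - \<kappa> * m t * c t" and y2' = "\<lambda>_. 0"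
        and y3' = "\<lambda>t. \<kappa> * m t * s t"])
qed (use signs cs in \<open>auto intro!: smooth smooth_intros derivative_eq_intros
    DERIV_cong[OF c] DERIV_cong[OF s] simp: power2_eq_square algebra_simps\<close>)

text \<open>The same for evolutes, with \<open>c\<close>, \<open>s\<close> the functions of an angle with derivative \<open>d\<close>.
  Since the condition \<open>m c + n s = 0\<close> cancels the component along \<open>\<mu>\<close>, the first curvature is
  just the derivative of the angle up to sign.\<close>

lemma legendre_curv_evolute:
  assumes J: "nondeg_interval J" and L: "legendre_curv (orthopairs \<sigma> \<tau>) J \<gamma> \<nu> m n"
    and signs: "\<tau> = - \<sigma> * \<kappa>" "\<sigma> \<in> {1, -1}" "\<kappa> \<in> {1, -1}" and smooth: "smooth_on J c" "smooth_on J s"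
    and c: "\<And>t. t \<in> J \<Longrightarrow> (c has_real_derivative \<kappa> * d t * s t) (at t within J)"
    and s: "\<And>t. t \<in> J \<Longrightarrow> (s has_real_derivative d t * c t) (at t within J)"
    and cs: "\<And>t. t \<in> J \<Longrightarrow> (c t)^2 = 1 + \<kappa> * (s t)^2"
    and mn: "\<And>t. t \<in> J \<Longrightarrow> m t * c t + n t * s t = 0"
  shows "legendre_curv (orthopairs \<sigma> \<kappa>) J
    (\<lambda>t. frame (c t) (s t) 0 (\<gamma> t) (\<nu> t)) (\<lambda>t. frame 0 0 1 (\<gamma> t) (\<nu> t))
    (\<lambda>t. \<sigma> * d t) (\<lambda>t. n t * c t + \<kappa> * m t * s t)"
proof -
  \<comment> \<open>The curve \<open>(m, n)\<close> is a multiple of \<open>(-s,c)\<close>; the factor is the second curvature.\<close>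
  have q: "(n t * c t + \<kappa> * m t * s t) * c t = n t \<and> (n t * c t + \<kappa> * m t * s t) * s t = - m t \<and>
      m t + \<kappa> * m t * s t * s t = - c t * n t * s t"
    if "t \<in> J" for t
    using cs[OF that] mn[OF that] by algebra
  show ?thesis
  proof (rule legendre_curv_frame[OF J L[unfolded signs(1)],
        where x1' = "\<lambda>t. \<kappa> * d t * s t" and x2' = "\<lambda>t. d t * c t"
        and x3' = "\<lambda>t. 0" and y1' = "\<lambda>t. 0" and y2' = "\<lambda>_. 0" and y3' = "\<lambda>t. 0"])
  qed (use signs(2,3) cs mn q in \<open>auto intro!: smooth smooth_intros derivative_eq_intros
    DERIV_cong[OF c] DERIV_cong[OF s] simp: power2_eq_square algebra_simps\<close>)
qed

lemma HE_fun_iff: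
  assumes "nondeg_interval J" "legendre_curv Delta1 J \<gamma> \<nu> m n"
  shows "HE_fun J \<gamma> \<nu> \<phi>
    \<longleftrightarrow> smooth_on J \<phi> \<and> (\<forall>t\<in>J. m t * cosh (\<phi> t) + n t * sinh (\<phi> t) = 0)"
  using ex_legendre_curv_iff[OF assms(1) _ assms(2), of "smooth_on J \<phi>"
      "\<lambda>t m n. m * cosh (\<phi> t) + n * sinh (\<phi> t) = 0"]
  unfolding HE_fun_def by auto

lemma bDE_fun_iff:
  assumes "nondeg_interval J" "legendre_curv Delta1bar J \<gamma> \<nu> m n"
  shows "bDE_fun J \<gamma> \<nu> \<phi>
    \<longleftrightarrow> smooth_on J \<phi> \<and> (\<forall>t\<in>J. m t * cosh (\<phi> t) + n t * sinh (\<phi> t) = 0)"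
  using ex_legendre_curv_iff[OF assms(1) _ assms(2), of "smooth_on J \<phi>"
      "\<lambda>t m n. m * cosh (\<phi> t) + n * sinh (\<phi> t) = 0"]
  unfolding bDE_fun_def by auto

lemma tDE_fun_iff:
  assumes "nondeg_interval J" "legendre_curv Delta5 J \<gamma> \<nu> m n"
  shows "tDE_fun J \<gamma> \<nu> \<phi>
    \<longleftrightarrow> smooth_on J \<phi> \<and> (\<forall>t\<in>J. m t * cos (\<phi> t) + n t * sin (\<phi> t) = 0)"
  using ex_legendre_curv_iff[OF assms(1) _ assms(2), of "smooth_on J \<phi>"
      "\<lambda>t m n. m * cos (\<phi> t) + n * sin (\<phi> t) = 0"]
  unfolding tDE_fun_def by auto

text \<open>The evolutes of \<open>(\<nu>, \<gamma>)\<close> and of \<open>(\<gamma>, \<nu>)\<close> are the same curves. Hence the evolute of \<open>(DI,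
  HI)\<close> is that of \<open>(HI, DI)\<close>, and similarly for \<open>(tHI, tDI)\<close>.\<close>

lemma evolute_swap:
  "bHE \<phi> \<nu> \<gamma> t = HE \<phi> \<gamma> \<nu> t" "DE \<phi> \<nu> \<gamma> t = bDE \<phi> \<gamma> \<nu> t" "mu \<nu> \<gamma> t = - mu \<gamma> \<nu> t"
  by (simp_all add: bHE_def HE_def DE_def bDE_def mu_def lwedge_skew[of "\<nu> t"])

lemma bHE_fun_swap:
  assumes "nondeg_interval J"
  shows "bHE_fun J \<nu> \<gamma> \<phi> \<longleftrightarrow> HE_fun J \<gamma> \<nu> \<phi>"
proof
  assume "bHE_fun J \<nu> \<gamma> \<phi>"
  then obtain m n where "smooth_on J \<phi>" "legendre_curv Delta1bar J \<nu> \<gamma> m n"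
    "\<forall>t\<in>J. m t * sinh (\<phi> t) + n t * cosh (\<phi> t) = 0" unfolding bHE_fun_def by blast
  then show "HE_fun J \<gamma> \<nu> \<phi>"
    using legendre_curv_swap[OF assms] unfolding HE_fun_def Delta_eq_orthopairs
    by (intro conjI exI[of _ "\<lambda>t. - n t"] exI[of _ "\<lambda>t. - m t"]) (auto simp: add_eq_0_iff)
next
  assume "HE_fun J \<gamma> \<nu> \<phi>"
  then obtain m n where "smooth_on J \<phi>" "legendre_curv Delta1 J \<gamma> \<nu> m n"
    "\<forall>t\<in>J. m t * cosh (\<phi> t) + n t * sinh (\<phi> t) = 0" unfolding HE_fun_def by blast
  then show "bHE_fun J \<nu> \<gamma> \<phi>"
    using legendre_curv_swap[OF assms] unfolding bHE_fun_def Delta_eq_orthopairs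
    by (intro conjI exI[of _ "\<lambda>t. - n t"] exI[of _ "\<lambda>t. - m t"]) (auto simp: add_eq_0_iff)
qed

lemma DE_fun_swap:
  assumes "nondeg_interval J"
  shows "DE_fun J \<nu> \<gamma> \<phi> \<longleftrightarrow> bDE_fun J \<gamma> \<nu> \<phi>"
proof
  assume "DE_fun J \<nu> \<gamma> \<phi>"
  then obtain m n where "smooth_on J \<phi>" "legendre_curv Delta1 J \<nu> \<gamma> m n"
    "\<forall>t\<in>J. m t * sinh (\<phi> t) + n t * cosh (\<phi> t) = 0" unfolding DE_fun_def by blast
  then show "bDE_fun J \<gamma> \<nu> \<phi>"
    using legendre_curv_swap[OF assms] unfolding bDE_fun_def Delta_eq_orthopairs
    by (intro conjI exI[of _ "\<lambda>t. - n t"] exI[of _ "\<lambda>t. - m t"]) (auto simp: add_eq_0_iff)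
next
  assume "bDE_fun J \<gamma> \<nu> \<phi>"
  then obtain m n where "smooth_on J \<phi>" "legendre_curv Delta1bar J \<gamma> \<nu> m n"
    "\<forall>t\<in>J. m t * cosh (\<phi> t) + n t * sinh (\<phi> t) = 0" unfolding bDE_fun_def by blast
  then show "DE_fun J \<nu> \<gamma> \<phi>"
    using legendre_curv_swap[OF assms] unfolding DE_fun_def Delta_eq_orthopairs
    by (intro conjI exI[of _ "\<lambda>t. - n t"] exI[of _ "\<lambda>t. - m t"]) (auto simp: add_eq_0_iff)
qed

lemma smooth_on_real_antiderivative:
  "smooth_on J f' \<Longrightarrow> (\<And>t. t \<in> J \<Longrightarrow> (f has_real_derivative f' t) (at t within J)) \<Longrightarrow> smooth_on J f"
  by (rule smooth_on_antiderivative) (simp_all add: has_real_derivative_iff_has_vector_derivative)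

text \<open>The curvature of the involute is \<open>(n sinh a, n cosh a)\<close>, and the condition on the angle
  \<open>p\<close> of the evolute becomes \<open>n sinh (a + p) = 0\<close>. By density of \<open>{n \<noteq> 0}\<close> it forces \<open>p = -a\<close>.\<close>

lemma evolute_of_HI:
  assumes I: "nondeg_interval I" "t0 \<in> I" and L: "legendre_curv Delta1 I \<gamma> \<nu> m n"
    and dense: "dense_in I (\<lambda>t. n t \<noteq> 0)" and a: "int_fun Delta1 I t0 \<gamma> \<nu> a"
  defines "X \<equiv> HI a \<gamma> \<nu>" and "Y \<equiv> DI a \<gamma> \<nu>"
  shows "HE_fun I X Y (\<lambda>t. - a t)"
    and "HE_fun I X Y p \<Longrightarrow> t \<in> I \<Longrightarrow>
      HE p X Y t = \<gamma> t \<and> nuHE X Y t = \<nu> t \<and> muHE p X Y t = mu \<gamma> \<nu> t"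
proof -
  have deriv: "(a has_real_derivative m t) (at t within I)" if "t \<in> I" for t
    using int_fun_has_derivative[OF I _ L a that] by simp
  have smooth: "smooth_on I a"
    using smooth_on_curvature(1)[OF I(1) _ L] deriv by (rule smooth_on_real_antiderivative) simp_all
  have cs: "((\<lambda>t. cosh (a t)) has_real_derivative 1 * m t * sinh (a t)) (at t within I)"
    "((\<lambda>t. sinh (a t)) has_real_derivative m t * cosh (a t)) (at t within I)" if "t \<in> I" for t
    by (auto intro!: derivative_eq_intros deriv[OF that])
  have LX: "legendre_curv Delta1 I X Y (\<lambda>t. n t * sinh (a t)) (\<lambda>t. n t * cosh (a t))"
    using legendre_curv_uminus[OF I(1)
        legendre_curv_involute[OF I(1) L[unfolded Delta_eq_orthopairs] _ _
      smooth_on_cosh_sinh(1,2)[OF smooth] cs]]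
    by (simp add: X_def Y_def hyperbolic_de_Sitter_frame[abs_def] frame_uminus
        Delta_eq_orthopairs cosh_square_eq)
  note iff = HE_fun_iff[OF I(1) LX]
  show "HE_fun I X Y (\<lambda>t. - a t)" unfolding iff using smooth by (simp add: smooth_intros)
  assume p: "HE_fun I X Y p" and t: "t \<in> I"
  have "sinh (a t + p t) = 0"
  proof (rule continuous_eq_0_of_dense[OF dense _ _ t])
    show "continuous_on I (\<lambda>t. sinh (a t + p t))"
      using smooth p unfolding iff by (intro smooth_on_continuous smooth_intros) simp_all
    show "sinh (a t + p t) = 0" if "t \<in> I" "n t \<noteq> 0" for t
    proof -
      have "n t * sinh (a t + p t) = 0"
        using p that(1) unfolding iff by (auto simp: sinh_add algebra_simps)
      then show ?thesis using that(2) by simp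
    qed
  qed
  then have pa: "p t = - a t" by simp
  note pt = legendre_curvD(3)[OF L t, unfolded Delta_eq_orthopairs]
  have "HE p X Y t = frame 1 0 0 (\<gamma> t) (\<nu> t)" "mu X Y t = frame 0 1 0 (\<gamma> t) (\<nu> t)"
    unfolding X_def Y_def hyperbolic_de_Sitter_frame frame_frame[OF pt] pa
    by (auto intro!: arg_cong3[where f = "\<lambda>a b c. frame a b c (\<gamma> t) (\<nu> t)"]
      simp: cosh_square_eq power2_eq_square[symmetric])
  then show "HE p X Y t = \<gamma> t \<and> nuHE X Y t = \<nu> t \<and> muHE p X Y t = mu \<gamma> \<nu> t"
    by (simp add: nuHE_def muHE_def mu_def[of "HE p X Y"] mu_def[of \<gamma>])
qed

text \<open>As for \<open>evolute_of_HI\<close>, with \<open>n sinh (p - a) = 0\<close> as the condition on the angle.\<close>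

lemma evolute_of_tDI:
  assumes I: "nondeg_interval I" "t0 \<in> I" and L: "legendre_curv Delta5 I \<gamma> \<nu> m n"
    and dense: "dense_in I (\<lambda>t. n t \<noteq> 0)" and a: "int_fun Delta5 I t0 \<gamma> \<nu> a"
  defines "X \<equiv> tDI a \<gamma> \<nu>" and "Y \<equiv> tHI a \<gamma> \<nu>"
  shows "bDE_fun I X Y a"
    and "bDE_fun I X Y p \<Longrightarrow> t \<in> I \<Longrightarrow>
      bDE p X Y t = \<gamma> t \<and> bnuDE X Y t = \<nu> t \<and> bmuDE p X Y t = mu \<gamma> \<nu> t"
proof -
  have deriv: "(a has_real_derivative m t) (at t within I)" if "t \<in> I" for t
    using int_fun_has_derivative[OF I _ L a that] by simp
  have smooth: "smooth_on I a"
    using smooth_on_curvature(1)[OF I(1) _ L] deriv by (rule smooth_on_real_antiderivative) simp_all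
  have cs: "((\<lambda>t. cosh (a t)) has_real_derivative 1 * m t * sinh (a t)) (at t within I)"
    "((\<lambda>t. sinh (a t)) has_real_derivative m t * cosh (a t)) (at t within I)" if "t \<in> I" for t
    by (auto intro!: derivative_eq_intros deriv[OF that])
  have LX: "legendre_curv Delta1bar I X Y (\<lambda>t. - n t * sinh (a t)) (\<lambda>t. n t * cosh (a t))"
    using legendre_curv_involute[OF I(1) L[unfolded Delta_eq_orthopairs] _ _
      smooth_on_cosh_sinh(1,2)[OF smooth] cs]
    by (simp add: X_def Y_def hyperbolic_de_Sitter_frame[abs_def] frame_uminus
        Delta_eq_orthopairs cosh_square_eq)
  note iff = bDE_fun_iff[OF I(1) LX]
  show "bDE_fun I X Y a" unfolding iff using smooth by simp
  assume p: "bDE_fun I X Y p" and t: "t \<in> I"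
  have "sinh (p t - a t) = 0"
  proof (rule continuous_eq_0_of_dense[OF dense _ _ t])
    show "continuous_on I (\<lambda>t. sinh (p t - a t))"
      using smooth p unfolding iff by (intro smooth_on_continuous smooth_intros) simp_all
    show "sinh (p t - a t) = 0" if "t \<in> I" "n t \<noteq> 0" for t
    proof -
      have "n t * sinh (p t - a t) = 0"
        using p that(1) unfolding iff by (auto simp: sinh_diff algebra_simps)
      then show ?thesis using that(2) by simp
    qed
  qed
  then have pa: "p t = a t" by simp
  note pt = legendre_curvD(3)[OF L t, unfolded Delta_eq_orthopairs]
  have "bDE p X Y t = frame 1 0 0 (\<gamma> t) (\<nu> t)" "mu X Y t = frame 0 1 0 (\<gamma> t) (\<nu> t)"
    unfolding X_def Y_def hyperbolic_de_Sitter_frame frame_frame[OF pt] pa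
    by (auto intro!: arg_cong3[where f = "\<lambda>a b c. frame a b c (\<gamma> t) (\<nu> t)"]
      simp: cosh_square_eq power2_eq_square[symmetric])
  then show "bDE p X Y t = \<gamma> t \<and> bnuDE X Y t = \<nu> t \<and> bmuDE p X Y t = mu \<gamma> \<nu> t"
    by (simp add: bnuDE_def bmuDE_def mu_def[of "bDE p X Y"] mu_def[of \<gamma>])
qed

text \<open>Here the condition on the angle is \<open>n sin (p - a) = 0\<close>. It leaves \<open>p - a\<close> free to be any
  multiple of \<open>\<pi>\<close>, constant because \<open>I\<close> is connected; its cosine is the sign \<open>\<epsilon>\<close>.\<close>

lemma evolute_of_bDI:
  assumes I: "nondeg_interval I" "t0 \<in> I" and L: "legendre_curv Delta1bar I \<gamma> \<nu> m n"
    and dense: "dense_in I (\<lambda>t. n t \<noteq> 0)" and a: "int_fun Delta1bar I t0 \<gamma> \<nu> a"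
  defines "X \<equiv> bDI a \<gamma> \<nu>" and "Y \<equiv> bnuDI a \<gamma> \<nu>"
  defines "E \<equiv> \<lambda>p \<epsilon>. \<forall>t\<in>I. tDE p X Y t = \<epsilon> *\<^sub>R \<gamma> t \<and> tnuDE X Y t = \<nu> t \<and>
    tmuDE p X Y t = \<epsilon> *\<^sub>R mu \<gamma> \<nu> t"
  shows "\<epsilon> \<in> {1, -1} \<Longrightarrow> \<exists>p. tDE_fun I X Y p \<and> E p \<epsilon>"
    and "tDE_fun I X Y p \<Longrightarrow> \<exists>\<epsilon>\<in>{1, -1}. E p \<epsilon>"
proof -
  have deriv: "(a has_real_derivative m t) (at t within I)" if "t \<in> I" for t
    using int_fun_has_derivative[OF I _ L a that] by simp
  have smooth: "smooth_on I a"
    using smooth_on_curvature(1)[OF I(1) _ L] deriv by (rule smooth_on_real_antiderivative) simp_all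
  have cs: "((\<lambda>t. cos (a t)) has_real_derivative (-1) * m t * sin (a t)) (at t within I)"
    "((\<lambda>t. sin (a t)) has_real_derivative m t * cos (a t)) (at t within I)" if "t \<in> I" for t
    by (auto intro!: derivative_eq_intros deriv[OF that])
  have LX: "legendre_curv Delta5 I X Y (\<lambda>t. - n t * sin (a t)) (\<lambda>t. n t * cos (a t))"
    using legendre_curv_involute[OF I(1) L[unfolded Delta_eq_orthopairs] _ _
      smooth_on_cos_sin(1,2)[OF smooth] cs]
    by (simp add: X_def Y_def hyperbolic_de_Sitter_frame[abs_def] frame_uminus
        Delta_eq_orthopairs cos_squared_eq)
  note iff = tDE_fun_iff[OF I(1) LX]
  have E: "E p \<epsilon>" if "\<And>t. t \<in> I \<Longrightarrow> cos (p t - a t) = \<epsilon> \<and> sin (p t - a t) = 0" for p \<epsilon>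
    unfolding E_def
  proof
    fix t assume t: "t \<in> I"
    note pt = legendre_curvD(3)[OF L t, unfolded Delta_eq_orthopairs]
    have "tDE p X Y t = frame \<epsilon> 0 0 (\<gamma> t) (\<nu> t)" "mu X Y t = frame 0 1 0 (\<gamma> t) (\<nu> t)"
      unfolding X_def Y_def hyperbolic_de_Sitter_frame frame_frame[OF pt]
      using that[OF t] by (auto intro!: arg_cong3[where f = "\<lambda>a b c. frame a b c (\<gamma> t) (\<nu> t)"]
        simp: cos_squared_eq power2_eq_square[symmetric] cos_diff sin_diff algebra_simps)
    then show "tDE p X Y t = \<epsilon> *\<^sub>R \<gamma> t \<and> tnuDE X Y t = \<nu> t \<and> tmuDE p X Y t = \<epsilon> *\<^sub>R mu \<gamma> \<nu> t"
      by (simp add: tnuDE_def tmuDE_def mu_def[of "tDE p X Y"] mu_def[of \<gamma>] frame_def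
          bounded_bilinear.scaleR_left[OF bounded_bilinear_lwedge])
  qed
  show "\<exists>p. tDE_fun I X Y p \<and> E p \<epsilon>" if "\<epsilon> \<in> {1, -1}"
  proof -
    define \<delta> where "\<delta> = (if \<epsilon> = 1 then 0 else pi)"
    have "tDE_fun I X Y (\<lambda>t. a t + \<delta>)"
      unfolding iff using smooth by (auto simp: \<delta>_def intro!: smooth_intros)
    moreover have "E (\<lambda>t. a t + \<delta>) \<epsilon>" using that by (intro E) (auto simp: \<delta>_def)
    ultimately show ?thesis by blast
  qed
  assume p: "tDE_fun I X Y p"
  have cont: "continuous_on I (\<lambda>t. p t - a t)"
    using smooth p unfolding iff by (intro smooth_on_continuous smooth_intros) simp_all
  have sin: "sin (p t - a t) = 0" if t: "t \<in> I" for t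
  proof (rule continuous_eq_0_of_dense[OF dense _ _ t])
    show "continuous_on I (\<lambda>t. sin (p t - a t))" using cont by (rule continuous_on_sin)
    show "sin (p t - a t) = 0" if "t \<in> I" "n t \<noteq> 0" for t
    proof -
      have "n t * sin (p t - a t) = 0"
        using p that(1) unfolding iff by (auto simp: sin_diff algebra_simps)
      then show ?thesis using that(2) by simp
    qed
  qed
  then have cos: "cos (p t - a t) \<in> {1, -1}" if "t \<in> I" for t
    using sin_cos_squared_add[of "p t - a t"] that by (auto simp: power2_eq_1_iff)
  have "(\<lambda>t. cos (p t - a t)) constant_on I"
  proof (rule continuous_finite_range_constant)
    show "connected I" using I by (simp add: nondeg_interval_def is_interval_connected_1)
    show "continuous_on I (\<lambda>t. cos (p t - a t))" using cont by (rule continuous_on_cos)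
    show "finite ((\<lambda>t. cos (p t - a t)) ` I)"
      by (rule finite_subset[OF image_subsetI[OF cos]]) simp_all
  qed
  then obtain \<epsilon> where \<epsilon>: "\<And>t. t \<in> I \<Longrightarrow> cos (p t - a t) = \<epsilon>" unfolding constant_on_def by blast
  show "\<exists>\<epsilon>\<in>{1, -1}. E p \<epsilon>"
  proof
    show "E p \<epsilon>" using \<epsilon> sin by (intro E) simp
    show "\<epsilon> \<in> {1, -1}" using cos[OF I(2)] \<epsilon>[OF I(2)] by simp
  qed
qed

text \<open>The curvature of an evolute starts with \<open>\<plusminus>\<phi>'\<close>. The angle of its involute is therefore
  \<open>\<plusminus>(\<phi> - \<phi> t0)\<close>, and in the frame of the original curve the two angles combine, by the
  addition theorems, to the constant \<open>\<phi> t0\<close>.\<close>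

lemma involute_of_HE:
  assumes I: "nondeg_interval I" "t0 \<in> I" and L: "legendre_curv Delta1 I \<gamma> \<nu> m n"
    and smooth: "smooth_on I \<phi>" and \<phi>: "\<And>t. t \<in> I \<Longrightarrow> m t * cosh (\<phi> t) + n t * sinh (\<phi> t) = 0"
  defines "X \<equiv> HE \<phi> \<gamma> \<nu>" and "Y \<equiv> nuHE \<gamma> \<nu>"
  shows "\<exists>a. int_fun Delta1 I t0 X Y a"
    and "int_fun Delta1 I t0 X Y a \<Longrightarrow> t \<in> I \<Longrightarrow>
      HI a X Y t = HP (\<phi> t0) \<gamma> \<nu> t \<and> DI a X Y t = DP (\<phi> t0) \<gamma> \<nu> t \<and> muI a X Y t = muP (\<phi> t0) \<gamma> \<nu> t"
proof -
  define \<phi>' where "\<phi>' t = vector_derivative \<phi> (at t within I)" for t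
  have deriv: "(\<phi> has_real_derivative \<phi>' t) (at t within I)" if "t \<in> I" for t
    using smooth_on_vector_derivative[OF I(1) smooth] that
    by (simp add: \<phi>'_def has_real_derivative_iff_has_vector_derivative)
  have cs: "((\<lambda>t. cosh (\<phi> t)) has_real_derivative 1 * \<phi>' t * sinh (\<phi> t)) (at t within I)"
    "((\<lambda>t. sinh (\<phi> t)) has_real_derivative \<phi>' t * cosh (\<phi> t)) (at t within I)" if "t \<in> I" for t
    by (auto intro!: derivative_eq_intros deriv[OF that])
  have LX: "legendre_curv Delta1 I X Y (\<lambda>t. - \<phi>' t)
      (\<lambda>t. n t * cosh (\<phi> t) + m t * sinh (\<phi> t))"
    using legendre_curv_evolute[OF I(1) L[unfolded Delta_eq_orthopairs] _ _ _
      smooth_on_cosh_sinh(1,2)[OF smooth] cs] \<phi>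
    by (simp add: X_def Y_def nuHE_def hyperbolic_de_Sitter_frame[abs_def]
        Delta_eq_orthopairs cosh_square_eq)
  then show "\<exists>a. int_fun Delta1 I t0 X Y a" using int_fun_exists by blast
  assume a: "int_fun Delta1 I t0 X Y a" and t: "t \<in> I"
  have "a t = (- \<phi> t) - (- \<phi> t0)"
    by (rule int_fun_antiderivative[OF I _ LX a t, where F = "\<lambda>t. - \<phi> t"])
      (auto intro!: derivative_eq_intros deriv)
  then have \<phi>0: "\<phi> t0 = \<phi> t + a t" by simp
  note pt = legendre_curvD(3)[OF L t, unfolded Delta_eq_orthopairs]
  have "HI a X Y t = HP (\<phi> t0) \<gamma> \<nu> t" "DI a X Y t = DP (\<phi> t0) \<gamma> \<nu> t"
    unfolding X_def Y_def nuHE_def hyperbolic_de_Sitter_frame frame_frame[OF pt] frame_uminus \<phi>0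
    by (auto intro!: arg_cong3[where f = "\<lambda>a b c. frame a b c (\<gamma> t) (\<nu> t)"]
      simp: cosh_add sinh_add cosh_diff sinh_diff algebra_simps)
  then show "HI a X Y t = HP (\<phi> t0) \<gamma> \<nu> t \<and> DI a X Y t = DP (\<phi> t0) \<gamma> \<nu> t \<and> muI a X Y t = muP (\<phi> t0) \<gamma> \<nu> t"
    by (simp add: muI_def muP_def mu_def)
qed

lemma involute_of_bHE:
  assumes I: "nondeg_interval I" "t0 \<in> I" and L: "legendre_curv Delta1bar I \<gamma> \<nu> m n"
    and smooth: "smooth_on I \<phi>" and \<phi>: "\<And>t. t \<in> I \<Longrightarrow> m t * sinh (\<phi> t) + n t * cosh (\<phi> t) = 0"
  defines "X \<equiv> bHE \<phi> \<gamma> \<nu>" and "Y \<equiv> bnuHE \<gamma> \<nu>"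
  shows "\<exists>a. int_fun Delta1 I t0 X Y a"
    and "int_fun Delta1 I t0 X Y a \<Longrightarrow> t \<in> I \<Longrightarrow>
      DI a X Y t = - bDP (\<phi> t0) \<gamma> \<nu> t \<and> HI a X Y t = bHP (\<phi> t0) \<gamma> \<nu> t \<and> muI a X Y t = bmuP (\<phi> t0) \<gamma> \<nu> t"
proof -
  define \<phi>' where "\<phi>' t = vector_derivative \<phi> (at t within I)" for t
  have deriv: "(\<phi> has_real_derivative \<phi>' t) (at t within I)" if "t \<in> I" for t
    using smooth_on_vector_derivative[OF I(1) smooth] that
    by (simp add: \<phi>'_def has_real_derivative_iff_has_vector_derivative)
  have cs: "((\<lambda>t. cosh (\<phi> t)) has_real_derivative 1 * \<phi>' t * sinh (\<phi> t)) (at t within I)"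
    "((\<lambda>t. sinh (\<phi> t)) has_real_derivative \<phi>' t * cosh (\<phi> t)) (at t within I)" if "t \<in> I" for t
    by (auto intro!: derivative_eq_intros deriv[OF that])
  \<comment> \<open>The evolute of the exchanged pair, whose \<open>mu\<close> has the opposite sign.\<close>
  have LX: "legendre_curv Delta1 I X Y \<phi>'
      (\<lambda>t. - (m t * cosh (\<phi> t)) - n t * sinh (\<phi> t))"
    using legendre_curv_uminus[OF I(1) legendre_curv_evolute[OF I(1)
        legendre_curv_swap[OF I(1) L[unfolded Delta_eq_orthopairs]] _ _ _
      smooth_on_cosh_sinh(1,2)[OF smooth] cs]] minus_unique[OF \<phi>]
    by (simp add: X_def Y_def bnuHE_def hyperbolic_de_Sitter_frame[abs_def]
        Delta_eq_orthopairs cosh_square_eq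
      algebra_simps lwedge_skew[of "\<nu> _" "\<gamma> _"] frame_def)
  then show "\<exists>a. int_fun Delta1 I t0 X Y a" using int_fun_exists by blast
  assume a: "int_fun Delta1 I t0 X Y a" and t: "t \<in> I"
  have "a t = (\<phi> t) - (\<phi> t0)"
    by (rule int_fun_antiderivative[OF I _ LX a t, where F = "\<lambda>t. \<phi> t"])
      (auto intro!: derivative_eq_intros deriv)
  then have \<phi>0: "\<phi> t0 = \<phi> t - a t" by simp
  note pt = legendre_curvD(3)[OF L t, unfolded Delta_eq_orthopairs]
  have "DI a X Y t = - bDP (\<phi> t0) \<gamma> \<nu> t" "HI a X Y t = bHP (\<phi> t0) \<gamma> \<nu> t"
    unfolding X_def Y_def bnuHE_def hyperbolic_de_Sitter_frame frame_frame[OF pt] frame_uminus \<phi>0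
    by (auto intro!: arg_cong3[where f = "\<lambda>a b c. frame a b c (\<gamma> t) (\<nu> t)"]
      simp: cosh_add sinh_add cosh_diff sinh_diff algebra_simps)
  then show "DI a X Y t = - bDP (\<phi> t0) \<gamma> \<nu> t \<and> HI a X Y t = bHP (\<phi> t0) \<gamma> \<nu> t \<and> muI a X Y t = bmuP (\<phi> t0) \<gamma> \<nu> t"
    by (simp add: muI_def bmuP_def mu_def lwedge_minus_right lwedge_skew[of "bHP _ _ _ _"])
qed

lemma involute_of_bDE:
  assumes I: "nondeg_interval I" "t0 \<in> I" and L: "legendre_curv Delta1bar I \<gamma> \<nu> m n"
    and smooth: "smooth_on I \<phi>" and \<phi>: "\<And>t. t \<in> I \<Longrightarrow> m t * cosh (\<phi> t) + n t * sinh (\<phi> t) = 0"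
  defines "X \<equiv> bDE \<phi> \<gamma> \<nu>" and "Y \<equiv> bnuDE \<gamma> \<nu>"
  shows "\<exists>a. int_fun Delta5 I t0 X Y a"
    and "int_fun Delta5 I t0 X Y a \<Longrightarrow> t \<in> I \<Longrightarrow>
      tDI a X Y t = bDP (\<phi> t0) \<gamma> \<nu> t \<and> tHI a X Y t = bHP (\<phi> t0) \<gamma> \<nu> t \<and> tmuI a X Y t = bmuP (\<phi> t0) \<gamma> \<nu> t"
proof -
  define \<phi>' where "\<phi>' t = vector_derivative \<phi> (at t within I)" for t
  have deriv: "(\<phi> has_real_derivative \<phi>' t) (at t within I)" if "t \<in> I" for t
    using smooth_on_vector_derivative[OF I(1) smooth] that
    by (simp add: \<phi>'_def has_real_derivative_iff_has_vector_derivative)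
  have cs: "((\<lambda>t. cosh (\<phi> t)) has_real_derivative 1 * \<phi>' t * sinh (\<phi> t)) (at t within I)"
    "((\<lambda>t. sinh (\<phi> t)) has_real_derivative \<phi>' t * cosh (\<phi> t)) (at t within I)" if "t \<in> I" for t
    by (auto intro!: derivative_eq_intros deriv[OF that])
  have LX: "legendre_curv Delta5 I X Y \<phi>'
      (\<lambda>t. n t * cosh (\<phi> t) + m t * sinh (\<phi> t))"
    using legendre_curv_evolute[OF I(1) L[unfolded Delta_eq_orthopairs] _ _ _
      smooth_on_cosh_sinh(1,2)[OF smooth] cs] \<phi>
    by (simp add: X_def Y_def bnuDE_def hyperbolic_de_Sitter_frame[abs_def]
        Delta_eq_orthopairs cosh_square_eq)
  then show "\<exists>a. int_fun Delta5 I t0 X Y a" using int_fun_exists by blast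
  assume a: "int_fun Delta5 I t0 X Y a" and t: "t \<in> I"
  have "a t = (\<phi> t) - (\<phi> t0)"
    by (rule int_fun_antiderivative[OF I _ LX a t, where F = "\<lambda>t. \<phi> t"])
      (auto intro!: derivative_eq_intros deriv)
  then have \<phi>0: "\<phi> t0 = \<phi> t - a t" by simp
  note pt = legendre_curvD(3)[OF L t, unfolded Delta_eq_orthopairs]
  have "tDI a X Y t = bDP (\<phi> t0) \<gamma> \<nu> t" "tHI a X Y t = bHP (\<phi> t0) \<gamma> \<nu> t"
    unfolding X_def Y_def bnuDE_def hyperbolic_de_Sitter_frame frame_frame[OF pt] frame_uminus \<phi>0
    by (auto intro!: arg_cong3[where f = "\<lambda>a b c. frame a b c (\<gamma> t) (\<nu> t)"]
      simp: cosh_add sinh_add cosh_diff sinh_diff algebra_simps)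
  then show "tDI a X Y t = bDP (\<phi> t0) \<gamma> \<nu> t \<and> tHI a X Y t = bHP (\<phi> t0) \<gamma> \<nu> t \<and> tmuI a X Y t = bmuP (\<phi> t0) \<gamma> \<nu> t"
    by (simp add: tmuI_def bmuP_def mu_def)
qed

lemma involute_of_DE:
  assumes I: "nondeg_interval I" "t0 \<in> I" and L: "legendre_curv Delta1 I \<gamma> \<nu> m n"
    and smooth: "smooth_on I \<phi>" and \<phi>: "\<And>t. t \<in> I \<Longrightarrow> m t * sinh (\<phi> t) + n t * cosh (\<phi> t) = 0"
  defines "X \<equiv> DE \<phi> \<gamma> \<nu>" and "Y \<equiv> nuDE \<gamma> \<nu>"
  shows "\<exists>a. int_fun Delta5 I t0 X Y a"
    and "int_fun Delta5 I t0 X Y a \<Longrightarrow> t \<in> I \<Longrightarrow>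
      tHI a X Y t = - HP (\<phi> t0) \<gamma> \<nu> t \<and> tDI a X Y t = DP (\<phi> t0) \<gamma> \<nu> t \<and> tmuI a X Y t = muP (\<phi> t0) \<gamma> \<nu> t"
proof -
  define \<phi>' where "\<phi>' t = vector_derivative \<phi> (at t within I)" for t
  have deriv: "(\<phi> has_real_derivative \<phi>' t) (at t within I)" if "t \<in> I" for t
    using smooth_on_vector_derivative[OF I(1) smooth] that
    by (simp add: \<phi>'_def has_real_derivative_iff_has_vector_derivative)
  have cs: "((\<lambda>t. cosh (\<phi> t)) has_real_derivative 1 * \<phi>' t * sinh (\<phi> t)) (at t within I)"
    "((\<lambda>t. sinh (\<phi> t)) has_real_derivative \<phi>' t * cosh (\<phi> t)) (at t within I)" if "t \<in> I" for t
    by (auto intro!: derivative_eq_intros deriv[OF that])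
  \<comment> \<open>The evolute of the exchanged pair, whose \<open>mu\<close> has the opposite sign.\<close>
  have LX: "legendre_curv Delta5 I X Y (\<lambda>t. - \<phi>' t)
      (\<lambda>t. - (m t * cosh (\<phi> t)) - n t * sinh (\<phi> t))"
    using legendre_curv_uminus[OF I(1) legendre_curv_evolute[OF I(1)
        legendre_curv_swap[OF I(1) L[unfolded Delta_eq_orthopairs]] _ _ _
      smooth_on_cosh_sinh(1,2)[OF smooth] cs]] minus_unique[OF \<phi>]
    by (simp add: X_def Y_def nuDE_def hyperbolic_de_Sitter_frame[abs_def]
        Delta_eq_orthopairs cosh_square_eq
      algebra_simps lwedge_skew[of "\<nu> _" "\<gamma> _"] frame_def)
  then show "\<exists>a. int_fun Delta5 I t0 X Y a" using int_fun_exists by blast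
  assume a: "int_fun Delta5 I t0 X Y a" and t: "t \<in> I"
  have "a t = (- \<phi> t) - (- \<phi> t0)"
    by (rule int_fun_antiderivative[OF I _ LX a t, where F = "\<lambda>t. - \<phi> t"])
      (auto intro!: derivative_eq_intros deriv)
  then have \<phi>0: "\<phi> t0 = \<phi> t + a t" by simp
  note pt = legendre_curvD(3)[OF L t, unfolded Delta_eq_orthopairs]
  have "tHI a X Y t = - HP (\<phi> t0) \<gamma> \<nu> t" "tDI a X Y t = DP (\<phi> t0) \<gamma> \<nu> t"
    unfolding X_def Y_def nuDE_def hyperbolic_de_Sitter_frame frame_frame[OF pt] frame_uminus \<phi>0
    by (auto intro!: arg_cong3[where f = "\<lambda>a b c. frame a b c (\<gamma> t) (\<nu> t)"]
      simp: cosh_add sinh_add cosh_diff sinh_diff algebra_simps)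
  then show "tHI a X Y t = - HP (\<phi> t0) \<gamma> \<nu> t \<and> tDI a X Y t = DP (\<phi> t0) \<gamma> \<nu> t \<and> tmuI a X Y t = muP (\<phi> t0) \<gamma> \<nu> t"
    by (simp add: tmuI_def muP_def mu_def lwedge_minus_right lwedge_skew[of "DP _ _ _ _"])
qed

lemma involute_of_tDE:
  assumes I: "nondeg_interval I" "t0 \<in> I" and L: "legendre_curv Delta5 I \<gamma> \<nu> m n"
    and smooth: "smooth_on I \<phi>" and \<phi>: "\<And>t. t \<in> I \<Longrightarrow> m t * cos (\<phi> t) + n t * sin (\<phi> t) = 0"
  defines "X \<equiv> tDE \<phi> \<gamma> \<nu>" and "Y \<equiv> tnuDE \<gamma> \<nu>"
  shows "\<exists>a. int_fun Delta1bar I t0 X Y a"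
    and "int_fun Delta1bar I t0 X Y a \<Longrightarrow> t \<in> I \<Longrightarrow>
      bDI a X Y t = tDP (\<phi> t0) \<gamma> \<nu> t \<and> bnuDI a X Y t = tnuDP (\<phi> t0) \<gamma> \<nu> t \<and> bmuDI a X Y t = tmuDP (\<phi> t0) \<gamma> \<nu> t"
proof -
  define \<phi>' where "\<phi>' t = vector_derivative \<phi> (at t within I)" for t
  have deriv: "(\<phi> has_real_derivative \<phi>' t) (at t within I)" if "t \<in> I" for t
    using smooth_on_vector_derivative[OF I(1) smooth] that
    by (simp add: \<phi>'_def has_real_derivative_iff_has_vector_derivative)
  have cs: "((\<lambda>t. cos (\<phi> t)) has_real_derivative (-1) * \<phi>' t * sin (\<phi> t)) (at t within I)"
    "((\<lambda>t. sin (\<phi> t)) has_real_derivative \<phi>' t * cos (\<phi> t)) (at t within I)" if "t \<in> I" for t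
    by (auto intro!: derivative_eq_intros deriv[OF that])
  have LX: "legendre_curv Delta1bar I X Y \<phi>'
      (\<lambda>t. n t * cos (\<phi> t) - m t * sin (\<phi> t))"
    using legendre_curv_evolute[OF I(1) L[unfolded Delta_eq_orthopairs] _ _ _
      smooth_on_cos_sin(1,2)[OF smooth] cs] \<phi>
    by (simp add: X_def Y_def tnuDE_def hyperbolic_de_Sitter_frame[abs_def]
        Delta_eq_orthopairs cos_squared_eq)
  then show "\<exists>a. int_fun Delta1bar I t0 X Y a" using int_fun_exists by blast
  assume a: "int_fun Delta1bar I t0 X Y a" and t: "t \<in> I"
  have "a t = (\<phi> t) - (\<phi> t0)"
    by (rule int_fun_antiderivative[OF I _ LX a t, where F = "\<lambda>t. \<phi> t"])
      (auto intro!: derivative_eq_intros deriv)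
  then have \<phi>0: "\<phi> t0 = \<phi> t - a t" by simp
  note pt = legendre_curvD(3)[OF L t, unfolded Delta_eq_orthopairs]
  have "bDI a X Y t = tDP (\<phi> t0) \<gamma> \<nu> t" "bnuDI a X Y t = tnuDP (\<phi> t0) \<gamma> \<nu> t"
    unfolding X_def Y_def tnuDE_def hyperbolic_de_Sitter_frame frame_frame[OF pt] frame_uminus \<phi>0
    by (auto intro!: arg_cong3[where f = "\<lambda>a b c. frame a b c (\<gamma> t) (\<nu> t)"]
      simp: cos_diff sin_diff algebra_simps)
  then show "bDI a X Y t = tDP (\<phi> t0) \<gamma> \<nu> t \<and> bnuDI a X Y t = tnuDP (\<phi> t0) \<gamma> \<nu> t \<and> bmuDI a X Y t = tmuDP (\<phi> t0) \<gamma> \<nu> t"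
    by (simp add: bmuDI_def tmuDP_def mu_def)
qed


section \<open>Duality of evolutes and involutes\<close>

theorem theorem5p24:
  fixes I :: "real set" and t0 :: real
    and \<gamma>h \<gamma>hd \<gamma>hs \<gamma>d \<gamma>dh \<gamma>ds \<gamma>T \<gamma>Td \<gamma>Th :: curve
    and mh nh md nd mT nT :: "real \<Rightarrow> real"
  assumes I: "nondeg_interval I" and t0: "t0 \<in> I"
    and h: "legendre_curv Delta1 I \<gamma>h \<gamma>hd mh nh"
    and d: "legendre_curv Delta1bar I \<gamma>d \<gamma>dh md nd"
    and T: "legendre_curv Delta5 I \<gamma>T \<gamma>Td mT nT"
    and dense_mh: "dense_in I (\<lambda>t. mh t \<noteq> 0)"
    and dense_nh: "dense_in I (\<lambda>t. nh t \<noteq> 0)"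
    and dense_md: "dense_in I (\<lambda>t. md t \<noteq> 0)"
    and dense_nd: "dense_in I (\<lambda>t. nd t \<noteq> 0)"
    and dense_nT: "dense_in I (\<lambda>t. nT t \<noteq> 0)"
    and hs: "\<gamma>hs = mu \<gamma>h \<gamma>hd"
    and ds: "\<gamma>ds = mu \<gamma>d \<gamma>dh"
    and Th: "\<gamma>Th = mu \<gamma>T \<gamma>Td"
  shows
    \<comment> \<open>(1)\<close>
    "(\<forall>f. smooth_on I f \<and> (\<forall>t\<in>I. mh t + f t * nh t = 0) \<and>
          (\<forall>\<epsilon>\<in>{1, -1}. dense_in I (\<lambda>t. nh t + \<epsilon> * mh t \<noteq> 0)) \<longrightarrow>
      (\<forall>\<epsilon>\<in>{1, -1}.
        (\<forall>J s. nondeg_interval J \<and> J \<subseteq> I \<and> HIh_fun \<epsilon> J \<gamma>h \<gamma>hd s \<longrightarrow>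
          (let X = HIh \<epsilon> s \<gamma>h \<gamma>hd; Y = nuHIh \<epsilon> s \<gamma>h \<gamma>hd in
            (\<exists>g. HEh_fun J X Y g) \<and>
            (\<forall>g. HEh_fun J X Y g \<longrightarrow>
              (\<forall>t\<in>J. (HEh \<epsilon> g X Y t, DEh \<epsilon> g X Y t, muEh \<epsilon> g X Y t)
                       = (\<gamma>h t, \<gamma>hd t, \<gamma>hs t))))) \<and>
        (\<forall>J s. nondeg_interval J \<and> J \<subseteq> I \<and> HIh_fun (- \<epsilon>) J \<gamma>h \<gamma>hd s \<longrightarrow>
          (let X = HIh (- \<epsilon>) s \<gamma>h \<gamma>hd; Y = (\<lambda>t. - nuHIh (- \<epsilon>) s \<gamma>h \<gamma>hd t) in
            (\<exists>g. HEh_fun J X Y g) \<and>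
            (\<forall>g. HEh_fun J X Y g \<longrightarrow>
              (\<forall>t\<in>J. (HEh \<epsilon> g X Y t, DEh \<epsilon> g X Y t, muEh \<epsilon> g X Y t)
                       = (\<gamma>h t, - \<gamma>hd t, - \<gamma>hs t))))) \<and>
        legendre_curv Delta1 I (HEh \<epsilon> f \<gamma>h \<gamma>hd) (DEh \<epsilon> f \<gamma>h \<gamma>hd)
          (m_HEh \<epsilon> I f nh) (n_HEh \<epsilon> I f nh) \<and>
        (\<forall>J S. nondeg_interval J \<and> J \<subseteq> I \<and>
            solves J (\<lambda>t x. (m_HEh \<epsilon> I f nh t + \<epsilon> * n_HEh \<epsilon> I f nh t) / 2 * x^2
                              - m_HEh \<epsilon> I f nh t) S \<longrightarrow>
          (let X = HEh \<epsilon> f \<gamma>h \<gamma>hd; Y = DEh \<epsilon> f \<gamma>h \<gamma>hd; l = (\<lambda>t. f t - S t) in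
            HIh_fun \<epsilon> J X Y S \<and> HPh_fun \<epsilon> J \<gamma>h \<gamma>hd l \<and>
            (\<forall>t\<in>J. (HIh \<epsilon> S X Y t, nuHIh \<epsilon> S X Y t, muHIh \<epsilon> S X Y t)
                     = (HPh \<epsilon> l \<gamma>h \<gamma>hd t, nuHPh \<epsilon> l \<gamma>h \<gamma>hd t, muHPh \<epsilon> l \<gamma>h \<gamma>hd t)))) \<and>
        (\<forall>J S. nondeg_interval J \<and> J \<subseteq> I \<and>
            solves J (\<lambda>t x. (m_HEh (- \<epsilon>) I f nh t + (- \<epsilon>) * n_HEh (- \<epsilon>) I f nh t) / 2 * x^2
                              - m_HEh (- \<epsilon>) I f nh t) S \<longrightarrow>
          (let X = HEh (- \<epsilon>) f \<gamma>h \<gamma>hd; Y = (\<lambda>t. - DEh (- \<epsilon>) f \<gamma>h \<gamma>hd t);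
               S' = (\<lambda>t. - S t); l = (\<lambda>t. f t + S' t) in
            HIh_fun \<epsilon> J X Y S' \<and> HPh_fun (- \<epsilon>) J \<gamma>h \<gamma>hd l \<and>
            (\<forall>t\<in>J. (HIh \<epsilon> S' X Y t, nuHIh \<epsilon> S' X Y t, muHIh \<epsilon> S' X Y t)
                     = (HPh (- \<epsilon>) l \<gamma>h \<gamma>hd t, - nuHPh (- \<epsilon>) l \<gamma>h \<gamma>hd t,
                        - muHPh (- \<epsilon>) l \<gamma>h \<gamma>hd t))))))
    \<and>
    \<comment> \<open>(2)\<close>
    ((\<exists>fb. smooth_on I fb \<and> (\<forall>t\<in>I. md t + fb t * nd t = 0)) \<and>
          (\<forall>\<epsilon>\<in>{1, -1}. dense_in I (\<lambda>t. nd t - \<epsilon> * md t \<noteq> 0)) \<longrightarrow>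
      (\<forall>\<epsilon>\<in>{1, -1}.
        (\<forall>J s. nondeg_interval J \<and> J \<subseteq> I \<and> bDIh_fun \<epsilon> J \<gamma>d \<gamma>dh s \<longrightarrow>
          (let X = bDIh \<epsilon> s \<gamma>d \<gamma>dh; Y = bnuDIh \<epsilon> s \<gamma>d \<gamma>dh in
            (\<exists>g. tDEh_fun J X Y g) \<and>
            (\<forall>g. tDEh_fun J X Y g \<longrightarrow>
              (\<forall>t\<in>J. (tDEh \<epsilon> g X Y t, tHEh \<epsilon> g X Y t, tmuEh \<epsilon> g X Y t)
                       = (\<gamma>d t, \<gamma>dh t, \<gamma>ds t))))) \<and>
        (\<forall>J s. nondeg_interval J \<and> J \<subseteq> I \<and> bDIh_fun (- \<epsilon>) J \<gamma>d \<gamma>dh s \<longrightarrow>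
          (let X = bDIh (- \<epsilon>) s \<gamma>d \<gamma>dh; Y = (\<lambda>t. - bnuDIh (- \<epsilon>) s \<gamma>d \<gamma>dh t) in
            (\<exists>g. tDEh_fun J X Y g) \<and>
            (\<forall>g. tDEh_fun J X Y g \<longrightarrow>
              (\<forall>t\<in>J. (tDEh \<epsilon> g X Y t, tHEh \<epsilon> g X Y t, tmuEh \<epsilon> g X Y t)
                       = (\<gamma>d t, - \<gamma>dh t, - \<gamma>ds t))))) \<and>
        (\<forall>ft. tDEh_fun I \<gamma>T \<gamma>Td ft \<longrightarrow>
          legendre_curv Delta1bar I (tDEh \<epsilon> ft \<gamma>T \<gamma>Td) (tHEh \<epsilon> ft \<gamma>T \<gamma>Td)
            (m_tDEh \<epsilon> I ft nT) (n_tDEh \<epsilon> I ft nT) \<and>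
          (\<forall>J S. nondeg_interval J \<and> J \<subseteq> I \<and>
              solves J (\<lambda>t x. - ((m_tDEh \<epsilon> I ft nT t - \<epsilon> * n_tDEh \<epsilon> I ft nT t) / 2) * x^2
                                - m_tDEh \<epsilon> I ft nT t) S \<longrightarrow>
            (let X = tDEh \<epsilon> ft \<gamma>T \<gamma>Td; Y = tHEh \<epsilon> ft \<gamma>T \<gamma>Td; l = (\<lambda>t. ft t + S t) in
              bDIh_fun \<epsilon> J X Y S \<and> tDPh_fun \<epsilon> J \<gamma>T \<gamma>Td l \<and>
              (\<forall>t\<in>J. (bDIh \<epsilon> S X Y t, bnuDIh \<epsilon> S X Y t, bmuDIh \<epsilon> S X Y t)
                       = (tDPh \<epsilon> l \<gamma>T \<gamma>Td t, tnuDPh \<epsilon> l \<gamma>T \<gamma>Td t, tmuDPh \<epsilon> l \<gamma>T \<gamma>Td t)))) \<and>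
          (\<forall>J S. nondeg_interval J \<and> J \<subseteq> I \<and>
              solves J (\<lambda>t x. - ((m_tDEh (- \<epsilon>) I ft nT t - (- \<epsilon>) * n_tDEh (- \<epsilon>) I ft nT t) / 2) * x^2
                                - m_tDEh (- \<epsilon>) I ft nT t) S \<longrightarrow>
            (let X = tDEh (- \<epsilon>) ft \<gamma>T \<gamma>Td; Y = (\<lambda>t. - tHEh (- \<epsilon>) ft \<gamma>T \<gamma>Td t);
                 S' = (\<lambda>t. - S t); l = (\<lambda>t. ft t - S' t) in
              bDIh_fun \<epsilon> J X Y S' \<and> tDPh_fun (- \<epsilon>) J \<gamma>T \<gamma>Td l \<and>
              (\<forall>t\<in>J. (bDIh \<epsilon> S' X Y t, bnuDIh \<epsilon> S' X Y t, bmuDIh \<epsilon> S' X Y t)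
                       = (tDPh (- \<epsilon>) l \<gamma>T \<gamma>Td t, - tnuDPh (- \<epsilon>) l \<gamma>T \<gamma>Td t,
                          - tmuDPh (- \<epsilon>) l \<gamma>T \<gamma>Td t)))))))
    \<and>
    \<comment> \<open>(3)\<close>
    (\<forall>\<phi>. smooth_on I \<phi> \<and> (\<forall>t\<in>I. mh t * cosh (\<phi> t) + nh t * sinh (\<phi> t) = 0) \<longrightarrow>
      (\<forall>a. int_fun Delta1 I t0 \<gamma>h \<gamma>hd a \<longrightarrow>
        (let X = HI a \<gamma>h \<gamma>hd; Y = DI a \<gamma>h \<gamma>hd in
          (\<exists>p. HE_fun I X Y p) \<and>
          (\<forall>p. HE_fun I X Y p \<longrightarrow>
            (\<forall>t\<in>I. (HE p X Y t, nuHE X Y t, muHE p X Y t) = (\<gamma>h t, \<gamma>hd t, \<gamma>hs t))))) \<and>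
      (let X = HE \<phi> \<gamma>h \<gamma>hd; Y = nuHE \<gamma>h \<gamma>hd in
        (\<exists>a. int_fun Delta1 I t0 X Y a) \<and>
        (\<forall>a. int_fun Delta1 I t0 X Y a \<longrightarrow>
          (\<forall>t\<in>I. (HI a X Y t, DI a X Y t, muI a X Y t)
                   = (HP (\<phi> t0) \<gamma>h \<gamma>hd t, DP (\<phi> t0) \<gamma>h \<gamma>hd t, muP (\<phi> t0) \<gamma>h \<gamma>hd t)))))
    \<and>
    \<comment> \<open>(4)\<close>
    (\<forall>\<phi>b. smooth_on I \<phi>b \<and> (\<forall>t\<in>I. md t * sinh (\<phi>b t) + nd t * cosh (\<phi>b t) = 0) \<longrightarrow>
      (\<forall>a. int_fun Delta1 I t0 \<gamma>h \<gamma>hd a \<longrightarrow>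
        (let X = DI a \<gamma>h \<gamma>hd; Y = HI a \<gamma>h \<gamma>hd in
          (\<exists>p. bHE_fun I X Y p) \<and>
          (\<forall>p. bHE_fun I X Y p \<longrightarrow>
            (\<forall>t\<in>I. (bHE p X Y t, bnuHE X Y t, bmuHE p X Y t) = (\<gamma>h t, - \<gamma>hd t, - \<gamma>hs t))))) \<and>
      (let X = bHE \<phi>b \<gamma>d \<gamma>dh; Y = bnuHE \<gamma>d \<gamma>dh in
        (\<exists>a. int_fun Delta1 I t0 X Y a) \<and>
        (\<forall>a. int_fun Delta1 I t0 X Y a \<longrightarrow>
          (\<forall>t\<in>I. (DI a X Y t, HI a X Y t, muI a X Y t)
                   = (- bDP (\<phi>b t0) \<gamma>d \<gamma>dh t, bHP (\<phi>b t0) \<gamma>d \<gamma>dh t, bmuP (\<phi>b t0) \<gamma>d \<gamma>dh t)))))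
    \<and>
    \<comment> \<open>(5)\<close>
    (\<forall>\<psi>b. smooth_on I \<psi>b \<and> (\<forall>t\<in>I. md t * cosh (\<psi>b t) + nd t * sinh (\<psi>b t) = 0) \<longrightarrow>
      (\<forall>a. int_fun Delta5 I t0 \<gamma>T \<gamma>Td a \<longrightarrow>
        (let X = tDI a \<gamma>T \<gamma>Td; Y = tHI a \<gamma>T \<gamma>Td in
          (\<exists>p. bDE_fun I X Y p) \<and>
          (\<forall>p. bDE_fun I X Y p \<longrightarrow>
            (\<forall>t\<in>I. (bDE p X Y t, bnuDE X Y t, bmuDE p X Y t) = (\<gamma>T t, \<gamma>Td t, \<gamma>Th t))))) \<and>
      (let X = bDE \<psi>b \<gamma>d \<gamma>dh; Y = bnuDE \<gamma>d \<gamma>dh in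
        (\<exists>a. int_fun Delta5 I t0 X Y a) \<and>
        (\<forall>a. int_fun Delta5 I t0 X Y a \<longrightarrow>
          (\<forall>t\<in>I. (tDI a X Y t, tHI a X Y t, tmuI a X Y t)
                   = (bDP (\<psi>b t0) \<gamma>d \<gamma>dh t, bHP (\<psi>b t0) \<gamma>d \<gamma>dh t, bmuP (\<psi>b t0) \<gamma>d \<gamma>dh t)))))
    \<and>
    \<comment> \<open>(6)\<close>
    (\<forall>\<psi>. smooth_on I \<psi> \<and> (\<forall>t\<in>I. mh t * sinh (\<psi> t) + nh t * cosh (\<psi> t) = 0) \<longrightarrow>
      (\<forall>a. int_fun Delta5 I t0 \<gamma>T \<gamma>Td a \<longrightarrow>
        (let X = tHI a \<gamma>T \<gamma>Td; Y = tDI a \<gamma>T \<gamma>Td in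
          (\<exists>p. DE_fun I X Y p) \<and>
          (\<forall>p. DE_fun I X Y p \<longrightarrow>
            (\<forall>t\<in>I. (DE p X Y t, nuDE X Y t, muDE p X Y t) = (\<gamma>T t, - \<gamma>Td t, - \<gamma>Th t))))) \<and>
      (let X = DE \<psi> \<gamma>h \<gamma>hd; Y = nuDE \<gamma>h \<gamma>hd in
        (\<exists>a. int_fun Delta5 I t0 X Y a) \<and>
        (\<forall>a. int_fun Delta5 I t0 X Y a \<longrightarrow>
          (\<forall>t\<in>I. (tHI a X Y t, tDI a X Y t, tmuI a X Y t)
                   = (- HP (\<psi> t0) \<gamma>h \<gamma>hd t, DP (\<psi> t0) \<gamma>h \<gamma>hd t, muP (\<psi> t0) \<gamma>h \<gamma>hd t)))))
    \<and>
    \<comment> \<open>(7)\<close>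
    (\<forall>\<phi>t. smooth_on I \<phi>t \<and> (\<forall>t\<in>I. mT t * cos (\<phi>t t) + nT t * sin (\<phi>t t) = 0) \<longrightarrow>
      (\<forall>a. int_fun Delta1bar I t0 \<gamma>d \<gamma>dh a \<longrightarrow>
        (let X = bDI a \<gamma>d \<gamma>dh; Y = bnuDI a \<gamma>d \<gamma>dh;
             E = (\<lambda>p \<epsilon>. \<forall>t\<in>I. (tDE p X Y t, tnuDE X Y t, tmuDE p X Y t)
                               = (\<epsilon> *\<^sub>R \<gamma>d t, \<gamma>dh t, \<epsilon> *\<^sub>R \<gamma>ds t)) in
          (\<forall>\<epsilon>\<in>{1, -1}. \<exists>p. tDE_fun I X Y p \<and> E p \<epsilon>) \<and>
          (\<forall>p. tDE_fun I X Y p \<longrightarrow> (\<exists>\<epsilon>\<in>{1, -1}. E p \<epsilon>)))) \<and>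
      (let X = tDE \<phi>t \<gamma>T \<gamma>Td; Y = tnuDE \<gamma>T \<gamma>Td in
        (\<exists>a. int_fun Delta1bar I t0 X Y a) \<and>
        (\<forall>a. int_fun Delta1bar I t0 X Y a \<longrightarrow>
          (\<forall>t\<in>I. (bDI a X Y t, bnuDI a X Y t, bmuDI a X Y t)
                   = (tDP (\<phi>t t0) \<gamma>T \<gamma>Td t, tnuDP (\<phi>t t0) \<gamma>T \<gamma>Td t, tmuDP (\<phi>t t0) \<gamma>T \<gamma>Td t)))))"
proof (intro conjI, goal_cases)
  case 1
  show ?case
    unfolding Let_def
  proof (intro allI impI ballI conjI, goal_cases)
    case (1 f \<epsilon> J s)
    then have J: "nondeg_interval J" "J \<subseteq> I" and s: "HIh_fun \<epsilon> J \<gamma>h \<gamma>hd s" by auto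
    have dense: "dense_in I (\<lambda>t. nh t + \<epsilon> * mh t \<noteq> 0)"
      using 1(1,2) by blast
    show ?case
      using evolute_of_HIh(1)[OF J(1) legendre_curv_subset[OF h J] 1(2)
          dense_in_subinterval[OF dense J] s] by blast
  next
    case (2 f \<epsilon> J s g t)
    then have J: "nondeg_interval J" "J \<subseteq> I" and s: "HIh_fun \<epsilon> J \<gamma>h \<gamma>hd s" by auto
    have dense: "dense_in I (\<lambda>t. nh t + \<epsilon> * mh t \<noteq> 0)"
      using 2(1,2) by blast
    show ?case
      using evolute_of_HIh(2)[OF J(1) legendre_curv_subset[OF h J] 2(2)
          dense_in_subinterval[OF dense J] s 2(4,5)] by (simp add: hs)
  next
    \<comment> \<open>The mixed formulas are those for \<open>- \<epsilon>\<close> with the second vector reversed.\<close>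
    case (3 f \<epsilon> J s)
    then have J: "nondeg_interval J" "J \<subseteq> I" and s: "HIh_fun (- \<epsilon>) J \<gamma>h \<gamma>hd s"
      and \<epsilon>: "- \<epsilon> \<in> {1, -1}" by auto
    have dense: "dense_in I (\<lambda>t. nh t + (- \<epsilon>) * mh t \<noteq> 0)"
      using 3(1) \<epsilon> by blast
    show ?case
      using HEh_fun_uminus[OF J(1) evolute_of_HIh(1)[OF J(1) legendre_curv_subset[OF h J] \<epsilon>
          dense_in_subinterval[OF dense J] s]] by blast
  next
    case (4 f \<epsilon> J s g t)
    then have J: "nondeg_interval J" "J \<subseteq> I" and s: "HIh_fun (- \<epsilon>) J \<gamma>h \<gamma>hd s"
      and \<epsilon>: "- \<epsilon> \<in> {1, -1}" by auto
    have dense: "dense_in I (\<lambda>t. nh t + (- \<epsilon>) * mh t \<noteq> 0)"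
      using 4(1) \<epsilon> by blast
    have g: "HEh_fun J (HIh (- \<epsilon>) s \<gamma>h \<gamma>hd) (nuHIh (- \<epsilon>) s \<gamma>h \<gamma>hd) (\<lambda>t. - g t)"
      using HEh_fun_uminus[OF J(1) 4(4)] by simp
    show ?case
      using evolute_of_HIh(2)[OF J(1) legendre_curv_subset[OF h J] \<epsilon>
          dense_in_subinterval[OF dense J] s g 4(5)] by (simp add: horocyclic_hyperbolic_uminus hs)
  next
    case (5 f \<epsilon>)
    then show ?case by (intro legendre_curv_HEh[OF I h]) auto
  next
    case (6 f \<epsilon> J S)
    then show ?case by (intro involute_of_HEh(1)[OF I h]) auto
  next
    case (7 f \<epsilon> J S)
    then show ?case by (intro involute_of_HEh(2)[OF I h]) auto
  next
    case (8 f \<epsilon> J S t)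
    then have "smooth_on I f" "\<And>t. t \<in> I \<Longrightarrow> mh t + f t * nh t = 0" "nondeg_interval J" "J \<subseteq> I"
      "solves J (\<lambda>t x. (m_HEh \<epsilon> I f nh t + \<epsilon> * n_HEh \<epsilon> I f nh t) / 2 * x^2 - m_HEh \<epsilon> I f nh t) S"
      by auto
    from involute_of_HEh(3)[OF I h 8(2) this 8(4)] show ?case by simp
  next
    case (9 f \<epsilon> J S)
    then have "- \<epsilon> \<in> {1, -1}" "smooth_on I f" "\<And>t. t \<in> I \<Longrightarrow> mh t + f t * nh t = 0"
      and J: "nondeg_interval J" "J \<subseteq> I"
      and "solves J (\<lambda>t x. (m_HEh (- \<epsilon>) I f nh t + (- \<epsilon>) * n_HEh (- \<epsilon>) I f nh t) / 2 * x^2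
        - m_HEh (- \<epsilon>) I f nh t) S"
      by auto
    from HIh_fun_uminus[OF J(1) involute_of_HEh(1)[OF I h this]] show ?case .
  next
    case (10 f \<epsilon> J S)
    then have "- \<epsilon> \<in> {1, -1}" "smooth_on I f" "\<And>t. t \<in> I \<Longrightarrow> mh t + f t * nh t = 0"
      "nondeg_interval J" "J \<subseteq> I"
      "solves J (\<lambda>t x. (m_HEh (- \<epsilon>) I f nh t + (- \<epsilon>) * n_HEh (- \<epsilon>) I f nh t) / 2 * x^2
        - m_HEh (- \<epsilon>) I f nh t) S"
      by auto
    from involute_of_HEh(2)[OF I h this] show ?case by simp
  next
    case (11 f \<epsilon> J S t)
    then have "- \<epsilon> \<in> {1, -1}" "smooth_on I f" "\<And>t. t \<in> I \<Longrightarrow> mh t + f t * nh t = 0"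
      "nondeg_interval J" "J \<subseteq> I"
      "solves J (\<lambda>t x. (m_HEh (- \<epsilon>) I f nh t + (- \<epsilon>) * n_HEh (- \<epsilon>) I f nh t) / 2 * x^2
        - m_HEh (- \<epsilon>) I f nh t) S"
      by auto
    from involute_of_HEh(3)[OF I h this 11(4)] show ?case by (simp add: horocyclic_hyperbolic_uminus)
  qed
next
  case 2
  show ?case
    unfolding Let_def
  proof (intro allI impI ballI conjI, goal_cases)
    case (1 \<epsilon> J s)
    then have J: "nondeg_interval J" "J \<subseteq> I" and s: "bDIh_fun \<epsilon> J \<gamma>d \<gamma>dh s" by auto
    have dense: "dense_in I (\<lambda>t. nd t - \<epsilon> * md t \<noteq> 0)"
      using 1(1,2) by blast
    show ?case
      using evolute_of_bDIh(1)[OF J(1) legendre_curv_subset[OF d J] 1(2)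
          dense_in_subinterval[OF dense J] s] by blast
  next
    case (2 \<epsilon> J s g t)
    then have J: "nondeg_interval J" "J \<subseteq> I" and s: "bDIh_fun \<epsilon> J \<gamma>d \<gamma>dh s" by auto
    have dense: "dense_in I (\<lambda>t. nd t - \<epsilon> * md t \<noteq> 0)"
      using 2(1,2) by blast
    show ?case
      using evolute_of_bDIh(2)[OF J(1) legendre_curv_subset[OF d J] 2(2)
          dense_in_subinterval[OF dense J] s 2(4,5)] by (simp add: ds)
  next
    case (3 \<epsilon> J s)
    then have J: "nondeg_interval J" "J \<subseteq> I" and s: "bDIh_fun (- \<epsilon>) J \<gamma>d \<gamma>dh s"
      and \<epsilon>: "- \<epsilon> \<in> {1, -1}" by auto
    have dense: "dense_in I (\<lambda>t. nd t - (- \<epsilon>) * md t \<noteq> 0)"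
      using 3(1) \<epsilon> by blast
    show ?case
      using tDEh_fun_uminus[OF J(1) evolute_of_bDIh(1)[OF J(1) legendre_curv_subset[OF d J] \<epsilon>
          dense_in_subinterval[OF dense J] s]] by blast
  next
    case (4 \<epsilon> J s g t)
    then have J: "nondeg_interval J" "J \<subseteq> I" and s: "bDIh_fun (- \<epsilon>) J \<gamma>d \<gamma>dh s"
      and \<epsilon>: "- \<epsilon> \<in> {1, -1}" by auto
    have dense: "dense_in I (\<lambda>t. nd t - (- \<epsilon>) * md t \<noteq> 0)"
      using 4(1) \<epsilon> by blast
    have g: "tDEh_fun J (bDIh (- \<epsilon>) s \<gamma>d \<gamma>dh) (bnuDIh (- \<epsilon>) s \<gamma>d \<gamma>dh) (\<lambda>t. - g t)"
      using tDEh_fun_uminus[OF J(1) 4(4)] by simp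
    show ?case
      using evolute_of_bDIh(2)[OF J(1) legendre_curv_subset[OF d J] \<epsilon>
          dense_in_subinterval[OF dense J] s g 4(5)] by (simp add: horocyclic_de_Sitter_uminus ds)
  next
    case (5 \<epsilon> f)
    then show ?case unfolding tDEh_fun_iff[OF I T] by (intro legendre_curv_tDEh[OF I T]) auto
  next
    case (6 \<epsilon> f J S)
    then show ?case unfolding tDEh_fun_iff[OF I T] by (intro involute_of_tDEh(1)[OF I T]) auto
  next
    case (7 \<epsilon> f J S)
    then show ?case unfolding tDEh_fun_iff[OF I T] by (intro involute_of_tDEh(2)[OF I T]) auto
  next
    case (8 \<epsilon> f J S t)
    then have "smooth_on I f" "\<And>t. t \<in> I \<Longrightarrow> mT t + f t * nT t = 0" "nondeg_interval J" "J \<subseteq> I"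
      "solves J (\<lambda>t x. - ((m_tDEh \<epsilon> I f nT t - \<epsilon> * n_tDEh \<epsilon> I f nT t) / 2) * x^2
        - m_tDEh \<epsilon> I f nT t) S"
      unfolding tDEh_fun_iff[OF I T] by auto
    from involute_of_tDEh(3)[OF I T 8(2) this 8(5)] show ?case by simp
  next
    case (9 \<epsilon> f J S)
    then have "- \<epsilon> \<in> {1, -1}" "smooth_on I f" "\<And>t. t \<in> I \<Longrightarrow> mT t + f t * nT t = 0"
      and J: "nondeg_interval J" "J \<subseteq> I"
      and "solves J (\<lambda>t x. - ((m_tDEh (- \<epsilon>) I f nT t - (- \<epsilon>) * n_tDEh (- \<epsilon>) I f nT t) / 2) * x^2
        - m_tDEh (- \<epsilon>) I f nT t) S"
      unfolding tDEh_fun_iff[OF I T] by auto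
    from bDIh_fun_uminus[OF J(1) involute_of_tDEh(1)[OF I T this]] show ?case .
  next
    case (10 \<epsilon> f J S)
    then have "- \<epsilon> \<in> {1, -1}" "smooth_on I f" "\<And>t. t \<in> I \<Longrightarrow> mT t + f t * nT t = 0"
      "nondeg_interval J" "J \<subseteq> I"
      "solves J (\<lambda>t x. - ((m_tDEh (- \<epsilon>) I f nT t - (- \<epsilon>) * n_tDEh (- \<epsilon>) I f nT t) / 2) * x^2
        - m_tDEh (- \<epsilon>) I f nT t) S"
      unfolding tDEh_fun_iff[OF I T] by auto
    from involute_of_tDEh(2)[OF I T this] show ?case by simp
  next
    case (11 \<epsilon> f J S t)
    then have "- \<epsilon> \<in> {1, -1}" "smooth_on I f" "\<And>t. t \<in> I \<Longrightarrow> mT t + f t * nT t = 0"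
      "nondeg_interval J" "J \<subseteq> I"
      "solves J (\<lambda>t x. - ((m_tDEh (- \<epsilon>) I f nT t - (- \<epsilon>) * n_tDEh (- \<epsilon>) I f nT t) / 2) * x^2
        - m_tDEh (- \<epsilon>) I f nT t) S"
      unfolding tDEh_fun_iff[OF I T] by auto
    from involute_of_tDEh(3)[OF I T this 11(5)] show ?case by (simp add: horocyclic_de_Sitter_uminus)
  qed
next
  case 3
  show ?case
    unfolding Let_def
  proof (intro allI impI conjI, goal_cases)
    case (1 \<phi> a)
    then show ?case using evolute_of_HI(1)[OF I t0 h dense_nh] by blast
  next
    case (2 \<phi> a p)
    then show ?case using evolute_of_HI(2)[OF I t0 h dense_nh] by (simp add: hs)
  next
    case (3 \<phi>)
    then show ?case by (intro involute_of_HE(1)[OF I t0 h]) auto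
  next
    case (4 \<phi> a)
    then show ?case using involute_of_HE(2)[OF I t0 h, of \<phi> a] by simp
  qed
next
  \<comment> \<open>The evolute of \<open>(DI, HI)\<close> is the evolute of \<open>(HI, DI)\<close>, treated in the previous case.\<close>
  case 4
  show ?case
    unfolding Let_def bHE_fun_swap[OF I]
  proof (intro allI impI conjI, goal_cases)
    case (1 \<phi> a)
    then show ?case using evolute_of_HI(1)[OF I t0 h dense_nh] by blast
  next
    case (2 \<phi> a p)
    then show ?case
      using evolute_of_HI(2)[OF I t0 h dense_nh, of a p]
      by (simp add: bnuHE_def nuHE_def bmuHE_def evolute_swap(1) hs
          evolute_swap(3)[where \<gamma> = "HI a \<gamma>h \<gamma>hd" and \<nu> = "DI a \<gamma>h \<gamma>hd"] mu_def[of "bHE _ _ _"]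
          mu_def[of \<gamma>h] lwedge_minus_right)
  next
    case (3 \<phi>)
    then show ?case by (intro involute_of_bHE(1)[OF I t0 d]) auto
  next
    case (4 \<phi> a)
    then show ?case using involute_of_bHE(2)[OF I t0 d, of \<phi> a] by simp
  qed
next
  case 5
  show ?case
    unfolding Let_def
  proof (intro allI impI conjI, goal_cases)
    case (1 \<psi> a)
    then show ?case using evolute_of_tDI(1)[OF I t0 T dense_nT] by blast
  next
    case (2 \<psi> a p)
    then show ?case using evolute_of_tDI(2)[OF I t0 T dense_nT] by (simp add: Th)
  next
    case (3 \<psi>)
    then show ?case by (intro involute_of_bDE(1)[OF I t0 d]) auto
  next
    case (4 \<psi> a)
    then show ?case using involute_of_bDE(2)[OF I t0 d, of \<psi> a] by simp
  qed
next
  \<comment> \<open>The evolute of \<open>(tHI, tDI)\<close> is the evolute of \<open>(tDI, tHI)\<close>, treated in the previous case.\<close>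
  case 6
  show ?case
    unfolding Let_def DE_fun_swap[OF I]
  proof (intro allI impI conjI, goal_cases)
    case (1 \<psi> a)
    then show ?case using evolute_of_tDI(1)[OF I t0 T dense_nT] by blast
  next
    case (2 \<psi> a p)
    then show ?case
      using evolute_of_tDI(2)[OF I t0 T dense_nT, of a p]
      by (simp add: nuDE_def bnuDE_def muDE_def evolute_swap(2) Th
          evolute_swap(3)[where \<gamma> = "tDI a \<gamma>T \<gamma>Td" and \<nu> = "tHI a \<gamma>T \<gamma>Td"] mu_def[of "DE _ _ _"]
          mu_def[of \<gamma>T] lwedge_minus_right)
  next
    case (3 \<psi>)
    then show ?case by (intro involute_of_DE(1)[OF I t0 h]) auto
  next
    case (4 \<psi> a)
    then show ?case using involute_of_DE(2)[OF I t0 h, of \<psi> a] by simp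
  qed
next
  case 7
  show ?case
    unfolding Let_def
  proof (intro allI impI conjI, goal_cases)
    case (1 \<phi> a)
    then show ?case using evolute_of_bDI(1)[OF I t0 d dense_nd] by (simp add: ds)
  next
    case (2 \<phi> a p)
    then show ?case using evolute_of_bDI(2)[OF I t0 d dense_nd] by (simp add: ds)
  next
    case (3 \<phi>)
    then show ?case by (intro involute_of_tDE(1)[OF I t0 T]) auto
  next
    case (4 \<phi> a)
    then show ?case using involute_of_tDE(2)[OF I t0 T, of \<phi> a] by simp
  qed
qed

end
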